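(* Let $G_o$ be a unimodular lcsc group acting jointly continuously on a Polish space $X$, let $Z\subset X$ be a separated cross section with return time set $\Lambda$, let $\mu$ be a $G_o$-invariant Borel probability measure on $X$ with transverse measure $\nu$ on $Z$, and let $r\ge1$. If $\Lambda$ is a uniform approximate lattice in $G_o$, then for every convenient sequence $(G_t)$ of subsets of $G_o$ we have $$\underline{\mathrm{Dens}}_{(G_t)}(Z_{z_1}\cap\dots\cap Z_{z_r})>0$$ for $\nu^{\otimes r}$-almost all $(z_1,\dots,z_r)\in Z^r$.
   Context: lcsc = locally compact second countable; $m_{G_o}$ is a fixed Haar measure on $G_o$. A Borel set $Z\subset X$ is a cross section if $G_o.Z=X$; its return time set is $\Lambda:=\{g\in G_o: g.Z\cap Z\neq\emptyset\}$; $Z$ is separated if $\Lambda\cap U=\{e\}$ for some identity neighbourhood $U$. For $x\in X$ put $Z_x:=\{g\in G_o: g.x\in Z\}$. The transverse measure of $\mu$ is the unique finite Borel measure $\nu$ on $Z$ such that for all bounded non-negative Borel $f:G_o\times Z\to\mathbb R$, $$\int_X\sum_{g\in Z_x}f(g^{-1},g.x)\,d\mu(x)=\int_{G_o}\int_Z f(g,z)\,d\nu(z)\,dm_{G_o}(g).$$ A uniform approximate lattice in $G_o$ is a symmetric subset $\Lambda\ni e$ such that $\Lambda^2\subset\Lambda F$ for some finite $F\subset G_o$, $\Lambda$ is uniformly discrete ($\Lambda\Lambda^{-1}\cap U=\{e\}$ for some identity neighbourhood $U$) and $G_o=K\Lambda$ for some compact $K$. Convenient sequences. For a unimodular lcsc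 group $G$ with Haar measure $m_G$, an open identity neighbourhood $V$ and a pre-compact Borel set $B\subset G$ put $B_V^-:=\bigcap_{v\in V}v^{-1}B$, $B_V^+:=\bigcup_{v\in V}v^{-1}B$. A family $(G_t)$ (indexed by real $t>0$) of pre-compact Borel sets of positive Haar measure is called a convenient sequence if, for some decreasing sequence $(V_n)$ of open identity neighbourhoods: (a) there are sequences $(\delta_n),(\varepsilon_n),(t_n)$ of positive reals with $\delta_n,\varepsilon_n\to0$ such that for all $n$: $G_{t-\delta_n}\subset (G_t)^-_{V_n}\subset (G_t)^+_{V_n}\subset G_{t+\delta_n}$ for all $t>t_n$, and $1-\varepsilon_n\le\liminf_{t\to\infty}\frac{m_G(G_{t-\delta_n})}{m_G(G_t)}$ and $\limsup_{t\to\infty}\frac{m_G(G_{t+\delta_n})}{m_G(G_t)}\le1+\varepsilon_n$; (b) for every standard Borel space $X$ with Borel $G$-action and every bounded real Borel function $\varphi$ on $X$, the set $E_\varphi$ of $x\in X$ for which $\overline\varphi(x):=\lim_{t\to\infty}\frac1{m_G(G_t)}\int_{G_t}\varphi(g.x)\,dm_G(g)$ exists is Borel and is $\mu$-conull for every finite $G$-invariant Borel measure $\mu$ on $X$, the function $\overline\varphi:E_\varphi\to\mathbb R$ is Borel, and for every $G$-ergodic $G$-invariant Borel probability measure $\mu$ there is a $G$-invariant $\mu$-conull Borel set $E_\varphi(\mu)\subset E_\varphi$ with $\overline\varphi(x)=\int\varphi\,d\mu$ for all $x\in E_\varphi(\mu)$. Lower density: $\underline{\mathrm{Dens}}_{(G_t)}(A):=\liminf_{t\to\infty}\frac{|A\cap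 G_t|}{m_{G_o}(G_t)}$. *)

theory Defs
  imports "HOL-Probability.Probability"
begin

text \<open>
  Topological groups are types of class \<^class>\<open>topological_group_add\<close>. The class is not commutative:
  \<open>g + h\<close> stands for the product \<open>gh\<close>, \<open>- g\<close> for the inverse and \<open>0\<close> for the identity \<open>e\<close>.
  Accordingly \<open>g +o B\<close> is the translate \<open>gB\<close> and \<open>A + B\<close>, for sets, is the product set \<open>AB\<close>;
  but \<open>A - B\<close> is the set difference, so that the product set of \<open>A\<close> and the inverse of \<open>B\<close>
  is written \<open>A + uminus ` B\<close>.
\<close>


subsection \<open>Haar measures and unimodularity\<close>

text \<open>
  On a locally compact second countable group every locally finite Borel measure is Radon, so no
  regularity condition is needed.
\<close>

definition haar_measure :: "'g::topological_group_add measure \<Rightarrow> bool" where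
  "haar_measure m \<longleftrightarrow>
     sets m = sets borel \<and>
     emeasure m UNIV \<noteq> 0 \<and>
     (\<forall>K. compact K \<longrightarrow> emeasure m K < \<infinity>) \<and>
     (\<forall>g. distr m m (\<lambda>h. g + h) = m)"

definition unimodular_group :: "'g::topological_group_add itself \<Rightarrow> bool" where
  "unimodular_group _ \<longleftrightarrow>
     (\<forall>m::'g measure. haar_measure m \<longrightarrow> (\<forall>g. distr m m (\<lambda>h. h + g) = m))"


subsection \<open>Group actions\<close>

definition acts_on :: "('g::group_add \<Rightarrow> 'x \<Rightarrow> 'x) \<Rightarrow> 'x set \<Rightarrow> bool" where
  "acts_on act S \<longleftrightarrow>
     (\<forall>g. \<forall>x\<in>S. act g x \<in> S) \<and>
     (\<forall>x\<in>S. act 0 x = x) \<and>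
     (\<forall>g h. \<forall>x\<in>S. act (g + h) x = act g (act h x))"

definition jointly_continuous_action ::
    "('g::topological_group_add \<Rightarrow> 'x::topological_space \<Rightarrow> 'x) \<Rightarrow> bool" where
  "jointly_continuous_action act \<longleftrightarrow>
     acts_on act UNIV \<and> continuous_on UNIV (\<lambda>(g, x). act g x)"

definition borel_action ::
    "('g::topological_group_add \<Rightarrow> 'x \<Rightarrow> 'x) \<Rightarrow> 'x measure \<Rightarrow> bool" where
  "borel_action act M \<longleftrightarrow>
     acts_on act (space M) \<and> (\<lambda>(g, x). act g x) \<in> borel \<Otimes>\<^sub>M M \<rightarrow>\<^sub>M M"

definition invariant_measure :: "('g \<Rightarrow> 'x \<Rightarrow> 'x) \<Rightarrow> 'x measure \<Rightarrow> bool" where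
  "invariant_measure act \<mu> \<longleftrightarrow> (\<forall>g. distr \<mu> \<mu> (act g) = \<mu>)"

definition invariant_set :: "('g \<Rightarrow> 'x \<Rightarrow> 'x) \<Rightarrow> 'x set \<Rightarrow> bool" where
  "invariant_set act A \<longleftrightarrow> (\<forall>g. act g ` A = A)"

definition ergodic_measure :: "('g \<Rightarrow> 'x \<Rightarrow> 'x) \<Rightarrow> 'x measure \<Rightarrow> bool" where
  "ergodic_measure act \<mu> \<longleftrightarrow>
     (\<forall>A\<in>sets \<mu>. invariant_set act A \<longrightarrow>
        emeasure \<mu> A = 0 \<or> emeasure \<mu> (space \<mu> - A) = 0)"


subsection \<open>Cross sections and transverse measures\<close>

definition cross_section ::
    "('g \<Rightarrow> 'x::topological_space \<Rightarrow> 'x) \<Rightarrow> 'x set \<Rightarrow> bool" where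
  "cross_section act Z \<longleftrightarrow> Z \<in> sets borel \<and> (\<Union>g. act g ` Z) = UNIV"

definition return_time_set :: "('g \<Rightarrow> 'x \<Rightarrow> 'x) \<Rightarrow> 'x set \<Rightarrow> 'g set" where
  "return_time_set act Z = {g. act g ` Z \<inter> Z \<noteq> {}}"

definition separated :: "('g::topological_group_add \<Rightarrow> 'x \<Rightarrow> 'x) \<Rightarrow> 'x set \<Rightarrow> bool" where
  "separated act Z \<longleftrightarrow> (\<exists>U. open U \<and> 0 \<in> U \<and> return_time_set act Z \<inter> U = {0})"

definition hitting_times :: "('g \<Rightarrow> 'x \<Rightarrow> 'x) \<Rightarrow> 'x set \<Rightarrow> 'x \<Rightarrow> 'g set" where
  "hitting_times act Z x = {g. act g x \<in> Z}"

text \<open>The possibly infinite sum over \<open>Z\<^sub>x\<close> is an integral against the counting measure.\<close>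

definition transverse_measure ::
    "'g::topological_group_add measure \<Rightarrow> ('g \<Rightarrow> 'x::topological_space \<Rightarrow> 'x) \<Rightarrow>
     'x set \<Rightarrow> 'x measure \<Rightarrow> 'x measure \<Rightarrow> bool" where
  "transverse_measure m act Z \<mu> \<nu> \<longleftrightarrow>
     finite_measure \<nu> \<and> space \<nu> = Z \<and> sets \<nu> = sets (restrict_space borel Z) \<and>
     (\<forall>f :: 'g \<times> 'x \<Rightarrow> real.
        f \<in> borel_measurable (borel \<Otimes>\<^sub>M restrict_space borel Z) \<longrightarrow>
        (\<exists>C. \<forall>g. \<forall>z\<in>Z. 0 \<le> f (g, z) \<and> f (g, z) \<le> C) \<longrightarrow>
        (\<integral>\<^sup>+ x. (\<integral>\<^sup>+ g. ennreal (f (- g, act g x)) \<partial>count_space (hitting_times act Z x)) \<partial>\<mu>) =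
        (\<integral>\<^sup>+ g. (\<integral>\<^sup>+ z. ennreal (f (g, z)) \<partial>\<nu>) \<partial>m))"


subsection \<open>Uniform approximate lattices\<close>

definition uniform_approximate_lattice :: "'g::topological_group_add set \<Rightarrow> bool" where
  "uniform_approximate_lattice L \<longleftrightarrow>
     0 \<in> L \<and> uminus ` L = L \<and>
     (\<exists>F. finite F \<and> L + L \<subseteq> L + F) \<and>
     (\<exists>U. open U \<and> 0 \<in> U \<and> (L + uminus ` L) \<inter> U = {0}) \<and>
     (\<exists>K. compact K \<and> K + L = UNIV)"


subsection \<open>Convenient sequences\<close>

definition standard_borel :: "'x measure \<Rightarrow> bool" where
  "standard_borel M \<longleftrightarrow>
     (\<exists>T. topspace T = space M \<and> completely_metrizable_space T \<and> second_countable T \<and>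
          sets M = sigma_sets (topspace T) {U. openin T U})"

definition inner_set :: "'g::group_add set \<Rightarrow> 'g set \<Rightarrow> 'g set" where
  "inner_set V B = (\<Inter>v\<in>V. (- v) +o B)"

definition outer_set :: "'g::group_add set \<Rightarrow> 'g set \<Rightarrow> 'g set" where
  "outer_set V B = (\<Union>v\<in>V. (- v) +o B)"

definition average ::
    "'g measure \<Rightarrow> (real \<Rightarrow> 'g set) \<Rightarrow> ('g \<Rightarrow> 'x \<Rightarrow> 'x) \<Rightarrow> ('x \<Rightarrow> real) \<Rightarrow> 'x \<Rightarrow> real \<Rightarrow> real" where
  "average m G act \<phi> x t = (LINT g:G t|m. \<phi> (act g x)) / measure m (G t)"

definition convergence_set ::
    "'g measure \<Rightarrow> (real \<Rightarrow> 'g set) \<Rightarrow> ('g \<Rightarrow> 'x \<Rightarrow> 'x) \<Rightarrow> 'x measure \<Rightarrow> ('x \<Rightarrow> real) \<Rightarrow> 'x set" where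
  "convergence_set m G act M \<phi> = {x \<in> space M. \<exists>l. (average m G act \<phi> x \<longlongrightarrow> l) at_top}"

definition limit_average ::
    "'g measure \<Rightarrow> (real \<Rightarrow> 'g set) \<Rightarrow> ('g \<Rightarrow> 'x \<Rightarrow> 'x) \<Rightarrow> ('x \<Rightarrow> real) \<Rightarrow> 'x \<Rightarrow> real" where
  "limit_average m G act \<phi> x = Lim at_top (average m G act \<phi> x)"

text \<open>
  Only the sets \<open>G t\<close> with \<open>t > 0\<close> matter: in the first condition below, \<open>t\<^sub>n\<close> may always be
  enlarged beyond \<open>\<delta>\<^sub>n\<close>.
\<close>

definition regular_family ::
    "'g::topological_group_add measure \<Rightarrow> (real \<Rightarrow> 'g set) \<Rightarrow> bool" where
  "regular_family m G \<longleftrightarrow>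
     (\<exists>V :: nat \<Rightarrow> 'g set. decseq V \<and> (\<forall>n. open (V n) \<and> 0 \<in> V n) \<and>
       (\<exists>\<delta> \<epsilon> T :: nat \<Rightarrow> real.
          (\<forall>n. 0 < \<delta> n \<and> 0 < \<epsilon> n \<and> 0 < T n) \<and> \<delta> \<longlonglongrightarrow> 0 \<and> \<epsilon> \<longlonglongrightarrow> 0 \<and>
          (\<forall>n. \<forall>t > T n.
             G (t - \<delta> n) \<subseteq> inner_set (V n) (G t) \<and>
             inner_set (V n) (G t) \<subseteq> outer_set (V n) (G t) \<and>
             outer_set (V n) (G t) \<subseteq> G (t + \<delta> n)) \<and>
          (\<forall>n.
             ereal (1 - \<epsilon> n) \<le>
               Liminf at_top (\<lambda>t. ereal (measure m (G (t - \<delta> n)) / measure m (G t))) \<and>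
             Limsup at_top (\<lambda>t. ereal (measure m (G (t + \<delta> n)) / measure m (G t)))
               \<le> ereal (1 + \<epsilon> n))))"

text \<open>
  A standard Borel space has at most the cardinality of the continuum, hence is isomorphic to a
  standard Borel structure (not necessarily the induced one) on some subset of the reals. So letting
  \<open>M\<close> range over all standard Borel spaces with underlying type \<^typ>\<open>real\<close> covers all standard Borel
  spaces. Only the space and the sigma-algebra of \<open>M\<close> are used.
\<close>

definition pointwise_ergodic_family ::
    "'g::topological_group_add measure \<Rightarrow> (real \<Rightarrow> 'g set) \<Rightarrow> bool" where
  "pointwise_ergodic_family m G \<longleftrightarrow>
     (\<forall>(M :: real measure) (act :: 'g \<Rightarrow> real \<Rightarrow> real) (\<phi> :: real \<Rightarrow> real).
        standard_borel M \<longrightarrow> borel_action act M \<longrightarrow>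
        \<phi> \<in> borel_measurable M \<longrightarrow> (\<exists>C. \<forall>x\<in>space M. \<bar>\<phi> x\<bar> \<le> C) \<longrightarrow>
        (let E = convergence_set m G act M \<phi> in
          E \<in> sets M \<and>
          (\<forall>\<mu>. finite_measure \<mu> \<longrightarrow> sets \<mu> = sets M \<longrightarrow> invariant_measure act \<mu> \<longrightarrow>
             (AE x in \<mu>. x \<in> E)) \<and>
          limit_average m G act \<phi> \<in> borel_measurable (restrict_space M E) \<and>
          (\<forall>\<mu>. prob_space \<mu> \<longrightarrow> sets \<mu> = sets M \<longrightarrow> invariant_measure act \<mu> \<longrightarrow>
             ergodic_measure act \<mu> \<longrightarrow>
             (\<exists>E'\<in>sets M. E' \<subseteq> E \<and> invariant_set act E' \<and> (AE x in \<mu>. x \<in> E') \<and>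
                (\<forall>x\<in>E'. limit_average m G act \<phi> x = (\<integral>y. \<phi> y \<partial>\<mu>))))))"

definition convenient_sequence ::
    "'g::topological_group_add measure \<Rightarrow> (real \<Rightarrow> 'g set) \<Rightarrow> bool" where
  "convenient_sequence m G \<longleftrightarrow>
     (\<forall>t>0. G t \<in> sets borel \<and> compact (closure (G t)) \<and> 0 < emeasure m (G t)) \<and>
     regular_family m G \<and>
     pointwise_ergodic_family m G"


subsection \<open>Lower density\<close>

definition lower_density ::
    "'g measure \<Rightarrow> (real \<Rightarrow> 'g set) \<Rightarrow> 'g set \<Rightarrow> ennreal" where
  "lower_density m G A =
     Liminf at_top (\<lambda>t. emeasure (count_space UNIV) (A \<inter> G t) / emeasure m (G t))"

end

theory Submission
  imports Defs
begin

text \<open>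
  Let \<open>\<Lambda>\<close> be the return time set. The measure \<open>\<nu>\<close> is invariant under partial translations within
  \<open>Z\<close>, hence extends to a partially invariant measure \<open>\<nu>\<^sub>P\<close> on the saturation \<open>P = \<Lambda>Z\<close>, which is
  finite because \<open>\<Lambda>\<^sup>3\<close>, which contains the return times of \<open>P\<close>, is locally finite. For a compact
  \<open>C \<subseteq> Z\<^sup>r\<close> the restriction of \<open>\<nu>\<^sub>P\<^sup>r\<close> to \<open>\<Lambda>C\<close> is the transverse measure of an invariant measure
  \<open>\<eta>\<close> on \<open>G\<^sub>oC\<close> for the diagonal action, and \<open>\<eta>\<close> is finite because \<open>G\<^sub>oC = K\<Lambda>C\<close> with \<open>K\<close>
  compact.

  The hypothesis on the family \<open>(G\<^sub>t)\<close> identifies the limits of averages only for ergodic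
  measures, and only on invariant conull sets. The ergodic decomposition of \<open>\<eta>\<close> transfers this to
  \<open>\<eta>\<close>: for a small neighbourhood \<open>W\<close> of the identity, the averages of the indicator of \<open>WC\<close> have a
  positive limit at almost every point of \<open>C\<close>. At such a point the visits to \<open>WC\<close> before time \<open>t\<close>
  are covered by translates of \<open>W\<close> by visits to \<open>C\<close> before time \<open>t + \<delta>\<close>, so the latter have
  positive lower density.
\<close>

subsection \<open>Coding Polish spaces by real numbers\<close>

text \<open>Finiteness of the invariant measure cannot be read off from \<open>C\<close>, to which
  an orbit may return arbitrarily late. The orbits return to \<open>\<Lambda>C\<close> within
  bounded time, since \<open>K\<Lambda>\<close> is the whole group, so finitely many small
  translates covering \<open>K\<close> bound the mass. The price is that the return times grow to a
  product of three copies of \<open>\<Lambda>\<close>; this is still locally finite, because it lies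
  in \<open>\<Lambda>F F\<close> with \<open>F\<close> finite. Compactness of \<open>C\<close> makes
  \<open>\<Lambda>C\<close> sigma-compact and \<open>WC\<close> compact, hence both Borel.

  Positivity of the limit almost everywhere on \<open>C\<close> is proved by contradiction.
  Otherwise there is a compact \<open>C'\<close> of positive measure in \<open>C\<close> none of
  whose points has a positive limit, and then \<open>WC'\<close> has positive measure under
  \<open>\<eta>\<close>. Let \<open>\<kappa>\<close> be ergodic. If \<open>WC\<close> is null for
  \<open>\<kappa>\<close>, so is \<open>WC'\<close>. If not, the limit is positive on some invariant
  conull set; this set misses \<open>C'\<close>, hence by invariance it misses \<open>WC'\<close>.
  So \<open>WC'\<close> is null for every ergodic measure, and therefore for
  \<open>\<eta>\<close>.\<close>

lemma ternary_sum:
  fixes b :: "nat \<Rightarrow> bool"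
  shows "summable (\<lambda>i. of_bool (b i) / 3 ^ Suc i :: real)"
    and "0 \<le> (\<Sum>i. of_bool (b i) / 3 ^ Suc i :: real)"
    and "(\<Sum>i. of_bool (b i) / 3 ^ Suc i :: real) < 1"
proof -
  have le: "of_bool (b i) / 3 ^ Suc i \<le> (1/3::real) ^ Suc i" for i
    by (simp add: power_divide divide_right_mono)
  have sg: "(\<lambda>i. (1/3::real) ^ Suc i) sums (1/2)"
    using sums_mult[OF geometric_sums[of "1/3::real"], of "1/3"] by simp
  show summ: "summable (\<lambda>i. of_bool (b i) / 3 ^ Suc i :: real)"
    by (rule summable_comparison_test[OF _ sums_summable[OF sg]]) (use le in auto)
  show "0 \<le> (\<Sum>i. of_bool (b i) / 3 ^ Suc i :: real)"
    by (rule suminf_nonneg[OF summ]) simp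
  have "(\<Sum>i. of_bool (b i) / 3 ^ Suc i) \<le> (\<Sum>i. (1/3::real) ^ Suc i)"
    by (rule suminf_le[OF le summ sums_summable[OF sg]])
  then show "(\<Sum>i. of_bool (b i) / 3 ^ Suc i :: real) < 1"
    using sums_unique[OF sg] by simp
qed

text \<open>Only the digits 0 and 1 occur in base 3, so every tail is at most 1/2 and in particular
  below 1. Hence multiplying by a power of 3 and taking the floor never carries into the digit that
  is read; in base 2 the two expansions of a dyadic number would collide.\<close>

lemma ternary_digit:
  fixes b :: "nat \<Rightarrow> bool"
  shows "\<lfloor>3 ^ Suc n * (\<Sum>i. of_bool (b i) / 3 ^ Suc i :: real)\<rfloor> mod 3 = of_bool (b n)"
proof -
  \<comment> \<open>\<open>S n\<close> is the number whose expansion starts at digit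
    \<open>n\<close>, that is, the fractional part of \<open>3 ^ n * S 0\<close>.\<close>
  define S :: "nat \<Rightarrow> real" where "S n = (\<Sum>i. of_bool (b (i + n)) / 3 ^ Suc i)" for n
  note summ = ternary_sum(1)[of "\<lambda>i. b (i + _)"]
  have S0: "0 \<le> S n" and S1: "S n < 1" for n
    unfolding S_def by (rule ternary_sum)+
  have rec: "3 * S n = of_bool (b n) + S (Suc n)" for n
  proof -
    have "S n = of_bool (b n) / 3 + (\<Sum>i. of_bool (b (Suc i + n)) / 3 ^ Suc (Suc i))"
      unfolding S_def using suminf_split_head[OF summ[of n]] by simp
    also have "(\<Sum>i. of_bool (b (Suc i + n)) / 3 ^ Suc (Suc i)) = S (Suc n) / 3"
      unfolding S_def using suminf_divide[OF summ[of "Suc n"], of 3] by (simp add: mult.commute)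
    finally show ?thesis by simp
  qed
  have "\<exists>k::int. 3 ^ n * S 0 = of_int k + S n" for n
  proof (induction n)
    case 0
    show ?case by (auto intro: exI[of _ 0])
  next
    case (Suc n)
    then obtain k where "3 ^ n * S 0 = of_int k + S n" by blast
    then have "3 ^ Suc n * S 0 = of_int (3 * k + of_bool (b n)) + S (Suc n)"
      using rec[of n] by simp
    then show ?case by blast
  qed
  then obtain k :: int where k: "3 ^ n * S 0 = of_int k + S n" by blast
  then have "3 ^ Suc n * S 0 = of_int (3 * k + of_bool (b n)) + S (Suc n)"
    using rec[of n] by simp
  then have "\<lfloor>3 ^ Suc n * S 0\<rfloor> = 3 * k + of_bool (b n)"
    using S0[of "Suc n"] S1[of "Suc n"] by (intro floor_unique) auto
  moreover have "(3 * k + of_bool (b n)) mod 3 = of_bool (b n)"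
    by (cases "b n") auto
  ultimately show ?thesis unfolding S_def by simp
qed

text \<open>A point is determined by the indices of its first approximations in a countable dense
  sequence, and these indices are stored in the ternary digits of one real number. The pair of Borel
  maps with \<open>j (\<iota> y) = y\<close> serves twice: to move conditional distributions from
  the line to the space, and to reach the hypothesis on the family \<open>G\<close>, which speaks of
  spaces of real numbers.\<close>

proposition polish_space_real_coding:
  obtains \<iota> :: "'y::polish_space \<Rightarrow> real" and j :: "real \<Rightarrow> 'y"
  where "\<iota> \<in> borel_measurable borel" "j \<in> borel_measurable borel" "\<And>y. j (\<iota> y) = y"
    "\<And>y. 0 \<le> \<iota> y" "\<And>y. \<iota> y < 1"
proof -
  obtain D :: "'y set" where D: "countable D" "\<And>X. open X \<Longrightarrow> X \<noteq> {} \<Longrightarrow> \<exists>d\<in>D. d \<in> X"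
    using countable_dense_setE by metis
  define d where "d = from_nat_into D"
  have d: "\<exists>k. dist y (d k) < e" if "0 < e" for y e
  proof -
    obtain x where "x \<in> D" "dist y x < e" using D(2)[of "ball y e"] \<open>0 < e\<close> by force
    then show ?thesis unfolding d_def using from_nat_into_surj[OF D(1)] by metis
  qed
  define K where "K m y = (LEAST k. dist y (d k) < (1/2) ^ m)" for m y
  have K: "dist y (d (K m y)) < (1/2) ^ m" for m y
    unfolding K_def using d[of "(1/2)^m" y] by (auto intro: LeastI_ex)
  have [measurable]: "K m \<in> borel \<rightarrow>\<^sub>M count_space UNIV" for m
    unfolding K_def by measurable
  \<comment> \<open>For each \<open>m\<close> exactly one of the digits at the positions
    \<open>prod_encode (m, k)\<close> is 1, namely the one with \<open>k = K m y\<close>; decoding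
    takes the least such \<open>k\<close>.\<close>
  define b where "b y i = (K (fst (prod_decode i)) y = snd (prod_decode i))" for y i
  define \<iota> where "\<iota> y = (\<Sum>i. of_bool (b y i) / 3 ^ Suc i :: real)" for y
  define dig where "dig t i \<longleftrightarrow> \<lfloor>3 ^ Suc i * t\<rfloor> mod 3 = 1" for i and t :: real
  define K' where "K' m t = (LEAST k. dig t (prod_encode (m, k)))" for m t
  have dig_\<iota>: "dig (\<iota> y) i = b y i" for y i
    unfolding dig_def \<iota>_def ternary_digit by simp
  have K'_\<iota>: "K' m (\<iota> y) = K m y" for m y
    unfolding K'_def dig_\<iota> b_def by (simp add: Least_equality)
  have [measurable]: "K' m \<in> borel \<rightarrow>\<^sub>M count_space UNIV" for m
    unfolding K'_def dig_def by measurable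
  define C where "C = {t. Cauchy (\<lambda>m. d (K' m t))}"
  have mC[measurable]: "(\<lambda>t. d (K' m t)) \<in> borel_measurable borel" for m
    by measurable
  have [measurable]: "C \<in> sets borel"
    using sets_Collect_Cauchy[of "\<lambda>m t. d (K' m t)" borel] unfolding C_def by simp
  \<comment> \<open>Off the Cauchy set the sequence is replaced by the constant \<open>d 0\<close>,
    so that it converges everywhere and its limit is Borel on all of the line.\<close>
  define u where "u m t = (if t \<in> C then d (K' m t) else d 0)" for m t
  define j where "j t = lim (\<lambda>m. u m t)" for t
  have lim: "(\<lambda>m. u m t) \<longlonglongrightarrow> j t" for t
  proof -
    have "Cauchy (\<lambda>m. u m t)"
      by (cases "t \<in> C") (auto simp: u_def C_def convergent_Cauchy convergent_const)
    then show ?thesis unfolding j_def by (simp add: Cauchy_convergent convergent_LIMSEQ_iff[symmetric])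
  qed
  have "u m \<in> borel_measurable borel" for m
    unfolding u_def[abs_def] by measurable
  then have "j \<in> borel_measurable borel"
    using borel_measurable_LIMSEQ_metric[of u borel j] lim by blast
  moreover have "\<iota> \<in> borel_measurable borel"
  proof -
    have [measurable]: "Measurable.pred borel (\<lambda>y. b y i)" for i unfolding b_def by measurable
    show ?thesis unfolding \<iota>_def by measurable
  qed
  moreover have "j (\<iota> y) = y" for y
  proof -
    have conv: "(\<lambda>m. d (K m y)) \<longlonglongrightarrow> y"
    proof (rule tendstoI)
      fix e :: real assume "0 < e"
      have "(\<lambda>m. (1/2::real) ^ m) \<longlonglongrightarrow> 0" by (rule LIMSEQ_realpow_zero) auto
      then have "eventually (\<lambda>m. (1/2::real) ^ m < e) sequentially"
        using \<open>0 < e\<close> order_tendstoD(2) by blast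
      then show "eventually (\<lambda>m. dist (d (K m y)) y < e) sequentially"
        by eventually_elim (metis K dist_commute less_trans)
    qed
    then have "\<iota> y \<in> C" unfolding C_def by (simp add: K'_\<iota> LIMSEQ_imp_Cauchy)
    then have "(\<lambda>m. d (K m y)) \<longlonglongrightarrow> j (\<iota> y)" using lim[of "\<iota> y"] by (simp add: u_def K'_\<iota>)
    then show ?thesis using conv LIMSEQ_unique by blast
  qed
  moreover have "0 \<le> \<iota> y" "\<iota> y < 1" for y
    unfolding \<iota>_def by (rule ternary_sum)+
  ultimately show thesis using that by blast
qed

subsection \<open>Regular conditional probabilities\<close>

text \<open>Strictness makes values at \<open>q n\<close> converge to the infimum over the rationals
  strictly above \<open>t\<close>; monotonicity makes the events \<open>\<xi> \<le> q n\<close>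
  decrease to \<open>\<xi> \<le> t\<close>.\<close>

lemma rat_above_seq:
  fixes t :: real
  obtains q :: "nat \<Rightarrow> rat" where "\<And>n. t < of_rat (q n)" "decseq q" "(\<lambda>n. real_of_rat (q n)) \<longlonglongrightarrow> t"
proof -
  have "\<exists>q::nat \<Rightarrow> rat. \<forall>n. (t < of_rat (q n) \<and> of_rat (q n) < t + 1 / Suc n) \<and> q (Suc n) \<le> q n"
  proof (rule dependent_nat_choice)
    show "\<exists>x. t < real_of_rat x \<and> real_of_rat x < t + 1 / real (Suc 0)"
      using of_rat_dense[of t "t + 1"] by auto
    fix x n assume "t < real_of_rat x \<and> real_of_rat x < t + 1 / real (Suc n)"
    then obtain y where "t < of_rat y" "of_rat y < min (real_of_rat x) (t + 1 / Suc (Suc n))"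
      using of_rat_dense[of t "min (real_of_rat x) (t + 1 / Suc (Suc n))"] by auto
    then show "\<exists>y. (t < real_of_rat y \<and> real_of_rat y < t + 1 / real (Suc (Suc n))) \<and> y \<le> x"
      by (intro exI[of _ y]) (auto simp: of_rat_less)
  qed
  then obtain q :: "nat \<Rightarrow> rat" where q: "\<And>n. t < of_rat (q n)" "\<And>n. of_rat (q n) < t + 1 / Suc n"
    "\<And>n. q (Suc n) \<le> q n" by blast
  have "(\<lambda>n. real_of_rat (q n)) \<longlonglongrightarrow> t"
  proof (rule tendsto_sandwich[of "\<lambda>_. t" _ _ "\<lambda>n. t + 1 / Suc n"])
    show "(\<lambda>n. t + 1 / real (Suc n)) \<longlonglongrightarrow> t"
      using tendsto_add[OF tendsto_const[of t] LIMSEQ_inverse_real_of_nat] by (simp add: inverse_eq_divide)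
  qed (use q in \<open>auto intro!: always_eventually less_imp_le simp del: of_nat_Suc\<close>)
  with q show thesis by (intro that[of q]) (auto intro: decseq_SucI)
qed

text \<open>The conditional expectations of the events \<open>\<xi> \<le> q\<close> with
  \<open>q\<close> rational are corrected on a null set so as to be monotone, regularised from the
  right and turned into measures. The bounds on \<open>\<xi>\<close> fix the values for
  \<open>q < 0\<close> and for \<open>q \<ge> 1\<close>, so the limits at both ends of the line are
  attained and no mass escapes.\<close>

lemma regular_conditional_distribution:
  fixes M F :: "'a measure" and \<xi> :: "'a \<Rightarrow> real"
  assumes "prob_space M" and sub: "subalgebra M F" and \<xi>[measurable]: "\<xi> \<in> borel_measurable M"
    and bnd: "\<And>x. 0 \<le> \<xi> x" "\<And>x. \<xi> x < 1"
  obtains \<kappa> :: "'a \<Rightarrow> real measure"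
  where "\<And>x. real_distribution (\<kappa> x)"
    "\<And>A. A \<in> sets borel \<Longrightarrow> (\<lambda>x. emeasure (\<kappa> x) A) \<in> borel_measurable F"
    "\<And>A B. A \<in> sets borel \<Longrightarrow> B \<in> sets F \<Longrightarrow>
       (\<integral>\<^sup>+x\<in>B. emeasure (\<kappa> x) A \<partial>M) = emeasure M (B \<inter> (\<xi> -` A \<inter> space M))"
proof -
  interpret prob_space M by fact
  interpret finite_measure_subalgebra M F
    using sub by unfold_locales
  note toM = measurable_from_subalg[OF sub]
  have FM: "B \<in> sets F \<Longrightarrow> B \<in> sets M" for B
    using sub unfolding subalgebra_def by auto
  let ?I = "\<lambda>(q::rat) y. indicator {..real_of_rat q} (\<xi> y) :: real"
  define F0 where "F0 q = real_cond_exp M F (?I q)" for q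
  have F0F[measurable]: "F0 q \<in> borel_measurable F" for q
    unfolding F0_def by (rule borel_measurable_cond_exp)
  note [measurable] = toM[OF F0F]
  have intI: "integrable M (?I q)" for q
    by (rule integrable_const_bound[where B=1]) (auto simp: indicator_def)
  have AE_mono: "AE x in M. F0 p x \<le> F0 q x" if "p \<le> q" for p q
    unfolding F0_def by (rule real_cond_exp_mono[OF _ intI intI])
      (use that in \<open>auto simp: indicator_def elim!: order_trans simp: of_rat_less_eq\<close>)
  have AE_0: "AE x in M. F0 q x = 0" if "q < 0" for q
  proof -
    have "?I q y = 0" for y using bnd(1)[of y] that by (auto simp: indicator_def not_le) (metis of_rat_less_0_iff order_le_less_trans not_le)
    then have "?I q = (\<lambda>y. 0)" by auto
    then show ?thesis using real_cond_exp_F_meas[of "\<lambda>y. 0"] by (simp add: F0_def)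
  qed
  have AE_1: "AE x in M. F0 q x = 1" if "1 \<le> q" for q
  proof -
    have "?I q y = 1" for y using bnd(2)[of y] that by (auto simp: indicator_def) (metis less_le_trans less_imp_le of_rat_1 of_rat_less_eq)
    then have "?I q = (\<lambda>y. 1)" by auto
    then show ?thesis using real_cond_exp_F_meas[of "\<lambda>y. 1"] by (simp add: F0_def)
  qed
  \<comment> \<open>\<open>good\<close> is a condition on countably many \<open>F\<close>-measurable
    functions, so a correction outside it stays \<open>F\<close>-measurable. The substitute used in
    \<open>F1\<close> is the distribution function of the point mass at 0.\<close>
  define good where "good x \<longleftrightarrow> (\<forall>p q. p \<le> q \<longrightarrow> F0 p x \<le> F0 q x) \<and> (\<forall>q<0. F0 q x = 0) \<and> (\<forall>q\<ge>1. F0 q x = 1)" for x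
  have good_F[measurable]: "Measurable.pred F good" unfolding good_def by measurable
  have AE_good: "AE x in M. good x"
  proof -
    have "AE x in M. \<forall>p q. p \<le> q \<longrightarrow> F0 p x \<le> F0 q x"
      unfolding AE_all_countable by (intro allI AE_impI AE_mono)
    moreover have "AE x in M. \<forall>q<0. F0 q x = 0"
      unfolding AE_all_countable by (intro allI AE_impI AE_0)
    moreover have "AE x in M. \<forall>q\<ge>1. F0 q x = 1"
      unfolding AE_all_countable by (intro allI AE_impI AE_1)
    ultimately show ?thesis unfolding good_def by eventually_elim blast
  qed
  define F1 where "F1 q x = (if good x then F0 q x else if 0 \<le> q then 1 else 0)" for q x
  have F1F[measurable]: "F1 q \<in> borel_measurable F" for q unfolding F1_def[abs_def] by measurable
  note [measurable] = toM[OF F1F] toM[OF good_F]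
  have F1_mono: "p \<le> q \<Longrightarrow> F1 p x \<le> F1 q x" for p q x
    unfolding F1_def by (auto simp: good_def)
  have F1_0: "q < 0 \<Longrightarrow> F1 q x = 0" for q x unfolding F1_def good_def by auto
  have F1_1: "1 \<le> q \<Longrightarrow> F1 q x = 1" for q x unfolding F1_def good_def by auto
  have F1_ge0: "0 \<le> F1 q x" for q x
    using F1_mono[of "min q (-1)" q x] F1_0[of "min q (-1)" x] by auto
  have F1_le1: "F1 q x \<le> 1" for q x
    using F1_mono[of q "max q 1" x] F1_1[of "max q 1" x] by auto
  have bdd: "bdd_below ((\<lambda>q. F1 q x) ` Q)" for x Q using F1_ge0 by (auto intro!: bdd_belowI)
  define F2 where "F2 t x = (INF q\<in>{q. t < real_of_rat q}. F1 q x)" for t x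
  have ne: "{q. t < real_of_rat q} \<noteq> {}" for t using of_rat_dense[of t "t+1"] by auto
  have F2_lim: "(\<lambda>n. F1 (q n) x) \<longlonglongrightarrow> F2 t x"
    if q: "\<And>n. t < of_rat (q n)" "(\<lambda>n. real_of_rat (q n)) \<longlonglongrightarrow> t" for q :: "nat \<Rightarrow> rat" and t x
  proof (rule order_tendstoI)
    fix a assume "a < F2 t x"
    moreover have "F2 t x \<le> F1 (q n) x" for n unfolding F2_def by (rule cINF_lower[OF bdd]) (use q in auto)
    ultimately have "a < F1 (q n) x" for n by (rule less_le_trans)
    then show "\<forall>\<^sub>F n in sequentially. a < F1 (q n) x" by simp
  next
    fix a assume "F2 t x < a"
    then obtain p where p: "t < real_of_rat p" "F1 p x < a"
      unfolding F2_def cINF_less_iff[OF ne bdd] by auto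
    have "\<forall>\<^sub>F n in sequentially. real_of_rat (q n) < real_of_rat p"
      using order_tendstoD(2)[OF q(2) p(1)] .
    then show "\<forall>\<^sub>F n in sequentially. F1 (q n) x < a"
      by eventually_elim (metis F1_mono less_imp_le of_rat_less order_le_less_trans p(2))
  qed
  have F2_mono: "s \<le> t \<Longrightarrow> F2 s x \<le> F2 t x" for s t x
    unfolding F2_def by (rule cINF_superset_mono[OF ne bdd]) auto
  have F2_0: "F2 t x = 0" if t0: "t < 0" for t x
  proof -
    obtain p where "t < real_of_rat p" "real_of_rat p < 0" using of_rat_dense[OF t0] by auto
    then have "F2 t x \<le> F1 p x" unfolding F2_def by (intro cINF_lower[OF bdd]) auto
    then have "F2 t x \<le> 0" using F1_0[of p x] \<open>real_of_rat p < 0\<close> by (simp add: of_rat_less_0_iff)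
    moreover have "0 \<le> F2 t x" unfolding F2_def by (rule cINF_greatest[OF ne F1_ge0])
    ultimately show ?thesis by simp
  qed
  have F2_1: "F2 t x = 1" if "1 \<le> t" for t x
  proof -
    have "F1 q x = 1" if "t < real_of_rat q" for q
      using F1_1[of q x] that \<open>1 \<le> t\<close> by (metis less_imp_le less_le_trans not_le of_rat_1 of_rat_less order_less_le_trans)
    then show ?thesis unfolding F2_def using ne[of t] by (simp cong: INF_cong_simp)
  qed
  have F2_rc: "continuous (at_right t) (\<lambda>t. F2 t x)" for t x
  proof -
    have "((\<lambda>t. F2 t x) \<longlongrightarrow> F2 t x) (at_right t)"
    proof (rule order_tendstoI)
      fix a assume "a < F2 t x"
      then show "\<forall>\<^sub>F s in at_right t. a < F2 s x"
        using F2_mono[of t _ x] by (auto simp: eventually_at_filter intro!: always_eventually less_le_trans[of a "F2 t x"])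
    next
      fix a assume "F2 t x < a"
      then obtain p where p: "t < real_of_rat p" "F1 p x < a"
        unfolding F2_def cINF_less_iff[OF ne bdd] by auto
      have "F2 s x < a" if "s < real_of_rat p" for s
      proof -
        have "F2 s x \<le> F1 p x" unfolding F2_def by (rule cINF_lower[OF bdd]) (use that in auto)
        then show ?thesis using p by simp
      qed
      then show "\<forall>\<^sub>F s in at_right t. F2 s x < a"
        using p(1) unfolding eventually_at_right[OF p(1)] by auto
    qed
    then show ?thesis unfolding continuous_within .
  qed
  have lim_bot: "((\<lambda>t. F2 t x) \<longlongrightarrow> 0) at_bot" for x
    by (rule tendsto_eventually) (use F2_0 in \<open>auto simp: eventually_at_bot_dense\<close>)
  have lim_top: "((\<lambda>t. F2 t x) \<longlongrightarrow> 1) at_top" for x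
    by (rule tendsto_eventually) (use F2_1 in \<open>auto simp: eventually_at_top_linorder\<close>)
  define \<kappa> where "\<kappa> x = interval_measure (\<lambda>t. F2 t x)" for x
  have rd: "real_distribution (\<kappa> x)" for x
    unfolding \<kappa>_def by (rule real_distribution_interval_measure[OF F2_mono F2_rc lim_bot lim_top])
  have \<kappa>_atMost: "emeasure (\<kappa> x) {..t} = ennreal (F2 t x)" for x t
  proof -
    interpret K: real_distribution "\<kappa> x" by (rule rd)
    have "cdf (\<kappa> x) = (\<lambda>t. F2 t x)"
      unfolding \<kappa>_def by (rule cdf_interval_measure[OF F2_mono F2_rc lim_bot])
    then show ?thesis by (metis K.emeasure_eq_measure cdf_def)
  qed
  have F2F[measurable]: "(\<lambda>x. F2 t x) \<in> borel_measurable F" for t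
  proof -
    obtain q where q: "\<And>n. t < of_rat (q n)" "(\<lambda>n. real_of_rat (q n)) \<longlonglongrightarrow> t"
      by (rule rat_above_seq) blast
    show ?thesis by (rule borel_measurable_LIMSEQ_real[OF F2_lim[OF q]]) auto
  qed
  note [measurable] = toM[OF F2F]
  have F1_int: "(\<integral>x. F1 q x * indicator B x \<partial>M) = measure M (B \<inter> (\<xi> -` {..of_rat q} \<inter> space M))" if B: "B \<in> sets F" for q B
  proof -
    note [measurable] = B FM[OF B]
    have "(\<integral>x. F1 q x * indicator B x \<partial>M) = (\<integral>x. indicator B x * F0 q x \<partial>M)"
      by (rule integral_cong_AE) (use AE_good in \<open>auto simp: F1_def\<close>)
    also have "\<dots> = (\<integral>x. indicator B x * ?I q x \<partial>M)"
      unfolding F0_def by (rule real_cond_exp_intg(2)) (auto intro!: integrable_const_bound[where B=1] simp: indicator_def)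
    also have "\<dots> = (\<integral>x. indicator (B \<inter> (\<xi> -` {..of_rat q} \<inter> space M)) x \<partial>M)"
      by (rule Bochner_Integration.integral_cong) (auto simp: indicator_def)
    also have "\<dots> = measure M (B \<inter> (\<xi> -` {..of_rat q} \<inter> space M))"
      using Bochner_Integration.integral_indicator[of M] by (simp add: Int_assoc)
    finally show ?thesis .
  qed
  have F2_int: "(\<integral>x. F2 t x * indicator B x \<partial>M) = measure M (B \<inter> (\<xi> -` {..t} \<inter> space M))" if B: "B \<in> sets F" for t B
  proof -
    note [measurable] = B FM[OF B]
    obtain q where q: "\<And>n. t < of_rat (q n)" "decseq q" "(\<lambda>n. real_of_rat (q n)) \<longlonglongrightarrow> t"
      by (rule rat_above_seq) blast
    have "(\<lambda>n. \<integral>x. F1 (q n) x * indicator B x \<partial>M) \<longlonglongrightarrow> (\<integral>x. F2 t x * indicator B x \<partial>M)"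
    proof (rule integral_dominated_convergence[where w="\<lambda>_. 1"])
      show "AE x in M. (\<lambda>n. F1 (q n) x * indicator B x) \<longlonglongrightarrow> F2 t x * indicator B x"
        by (intro AE_I2 tendsto_mult F2_lim q tendsto_const)
      show "AE x in M. norm (F1 (q n) x * indicator B x) \<le> 1" for n
        by (rule AE_I2) (use F1_ge0 F1_le1 in \<open>auto simp: indicator_def\<close>)
    qed auto
    moreover have "(\<lambda>n. measure M (B \<inter> (\<xi> -` {..of_rat (q n)} \<inter> space M))) \<longlonglongrightarrow> measure M (\<Inter>n. B \<inter> (\<xi> -` {..of_rat (q n)} \<inter> space M))"
    proof (rule finite_Lim_measure_decseq)
      show "decseq (\<lambda>n. B \<inter> (\<xi> -` {..real_of_rat (q n)} \<inter> space M))"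
        using q(2) unfolding decseq_def by (auto intro: order_trans simp: of_rat_less_eq) (meson of_rat_less_eq order_trans)
    qed auto
    moreover have "(\<Inter>n. B \<inter> (\<xi> -` {..of_rat (q n)} \<inter> space M)) = B \<inter> (\<xi> -` {..t} \<inter> space M)"
      by (auto intro: order_trans[OF _ less_imp_le[OF q(1)]] intro!: LIMSEQ_le_const[OF q(3)])
    ultimately show ?thesis using F1_int[OF B] LIMSEQ_unique by force
  qed
  have F2_ge0: "0 \<le> F2 t x" for t x unfolding F2_def by (rule cINF_greatest[OF ne F1_ge0])
  have F2_le1: "F2 t x \<le> 1" for t x
    using F2_mono[of t "max t 1" x] F2_1[of "max t 1" x] by auto
  \<comment> \<open>A Dynkin induction over the half lines. Measurability and the integral identity
    go through it together, because the integral of a complement or of a disjoint union is computed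
    with the measurability of its parts.\<close>
  have fin: "(\<lambda>x. emeasure (\<kappa> x) A) \<in> borel_measurable F \<and>
      (\<forall>B\<in>sets F. (\<integral>\<^sup>+x\<in>B. emeasure (\<kappa> x) A \<partial>M) = emeasure M (B \<inter> (\<xi> -` A \<inter> space M)))"
    if "A \<in> sets borel" for A
  proof -
    have "A \<in> sigma_sets UNIV (range (\<lambda>a::real. {..a}))"
      using that unfolding borel_eq_atMost by (simp add: image_def)
    then show ?thesis
    proof (induction rule: sigma_sets_induct_disjoint[rotated 2, consumes 1, case_names basic empty compl union])
      case (basic A)
      then obtain t where A: "A = {..t}" by auto
      have "(\<integral>\<^sup>+x\<in>B. ennreal (F2 t x) \<partial>M) = emeasure M (B \<inter> (\<xi> -` {..t} \<inter> space M))" if B: "B \<in> sets F" for B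
      proof -
        note [measurable] = FM[OF B]
        have "(\<integral>\<^sup>+x\<in>B. ennreal (F2 t x) \<partial>M) = (\<integral>\<^sup>+x. ennreal (F2 t x * indicator B x) \<partial>M)"
          by (rule nn_integral_cong) (auto simp: indicator_def)
        also have "\<dots> = ennreal (\<integral>x. F2 t x * indicator B x \<partial>M)"
          by (rule nn_integral_eq_integral) (auto intro!: integrable_const_bound[where B=1] simp: F2_ge0 F2_le1 indicator_def)
        finally show ?thesis by (simp add: F2_int that emeasure_eq_measure)
      qed
      then show ?case by (simp add: A \<kappa>_atMost)
    next
      case empty
      then show ?case by simp
    next
      case (compl A)
      have A: "A \<in> sets borel" using compl(1) unfolding borel_eq_atMost by (simp add: image_def)
      have eq: "emeasure (\<kappa> x) (UNIV - A) = 1 - emeasure (\<kappa> x) A" for x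
      proof -
        interpret K: real_distribution "\<kappa> x" by (rule rd)
        show ?thesis using K.emeasure_space_1 A emeasure_compl[of A "\<kappa> x"] by simp
      qed
      have le1: "emeasure (\<kappa> x) A \<le> 1" for x
      proof -
        interpret K: real_distribution "\<kappa> x" by (rule rd)
        show ?thesis by (rule K.measure_le_1)
      qed
      have mF[measurable]: "(\<lambda>x. emeasure (\<kappa> x) A) \<in> borel_measurable F" using compl by blast
      note [measurable] = toM[OF mF]
      have "(\<integral>\<^sup>+x\<in>B. emeasure (\<kappa> x) (UNIV - A) \<partial>M) = emeasure M (B \<inter> (\<xi> -` (UNIV - A) \<inter> space M))" if B: "B \<in> sets F" for B
      proof -
        note [measurable] = FM[OF B]
        have "(\<integral>\<^sup>+x\<in>B. emeasure (\<kappa> x) (UNIV - A) \<partial>M) = (\<integral>\<^sup>+x. indicator B x - emeasure (\<kappa> x) A * indicator B x \<partial>M)"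
          by (rule nn_integral_cong) (auto simp: eq indicator_def)
        also have "\<dots> = (\<integral>\<^sup>+x. indicator B x \<partial>M) - (\<integral>\<^sup>+x\<in>B. emeasure (\<kappa> x) A \<partial>M)"
        proof (rule nn_integral_diff)
          have "(\<integral>\<^sup>+x\<in>B. emeasure (\<kappa> x) A \<partial>M) \<le> emeasure M B"
            using compl B by (auto intro!: emeasure_mono)
          then show "(\<integral>\<^sup>+x\<in>B. emeasure (\<kappa> x) A \<partial>M) \<noteq> \<infinity>"
            by (metis emeasure_finite infinity_ennreal_def neq_top_trans)
        qed (use le1 in \<open>auto simp: indicator_def\<close>)
        also have "\<dots> = emeasure M B - emeasure M (B \<inter> (\<xi> -` A \<inter> space M))"
          using compl B by simp
        also have "\<dots> = emeasure M (B - (B \<inter> (\<xi> -` A \<inter> space M)))"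
          by (rule emeasure_Diff[symmetric]) (use A in auto)
        also have "B - (B \<inter> (\<xi> -` A \<inter> space M)) = B \<inter> (\<xi> -` (UNIV - A) \<inter> space M)"
          using sets.sets_into_space[OF FM[OF B]] by auto
        finally show ?thesis .
      qed
      then show ?case by (simp add: eq)
    next
      case (union A)
      have A: "A i \<in> sets borel" for i using union(2) unfolding borel_eq_atMost by (auto simp: image_def)
      have eq: "emeasure (\<kappa> x) (\<Union>i. A i) = (\<Sum>i. emeasure (\<kappa> x) (A i))" for x
      proof -
        interpret K: real_distribution "\<kappa> x" by (rule rd)
        show ?thesis by (rule suminf_emeasure[symmetric]) (use A union(1) in auto)
      qed
      have mF[measurable]: "(\<lambda>x. emeasure (\<kappa> x) (A i)) \<in> borel_measurable F" for i using union by blast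
      note [measurable] = toM[OF mF]
      have "(\<integral>\<^sup>+x\<in>B. emeasure (\<kappa> x) (\<Union>i. A i) \<partial>M) = emeasure M (B \<inter> (\<xi> -` (\<Union>i. A i) \<inter> space M))" if B: "B \<in> sets F" for B
      proof -
        note [measurable] = FM[OF B]
        have "(\<integral>\<^sup>+x\<in>B. emeasure (\<kappa> x) (\<Union>i. A i) \<partial>M) = (\<integral>\<^sup>+x. (\<Sum>i. emeasure (\<kappa> x) (A i) * indicator B x) \<partial>M)"
          by (simp add: eq ennreal_suminf_multc)
        also have "\<dots> = (\<Sum>i. \<integral>\<^sup>+x\<in>B. emeasure (\<kappa> x) (A i) \<partial>M)"
          by (rule nn_integral_suminf) simp
        also have "\<dots> = (\<Sum>i. emeasure M (B \<inter> (\<xi> -` A i \<inter> space M)))"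
          using union B by simp
        also have "\<dots> = emeasure M (\<Union>i. B \<inter> (\<xi> -` A i \<inter> space M))"
          by (rule suminf_emeasure) (use A union(1) in \<open>auto simp: disjoint_family_on_def\<close>)
        also have "(\<Union>i. B \<inter> (\<xi> -` A i \<inter> space M)) = B \<inter> (\<xi> -` (\<Union>i. A i) \<inter> space M)" by auto
        finally show ?thesis .
      qed
      then show ?case by (simp add: eq)
    qed (auto simp: Int_stable_def intro!: range_eqI[of _ _ "min _ _"])
  qed
  show thesis
    by (rule that[of \<kappa>]) (use rd fin in auto)
qed

text \<open>The kernel of the coded variable \<open>\<iota>\<close> is pushed back to the space by
  \<open>j\<close>. Since \<open>j\<close> is a left inverse of \<open>\<iota>\<close>, pulling a
  Borel set back along \<open>j\<close> and then along \<open>\<iota>\<close> returns the set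
  itself, so the defining identity survives.\<close>

proposition regular_conditional_probability:
  fixes M F :: "'y::polish_space measure"
  assumes "prob_space M" and sets_M: "sets M = sets borel" and sub: "subalgebra M F"
  obtains \<kappa> :: "'y \<Rightarrow> 'y measure"
  where "\<And>x. prob_space (\<kappa> x)" "\<And>x. sets (\<kappa> x) = sets borel"
    "\<And>A. A \<in> sets borel \<Longrightarrow> (\<lambda>x. emeasure (\<kappa> x) A) \<in> borel_measurable F"
    "\<And>A B. A \<in> sets borel \<Longrightarrow> B \<in> sets F \<Longrightarrow> (\<integral>\<^sup>+x\<in>B. emeasure (\<kappa> x) A \<partial>M) = emeasure M (A \<inter> B)"
    "\<And>f. f \<in> borel_measurable borel \<Longrightarrow> (\<lambda>x. \<integral>\<^sup>+y. f y \<partial>\<kappa> x) \<in> borel_measurable F"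
    "\<And>f. f \<in> borel_measurable borel \<Longrightarrow> (\<integral>\<^sup>+x. \<integral>\<^sup>+y. f y \<partial>\<kappa> x \<partial>M) = (\<integral>\<^sup>+y. f y \<partial>M)"
proof -
  note [measurable_cong] = sets_M
  have spM: "space M = UNIV" using sets_eq_imp_space_eq[OF sets_M] by simp
  obtain \<iota> and j :: "real \<Rightarrow> 'y" where \<iota>: "\<iota> \<in> borel_measurable borel" and j[measurable]: "j \<in> borel_measurable borel"
    and j\<iota>: "\<And>y. j (\<iota> y) = y" and \<iota>01: "\<And>y. 0 \<le> \<iota> y" "\<And>y. \<iota> y < 1"
    by (rule polish_space_real_coding) blast
  have \<iota>M: "\<iota> \<in> borel_measurable M" using \<iota> by measurable
  obtain \<kappa>0 where rd: "\<And>x. real_distribution (\<kappa>0 x)"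
    and m: "\<And>A. A \<in> sets borel \<Longrightarrow> (\<lambda>x. emeasure (\<kappa>0 x) A) \<in> borel_measurable F"
    and i: "\<And>A B. A \<in> sets borel \<Longrightarrow> B \<in> sets F \<Longrightarrow>
       (\<integral>\<^sup>+x\<in>B. emeasure (\<kappa>0 x) A \<partial>M) = emeasure M (B \<inter> (\<iota> -` A \<inter> space M))"
    by (rule regular_conditional_distribution[OF assms(1) sub \<iota>M \<iota>01]) blast
  have jm: "j \<in> \<kappa>0 x \<rightarrow>\<^sub>M borel" for x
    using j rd[of x] by (simp add: real_distribution_def real_distribution_axioms_def cong: measurable_cong_sets)
  have sp0: "space (\<kappa>0 x) = UNIV" for x
    using rd[of x] by (rule real_distribution.space_eq_univ)
  define \<kappa> where "\<kappa> x = distr (\<kappa>0 x) borel j" for x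
  have pr: "prob_space (\<kappa> x)" for x
    unfolding \<kappa>_def using rd[of x] jm by (intro prob_space.prob_space_distr) (auto simp: real_distribution_def)
  have se: "sets (\<kappa> x) = sets borel" for x unfolding \<kappa>_def by simp
  have em: "emeasure (\<kappa> x) A = emeasure (\<kappa>0 x) (j -` A)" if "A \<in> sets borel" for x A
    unfolding \<kappa>_def using emeasure_distr[OF jm that] by (simp add: sp0)
  have jA: "j -` A \<in> sets borel" if "A \<in> sets borel" for A
    using measurable_sets[OF j that] by simp
  have mF: "(\<lambda>x. emeasure (\<kappa> x) A) \<in> borel_measurable F" if "A \<in> sets borel" for A
    using m[OF jA[OF that]] em[OF that] by simp
  have I: "(\<integral>\<^sup>+x\<in>B. emeasure (\<kappa> x) A \<partial>M) = emeasure M (A \<inter> B)" if "A \<in> sets borel" "B \<in> sets F" for A B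
  proof -
    have "\<iota> -` (j -` A) = A" using j\<iota> by auto
    then show ?thesis using i[OF jA[OF that(1)] that(2)] em[OF that(1)] by (simp add: spM Int_commute)
  qed
  have kF: "\<kappa> \<in> F \<rightarrow>\<^sub>M subprob_algebra borel"
    by (rule measurable_subprob_algebra) (use pr se mF in \<open>auto intro: prob_space_imp_subprob_space\<close>)
  have kM: "\<kappa> \<in> M \<rightarrow>\<^sub>M subprob_algebra borel"
    using measurable_from_subalg[OF sub kF] .
  \<comment> \<open>Averaging the kernel over \<open>M\<close> gives back \<open>M\<close>;
    integrals of nonnegative Borel functions then follow from the integral formula for
    \<open>bind\<close>.\<close>
  have bind: "M \<bind> \<kappa> = M"
  proof (rule measure_eqI)
    show s: "sets (M \<bind> \<kappa>) = sets M" using sets_bind[of M \<kappa> borel] se spM sets_M by simp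
    fix A assume "A \<in> sets (M \<bind> \<kappa>)"
    then have A: "A \<in> sets borel" using s sets_M by simp
    have "emeasure (M \<bind> \<kappa>) A = (\<integral>\<^sup>+x. emeasure (\<kappa> x) A \<partial>M)"
      by (rule emeasure_bind[OF _ kM A]) (simp add: spM)
    also have "\<dots> = (\<integral>\<^sup>+x\<in>UNIV. emeasure (\<kappa> x) A \<partial>M)" by simp
    also have "\<dots> = emeasure M (A \<inter> UNIV)"
      by (rule I[OF A]) (metis sets.top spM sub subalgebra_def)
    finally show "emeasure (M \<bind> \<kappa>) A = emeasure M A" by simp
  qed
  show thesis
  proof (rule that[of \<kappa>])
    fix f :: "'y \<Rightarrow> ennreal" assume f[measurable]: "f \<in> borel_measurable borel"
    show "(\<lambda>x. \<integral>\<^sup>+y. f y \<partial>\<kappa> x) \<in> borel_measurable F"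
      using nn_integral_measurable_subprob_algebra[OF f] kF by measurable
    show "(\<integral>\<^sup>+x. \<integral>\<^sup>+y. f y \<partial>\<kappa> x \<partial>M) = (\<integral>\<^sup>+y. f y \<partial>M)"
      using nn_integral_bind[OF f kM] by (simp add: bind)
  qed (use pr se mF I in auto)
qed

subsection \<open>Ergodic decomposition\<close>

lemma invariant_set_iff:
  assumes "acts_on act UNIV" "invariant_set act A"
  shows "act g x \<in> A \<longleftrightarrow> x \<in> A"
proof
  assume "x \<in> A"
  then show "act g x \<in> A" using assms(2) unfolding invariant_set_def by blast
next
  assume "act g x \<in> A"
  then have "act (- g) (act g x) \<in> A" using assms(2) unfolding invariant_set_def by blast
  then show "x \<in> A" using assms(1) unfolding acts_on_def by (metis UNIV_I add.left_inverse)
qed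

lemma jointly_continuous_action_simps:
  fixes act :: "'g::topological_group_add \<Rightarrow> 'x::topological_space \<Rightarrow> 'x"
  assumes "jointly_continuous_action act"
  shows "act 0 x = x" "act (g + h) x = act g (act h x)" "act (- g) (act g x) = x" "act g (act (- g) x) = x"
    and "continuous_on A (act g)" "continuous_on B (\<lambda>g. act g x)"
    and "continuous_on C (\<lambda>(g, x). act g x)"
proof -
  have a: "acts_on act UNIV" and c: "continuous_on UNIV (\<lambda>(g, x). act g x)"
    using assms unfolding jointly_continuous_action_def by auto
  show 1: "act 0 x = x" "act (g + h) x = act g (act h x)" for x g h using a unfolding acts_on_def by auto
  show "act (- g) (act g x) = x" "act g (act (- g) x) = x"
    using 1 by (metis add.left_inverse add.right_inverse)+
  show "continuous_on C (\<lambda>(g, x). act g x)" by (rule continuous_on_subset[OF c]) auto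
  have "continuous_on A (\<lambda>x. (\<lambda>(g, x). act g x) (g, x))"
    by (rule continuous_on_compose2[OF c]) (auto intro!: continuous_intros)
  then show "continuous_on A (act g)" by simp
  have "continuous_on B (\<lambda>g. (\<lambda>(g, x). act g x) (g, x))"
    by (rule continuous_on_compose2[OF c]) (auto intro!: continuous_intros)
  then show "continuous_on B (\<lambda>g. act g x)" by simp
qed

lemma jointly_continuous_action_measurable:
  fixes act :: "'g::topological_group_add \<Rightarrow> 'x::topological_space \<Rightarrow> 'x"
  assumes "jointly_continuous_action act"
  shows "act g \<in> borel \<rightarrow>\<^sub>M borel"
  by (rule borel_measurable_continuous_onI) (rule jointly_continuous_action_simps[OF assms])

text \<open>Averages of translates of \<open>f\<close> with dyadic weights: enough convexity for the parallelogram law.\<close>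

inductive_set orbit_hull :: "('g \<Rightarrow> 'x \<Rightarrow> 'x) \<Rightarrow> ('x \<Rightarrow> real) \<Rightarrow> ('x \<Rightarrow> real) set"
  for act f where
    translate: "(\<lambda>x. f (act g x)) \<in> orbit_hull act f"
  | midpoint: "h \<in> orbit_hull act f \<Longrightarrow> h' \<in> orbit_hull act f \<Longrightarrow> (\<lambda>x. (h x + h' x) / 2) \<in> orbit_hull act f"

lemma orbit_hull_bounds:
  assumes "h \<in> orbit_hull act f" "\<And>x. 0 \<le> f x" "\<And>x. f x \<le> 1"
  shows "0 \<le> h x \<and> h x \<le> 1"
  using assms(1) by induction (use assms in \<open>auto intro: field_le_epsilon\<close>)

lemma orbit_hull_measurable:
  assumes "h \<in> orbit_hull act f" "f \<in> borel_measurable M" "\<And>g. act g \<in> M \<rightarrow>\<^sub>M M"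
  shows "h \<in> borel_measurable M"
  using assms(1)
proof induction
  case (translate g)
  then show ?case using measurable_compose[OF assms(3,2)] .
next
  case (midpoint h h')
  then show ?case by measurable
qed

lemma orbit_hull_shift:
  assumes "h \<in> orbit_hull act f" "\<And>g g' x. act (g + g') x = act g (act g' x)"
  shows "(\<lambda>x. h (act g x)) \<in> orbit_hull act f"
  using assms(1)
proof induction
  case (translate g')
  have "(\<lambda>x. f (act g' (act g x))) = (\<lambda>x. f (act (g' + g) x))" using assms(2) by simp
  then show ?case by (simp only: orbit_hull.translate)
next
  case (midpoint h h')
  show ?case by (rule orbit_hull.midpoint[OF midpoint(3,4)])
qed

text \<open>Translation changes neither \<open>M\<close> nor, up to null sets, \<open>B\<close>, so
  a translate of \<open>f\<close> keeps its integral over \<open>B\<close>, and midpoints follow by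
  linearity. This fixes the integral over \<open>B\<close> of any bounded limit of hull
  elements.\<close>

lemma orbit_hull_integral:
  assumes "finite_measure M" "invariant_measure act M" "\<And>g. act g \<in> M \<rightarrow>\<^sub>M M"
    and f: "f \<in> borel_measurable M" "\<And>x. 0 \<le> f x" "\<And>x. f x \<le> 1"
    and B: "B \<in> sets M" "\<And>g. AE x in M. act g x \<in> B \<longleftrightarrow> x \<in> B"
    and h: "h \<in> orbit_hull act f"
  shows "(\<integral>x. indicator B x * h x \<partial>M) = (\<integral>x. indicator B x * f x \<partial>M)"
proof -
  interpret finite_measure M by fact
  note [measurable] = assms(3) B(1) f(1)
  show ?thesis
    using h
  proof induction
    case (translate g)
    have "(\<integral>x. indicator B x * f x \<partial>M) = (\<integral>x. indicator B x * f x \<partial>distr M M (act g))"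
      using assms(2) by (simp add: invariant_measure_def)
    also have "\<dots> = (\<integral>x. indicator B (act g x) * f (act g x) \<partial>M)"
      by (rule integral_distr) measurable
    also have "\<dots> = (\<integral>x. indicator B x * f (act g x) \<partial>M)"
      by (rule integral_cong_AE) (use B(2)[of g] in \<open>auto simp: indicator_def\<close>)
    finally show ?case by simp
  next
    case (midpoint h h')
    have *: "integrable M (\<lambda>x. indicator B x * k x)" if "k \<in> orbit_hull act f" for k
      using orbit_hull_measurable[OF that f(1) assms(3)] orbit_hull_bounds[OF that f(2,3)]
      by (intro integrable_const_bound[where B=1]) (auto simp: indicator_def)
    have "(\<integral>x. indicator B x * ((h x + h' x) / 2) \<partial>M) = (\<integral>x. (indicator B x * h x + indicator B x * h' x) / 2 \<partial>M)"
      by (rule Bochner_Integration.integral_cong) (auto simp: algebra_simps)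
    then show ?case using midpoint * by simp
  qed
qed

text \<open>Square integrals of order \<open>(1/16) ^ n\<close> give integrals of order
  \<open>(1/4) ^ n\<close>, so the sum of the absolute values has a finite integral and is finite
  almost everywhere.\<close>

lemma AE_summable_of_square_integrals:
  fixes u :: "nat \<Rightarrow> 'a \<Rightarrow> real"
  assumes "finite_measure M" and [measurable]: "\<And>n. u n \<in> borel_measurable M"
    and bnd: "\<And>n x. \<bar>u n x\<bar> \<le> 1" and sq: "\<And>n. (\<integral>x. (u n x)\<^sup>2 \<partial>M) \<le> C * (1/16) ^ n"
  shows "AE x in M. summable (\<lambda>n. \<bar>u n x\<bar>)"
proof -
  interpret finite_measure M by fact
  define D where "D = (measure M (space M) + C) / 2"
  have int: "integrable M (\<lambda>x. \<bar>u n x\<bar>)" "integrable M (\<lambda>x. (u n x)\<^sup>2)" for n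
    by (rule integrable_const_bound[where B=1], use bnd[of n] in \<open>auto simp: abs_square_le_1\<close>)+
  have le: "(\<integral>x. \<bar>u n x\<bar> \<partial>M) \<le> D * (1/4) ^ n" for n
  proof -
    \<comment> \<open>The inequality between arithmetic and geometric mean. The factor
      \<open>4 ^ n\<close> is chosen so that both terms end up of order
      \<open>(1/4) ^ n\<close>.\<close>
    have "\<bar>t\<bar> \<le> ((1/4) ^ n + 4 ^ n * t\<^sup>2) / 2" for t :: real
    proof -
      have "0 \<le> 4 ^ n * (\<bar>t\<bar> - (1/4) ^ n)\<^sup>2" by simp
      also have "\<dots> = 4 ^ n * t\<^sup>2 - 2 * \<bar>t\<bar> * (4 ^ n * (1/4) ^ n) + (4 ^ n * (1/4) ^ n) * (1/4) ^ n"
        by (simp add: power2_diff algebra_simps power2_eq_square)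
      also have "(4::real) ^ n * (1/4) ^ n = 1" by (simp add: power_mult_distrib[symmetric])
      finally show ?thesis by simp
    qed
    then have "(\<integral>x. \<bar>u n x\<bar> \<partial>M) \<le> (\<integral>x. ((1/4) ^ n + 4 ^ n * (u n x)\<^sup>2) / 2 \<partial>M)"
      using int by (intro integral_mono) auto
    also have "\<dots> = ((1/4) ^ n * measure M (space M) + 4 ^ n * (\<integral>x. (u n x)\<^sup>2 \<partial>M)) / 2"
      using int by (simp add: mult.commute)
    also have "\<dots> \<le> ((1/4) ^ n * measure M (space M) + 4 ^ n * (C * (1/16) ^ n)) / 2"
      using sq by simp
    also have "4 ^ n * (C * (1/16) ^ n) = C * (1/4 :: real) ^ n"
      by (simp add: power_mult_distrib[symmetric] mult.left_commute)
    finally show ?thesis by (simp add: D_def algebra_simps)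
  qed
  have "(\<integral>\<^sup>+x. (\<Sum>n. ennreal \<bar>u n x\<bar>) \<partial>M) = (\<Sum>n. \<integral>\<^sup>+x. ennreal \<bar>u n x\<bar> \<partial>M)"
    by (rule nn_integral_suminf) simp
  also have "\<dots> = (\<Sum>n. ennreal (\<integral>x. \<bar>u n x\<bar> \<partial>M))"
    using nn_integral_eq_integral[OF int(1)] by simp
  also have "\<dots> < \<infinity>"
  proof -
    have "summable (\<lambda>n. \<integral>x. \<bar>u n x\<bar> \<partial>M)"
      by (rule summable_comparison_test[of _ "\<lambda>n. D * (1/4) ^ n"]) (use le in \<open>auto intro!: summable_mult summable_geometric\<close>)
    then show ?thesis by (simp add: suminf_ennreal2 ennreal_suminf_neq_top less_top)
  qed
  finally have "AE x in M. (\<Sum>n. ennreal \<bar>u n x\<bar>) \<noteq> \<infinity>"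
    by (intro nn_integral_PInf_AE) auto
  then show ?thesis
    by eventually_elim (rule summable_suminf_not_top, auto)
qed

text \<open>A sequence in the hull that nearly minimises the \<open>L^2\<close> norm converges, by
  the parallelogram law. Its translate by \<open>g\<close> lies in the hull and has the same norms,
  so it is just as close to minimal and has the same limit; this makes \<open>f'\<close> invariant
  under each \<open>g\<close> almost everywhere. The \<open>h n\<close> are functions rather than
  classes modulo \<open>M\<close>, so they can later be integrated against conditional measures as
  well.\<close>

lemma orbit_hull_limit:
  fixes act :: "'g::group_add \<Rightarrow> 'x \<Rightarrow> 'x"
  assumes "finite_measure M" and inv: "invariant_measure act M" and am[measurable]: "\<And>g. act g \<in> M \<rightarrow>\<^sub>M M"
    and add: "\<And>g g' x. act (g + g') x = act g (act g' x)"
    and f: "f \<in> borel_measurable M" "\<And>x. 0 \<le> f x" "\<And>x. f x \<le> 1"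
  obtains h f' where "\<And>n::nat. h n \<in> orbit_hull act f" "f' \<in> borel_measurable M"
    "AE x in M. (\<lambda>n. h n x) \<longlonglongrightarrow> f' x" "\<And>g. AE x in M. f' (act g x) = f' x"
proof -
  interpret finite_measure M by fact
  note [measurable] = orbit_hull_measurable[OF _ f(1) am]
  note b = orbit_hull_bounds[OF _ f(2,3)]
  let ?H = "orbit_hull act f"
  let ?N = "\<lambda>h. \<integral>x. (h x)\<^sup>2 \<partial>M"
  define d where "d = (INF h\<in>?H. ?N h)"
  have bdd: "bdd_below (?N ` ?H)" by (auto intro!: bdd_belowI[of _ 0] integral_nonneg_AE)
  have ne: "?H \<noteq> {}" using orbit_hull.translate by fast
  have int: "integrable M (\<lambda>x. h x * k x)" if "h \<in> ?H" "k \<in> ?H" for h k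
    using b[OF that(1)] b[OF that(2)] that
    by (intro integrable_const_bound[where B=1]) (auto simp: abs_mult intro!: mult_le_one)
  \<comment> \<open>The midpoint of \<open>h\<close> and \<open>k\<close> is in the hull, so its
    squared norm is at least \<open>d\<close>; by the parallelogram law the squared distance is at
    most \<open>4 * (d + e) - 4 * d\<close>.\<close>
  have para: "(\<integral>x. (h x - k x)\<^sup>2 \<partial>M) \<le> 4 * e" if h: "h \<in> ?H" "k \<in> ?H" "?N h \<le> d + e" "?N k \<le> d + e" for h k e
  proof -
    have "d \<le> ?N (\<lambda>x. (h x + k x) / 2)"
      unfolding d_def by (rule cINF_lower[OF bdd]) (rule orbit_hull.midpoint[OF h(1,2)])
    also have "\<dots> = (\<integral>x. (h x * h x + 2 * (h x * k x) + k x * k x) / 4 \<partial>M)"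
      by (rule Bochner_Integration.integral_cong) (auto simp: power2_eq_square field_simps)
    also have "\<dots> = ((\<integral>x. h x * h x \<partial>M) + 2 * (\<integral>x. h x * k x \<partial>M) + (\<integral>x. k x * k x \<partial>M)) / 4"
      using int h by simp
    finally have 1: "4 * d \<le> (\<integral>x. h x * h x \<partial>M) + 2 * (\<integral>x. h x * k x \<partial>M) + (\<integral>x. k x * k x \<partial>M)" by simp
    have "(\<integral>x. (h x - k x)\<^sup>2 \<partial>M) = (\<integral>x. h x * h x - 2 * (h x * k x) + k x * k x \<partial>M)"
      by (rule Bochner_Integration.integral_cong) (auto simp: power2_eq_square field_simps)
    also have "\<dots> = (\<integral>x. h x * h x \<partial>M) - 2 * (\<integral>x. h x * k x \<partial>M) + (\<integral>x. k x * k x \<partial>M)"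
      using int h by simp
    finally show ?thesis using 1 h(3,4) by (simp add: power2_eq_square)
  qed
  have "\<exists>h\<in>?H. ?N h < d + (1/16) ^ n" for n
    using cINF_less_iff[OF ne bdd, of "d + (1/16)^n"] by (simp add: d_def)
  then obtain h where h: "\<And>n. h n \<in> ?H" "\<And>n. ?N (h n) < d + (1/16) ^ n" by metis
  have hm[measurable]: "h n \<in> borel_measurable M" for n using h(1) by measurable
  define f' where "f' x = lim (\<lambda>n. h n x)" for x
  have f'm[measurable]: "f' \<in> borel_measurable M" unfolding f'_def[abs_def] by measurable
  have dif: "\<bar>k x - k' x\<bar> \<le> 1" if "k \<in> ?H" "k' \<in> ?H" for k k' x
    using b[OF that(1), of x] b[OF that(2), of x] by auto
  have "AE x in M. summable (\<lambda>n. \<bar>h (Suc n) x - h n x\<bar>)"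
  proof (rule AE_summable_of_square_integrals[where C=4])
    show "(\<integral>x. (h (Suc n) x - h n x)\<^sup>2 \<partial>M) \<le> 4 * (1/16) ^ n" for n
    proof (rule para)
      have "?N (h (Suc n)) < d + (1/16) ^ Suc n" by (rule h)
      also have "\<dots> \<le> d + (1/16) ^ n" by simp
      finally show "?N (h (Suc n)) \<le> d + (1/16) ^ n" by simp
    qed (use h less_imp_le in auto)
  qed (use h dif in \<open>auto intro: finite_measure_axioms\<close>)
  then have lim: "AE x in M. (\<lambda>n. h n x) \<longlonglongrightarrow> f' x"
  proof eventually_elim
    case (elim x)
    have "summable (\<lambda>n. h (Suc n) x - h n x)" by (rule summable_rabs_cancel[OF elim])
    then obtain l where "(\<lambda>n. \<Sum>i<n. h (Suc i) x - h i x) \<longlonglongrightarrow> l" unfolding summable_def sums_def by blast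
    then have "(\<lambda>n. h n x - h 0 x) \<longlonglongrightarrow> l" 
      using sum_lessThan_telescope[of "\<lambda>n. h n x"] by simp
    then have "(\<lambda>n. h n x - h 0 x + h 0 x) \<longlonglongrightarrow> l + h 0 x" by (intro tendsto_intros)
    then have "(\<lambda>n. h n x) \<longlonglongrightarrow> l + h 0 x" by simp
    then show ?case unfolding f'_def by (metis limI)
  qed
  moreover have "AE x in M. f' (act g x) = f' x" for g
  proof -
    have sh: "(\<lambda>x. h n (act g x)) \<in> ?H" for n by (rule orbit_hull_shift[OF h(1) add])
    have D: "distr M M (act g) = M" using inv by (simp add: invariant_measure_def)
    have "AE x in M. summable (\<lambda>n. \<bar>h n (act g x) - h n x\<bar>)"
    proof (rule AE_summable_of_square_integrals[where C=4])
      show "(\<integral>x. (h n (act g x) - h n x)\<^sup>2 \<partial>M) \<le> 4 * (1/16) ^ n" for n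
      proof (rule para[OF sh h(1)])
        have "?N (h n) = (\<integral>x. (h n x)\<^sup>2 \<partial>distr M M (act g))" by (simp add: D)
        also have "\<dots> = ?N (\<lambda>x. h n (act g x))" by (rule integral_distr) measurable
        finally show "?N (\<lambda>x. h n (act g x)) \<le> d + (1/16) ^ n" using h(2)[of n] by simp
      qed (use h(2)[of n] in simp)
    qed (use h sh dif[OF sh h(1)] in \<open>auto intro: finite_measure_axioms\<close>)
    moreover have "AE x in distr M M (act g). (\<lambda>n. h n x) \<longlonglongrightarrow> f' x" by (simp only: D lim)
    then have "AE x in M. (\<lambda>n. h n (act g x)) \<longlonglongrightarrow> f' (act g x)" by (rule AE_distrD[OF am[of g]])
    ultimately show ?thesis using lim
    proof eventually_elim
      case (elim x)
      have "(\<lambda>n. \<bar>h n (act g x) - h n x\<bar>) \<longlonglongrightarrow> 0" by (rule summable_LIMSEQ_zero[OF elim(1)])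
      then have "(\<lambda>n. h n (act g x) - h n x) \<longlonglongrightarrow> 0" by (simp add: tendsto_rabs_zero_iff)
      moreover have "(\<lambda>n. h n (act g x) - h n x) \<longlonglongrightarrow> f' (act g x) - f' x"
        using elim by (intro tendsto_intros)
      ultimately show ?case using LIMSEQ_unique by fastforce
    qed
  qed
  ultimately show thesis using that[of h f'] h(1) f'm by blast
qed

section \<open>Testing measures and their invariance on countably many sets\<close>

lemma open_generating_pi_system:
  obtains A :: "'y::second_countable_topology set set"
  where "countable A" "Int_stable A" "\<And>U. U \<in> A \<Longrightarrow> open U" "UNIV \<in> A" "sets borel = sigma_sets UNIV A"
proof -
  obtain B :: "'y set set" where B: "countable B" "topological_basis B"
    using ex_countable_basis by blast
  define A where "A = Inter ` {F. finite F \<and> F \<subseteq> B}"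
  have 1: "countable A" unfolding A_def using B(1) by (intro countable_image countable_Collect_finite_subset)
  have 2: "Int_stable A"
  proof (rule Int_stableI)
    fix a b assume "a \<in> A" "b \<in> A"
    then obtain F F' where "a = \<Inter>F" "b = \<Inter>F'" "finite F" "finite F'" "F \<subseteq> B" "F' \<subseteq> B"
      unfolding A_def by auto
    then show "a \<inter> b \<in> A" unfolding A_def by (intro image_eqI[of _ _ "F \<union> F'"]) auto
  qed
  have 3: "open U" if "U \<in> A" for U
  proof -
    obtain F where "U = \<Inter>F" "finite F" "F \<subseteq> B" using \<open>U \<in> A\<close> unfolding A_def by auto
    then show ?thesis using topological_basis_open[OF B(2)] by (auto intro!: open_Inter)
  qed
  have 4: "UNIV \<in> A" unfolding A_def by (auto intro!: image_eqI[of _ _ "{}"])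
  have "B \<subseteq> A" unfolding A_def by (auto intro!: image_eqI[of _ _ "{_}"])
  have B': "sets borel = sigma_sets UNIV B"
    using arg_cong[OF borel_eq_countable_basis[OF B], of sets] by simp
  also have "\<dots> = sigma_sets UNIV A"
  proof
    show "sigma_sets UNIV B \<subseteq> sigma_sets UNIV A" by (rule sigma_sets_mono') fact
    show "sigma_sets UNIV A \<subseteq> sigma_sets UNIV B"
      unfolding B'[symmetric] using sets.sigma_sets_subset[of A "borel :: 'y measure"] 3
      by (metis borel_open space_borel subsetI)
  qed
  finally show thesis using that 1 2 3 4 by blast
qed

lemma measure_eqI_open_pi_system:
  fixes M N :: "'y::topological_space measure"
  assumes "finite_measure M" "sets M = sets borel" "sets N = sets borel"
    and A: "Int_stable A" "UNIV \<in> A" "sets borel = sigma_sets UNIV A"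
    and eq: "\<And>U. U \<in> A \<Longrightarrow> emeasure M U = emeasure N U"
  shows "M = N"
proof (rule measure_eqI_generator_eq[where E=A and \<Omega>=UNIV and A="\<lambda>_. UNIV"])
  show "emeasure M UNIV \<noteq> \<infinity>"
    using finite_measure.emeasure_finite[OF assms(1)] by simp
qed (use assms in auto)

text \<open>An almost everywhere argument about kernels yields invariance for countably many group
  elements only. If \<open>s n\<close> tends to \<open>g\<close> and \<open>act g y\<close> lies in
  an open \<open>U\<close>, then \<open>act (s n) y\<close> lies in \<open>U\<close> eventually; so
  Fatou's lemma bounds the measure of the preimage of \<open>U\<close> under \<open>act g\<close> by
  that of \<open>U\<close>. The same bound for \<open>- g\<close> gives equality.\<close>

lemma invariant_measure_of_dense:
  fixes act :: "'g::{topological_group_add, first_countable_topology} \<Rightarrow> 'y::second_countable_topology \<Rightarrow> 'y"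
  assumes act: "jointly_continuous_action act" and "closure D = UNIV"
    and K: "finite_measure K" "sets K = sets borel"
    and D: "\<And>g U. g \<in> D \<Longrightarrow> open U \<Longrightarrow> emeasure K (act g -` U) = emeasure K U"
  shows "invariant_measure act K"
proof -
  interpret finite_measure K by fact
  note [measurable_cong] = K(2)
  note am[measurable] = jointly_continuous_action_measurable[OF act]
  have sp: "space K = UNIV" using sets_eq_imp_space_eq[OF K(2)] by simp
  have le: "emeasure K (act g -` U) \<le> emeasure K U" if U: "open U" for g U
  proof -
    have [measurable]: "U \<in> sets borel" using U by simp
    obtain s where s: "\<And>n. s n \<in> D" "s \<longlonglongrightarrow> g"
      using assms(2) closure_sequential[of g D] by auto
    have ind: "indicator U (act g y) \<le> liminf (\<lambda>n. indicator U (act (s n) y) :: ennreal)" for y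
    proof (cases "act g y \<in> U")
      case True
      have "(\<lambda>n. act (s n) y) \<longlonglongrightarrow> act g y"
        using continuous_on_tendsto_compose[OF jointly_continuous_action_simps(6)[OF act, of UNIV] s(2)] by simp
      then have "eventually (\<lambda>n. act (s n) y \<in> U) sequentially"
        using topological_tendstoD[OF _ U True] by blast
      then have "eventually (\<lambda>n. 1 \<le> (indicator U (act (s n) y) :: ennreal)) sequentially"
        by eventually_elim simp
      then show ?thesis using Liminf_bounded[of 1] True by simp
    qed simp
    have ie: "(\<integral>\<^sup>+y. indicator U (act h y) \<partial>K) = emeasure K (act h -` U)" for h
    proof -
      have "(\<integral>\<^sup>+y. indicator U (act h y) \<partial>K) = (\<integral>\<^sup>+y. indicator (act h -` U) y \<partial>K)"
        by (rule nn_integral_cong) (auto simp: indicator_def)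
      also have "\<dots> = emeasure K (act h -` U)"
        using measurable_sets[OF am[of h], of U] by (intro nn_integral_indicator) (simp add: K(2))
      finally show ?thesis .
    qed
    have "emeasure K (act g -` U) \<le> (\<integral>\<^sup>+y. liminf (\<lambda>n. indicator U (act (s n) y)) \<partial>K)"
      unfolding ie[symmetric] by (rule nn_integral_mono) (rule ind)
    also have "\<dots> \<le> liminf (\<lambda>n. \<integral>\<^sup>+y. indicator U (act (s n) y) \<partial>K)"
      by (rule nn_integral_liminf) measurable
    also have "\<dots> = emeasure K U" using D[OF s(1) U] by (simp add: ie Liminf_const)
    finally show ?thesis .
  qed
  have eq: "emeasure K (act g -` U) = emeasure K U" if U: "open U" for g U
  proof (rule antisym[OF le[OF U]])
    have "open (act g -` U)"
      using open_vimage[OF U] jointly_continuous_action_simps(5)[OF act, of UNIV] by blast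
    from le[OF this, of "- g"] show "emeasure K U \<le> emeasure K (act g -` U)"
      by (simp add: vimage_def jointly_continuous_action_simps[OF act])
  qed
  obtain A :: "'y set set" where A: "Int_stable A" "\<And>U. U \<in> A \<Longrightarrow> open U" "UNIV \<in> A" "sets borel = sigma_sets UNIV A"
    by (rule open_generating_pi_system) blast
  show ?thesis unfolding invariant_measure_def
  proof
    fix g
    show "distr K K (act g) = K"
    proof (rule measure_eqI_open_pi_system[OF _ _ _ A(1,3,4)])
      show "finite_measure (distr K K (act g))" by (rule finite_measure_distr) measurable
      show "emeasure (distr K K (act g)) U = emeasure K U" if "U \<in> A" for U
        using eq[OF A(2)[OF that]] A(2)[OF that] by (subst emeasure_distr) (auto simp: K(2) sp)
    qed (use K in auto)
  qed
qed

lemma countable_dense_closure: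
  obtains D :: "'a::second_countable_topology set" where "countable D" "closure D = UNIV"
proof -
  obtain D :: "'a set" where D: "countable D" "\<And>X. open X \<Longrightarrow> X \<noteq> {} \<Longrightarrow> \<exists>d\<in>D. d \<in> X"
    by (rule countable_dense_setE) blast
  have "x \<in> closure D" for x
    unfolding closure_iff_nhds_not_empty using D(2) by (metis disjoint_iff empty_iff subsetD)
  with D(1) show thesis using that by auto
qed

text \<open>The components are the conditional measures given the almost invariant sets. Their
  invariance reduces to countably many conditions. Ergodicity concerns uncountably many invariant
  sets, so the exceptional null set must be found before an invariant set is chosen. For each
  \<open>U\<close> in a countable generator, a hull sequence starting from its indicator converges
  to a constant almost everywhere for almost every component, and this alone makes \<open>U\<close>
  independent of all invariant sets.\<close>

proposition ergodic_decomposition: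
  fixes act :: "'g::{topological_group_add, second_countable_topology} \<Rightarrow> 'y::polish_space \<Rightarrow> 'y"
  assumes act: "jointly_continuous_action act"
    and "prob_space M" and sets_M: "sets M = sets borel" and inv: "invariant_measure act M"
  obtains \<kappa> :: "'y \<Rightarrow> 'y measure"
  where "\<And>x. prob_space (\<kappa> x)" "\<And>x. sets (\<kappa> x) = sets borel"
    "AE x in M. invariant_measure act (\<kappa> x) \<and> ergodic_measure act (\<kappa> x)"
    "\<And>A. A \<in> sets borel \<Longrightarrow> (\<integral>\<^sup>+x. emeasure (\<kappa> x) A \<partial>M) = emeasure M A"
proof -
  interpret prob_space M by fact
  note [measurable_cong] = sets_M
  have sp: "space M = UNIV" using sets_eq_imp_space_eq[OF sets_M] by simp
  have am0: "act g \<in> borel \<rightarrow>\<^sub>M borel" for g by (rule jointly_continuous_action_measurable[OF act])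
  have am[measurable]: "act g \<in> M \<rightarrow>\<^sub>M M" for g using am0[of g] by measurable
  note [simp] = jointly_continuous_action_simps(1-4)[OF act]
  have D: "distr M M (act g) = M" for g using inv by (simp add: invariant_measure_def)
  \<comment> \<open>The null set may depend on \<open>g\<close>. The limit functions
    \<open>f'\<close> are invariant only in this weak sense, and it is their level sets that have to
    belong to \<open>F\<close>.\<close>
  define FA where "FA = {A \<in> sets M. \<forall>g. AE x in M. act g x \<in> A \<longleftrightarrow> x \<in> A}"
  define F where "F = sigma UNIV FA"
  have "sigma_algebra UNIV FA"
    unfolding sigma_algebra_iff2
  proof safe
    show "a \<in> FA \<Longrightarrow> x \<in> UNIV" for a x by simp
    show "{} \<in> FA" unfolding FA_def by simp
    show "UNIV - s \<in> FA" if "s \<in> FA" for s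
      using that unfolding FA_def by (auto simp: sp[symmetric] sets.compl_sets) (simp add: sp)
    show "\<Union> (range A) \<in> FA" if A: "range A \<subseteq> FA" for A :: "nat \<Rightarrow> 'y set"
      unfolding FA_def
    proof (intro CollectI conjI allI)
      show "\<Union> (range A) \<in> sets M" using A unfolding FA_def by auto
      fix g
      have "AE x in M. \<forall>i. act g x \<in> A i \<longleftrightarrow> x \<in> A i"
        using A unfolding AE_all_countable FA_def by auto
      then show "AE x in M. (act g x \<in> \<Union> (range A)) = (x \<in> \<Union> (range A))"
        by eventually_elim auto
    qed
  qed
  then have sF: "sets F = FA" "space F = UNIV"
    unfolding F_def by (simp_all add: sigma_algebra.sigma_sets_eq)
  have sub: "subalgebra M F"
    unfolding subalgebra_def sF sp by (auto simp: FA_def)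
  interpret R: finite_measure "restr_to_subalg M F" by (rule finite_measure_restr_to_subalg[OF sub finite_measure_axioms])
  obtain \<kappa> where \<kappa>: "\<And>x. prob_space (\<kappa> x)" "\<And>x. sets (\<kappa> x) = sets borel"
    and \<kappa>F: "\<And>A. A \<in> sets borel \<Longrightarrow> (\<lambda>x. emeasure (\<kappa> x) A) \<in> borel_measurable F"
    and \<kappa>I: "\<And>A B. A \<in> sets borel \<Longrightarrow> B \<in> sets F \<Longrightarrow> (\<integral>\<^sup>+x\<in>B. emeasure (\<kappa> x) A \<partial>M) = emeasure M (A \<inter> B)"
    and \<kappa>f: "\<And>f. f \<in> borel_measurable borel \<Longrightarrow> (\<lambda>x. \<integral>\<^sup>+y. f y \<partial>\<kappa> x) \<in> borel_measurable F"
    and \<kappa>D: "\<And>f. f \<in> borel_measurable borel \<Longrightarrow> (\<integral>\<^sup>+x. \<integral>\<^sup>+y. f y \<partial>\<kappa> x \<partial>M) = (\<integral>\<^sup>+y. f y \<partial>M)"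
    by (rule regular_conditional_probability[OF assms(2,3) sub]) blast
  have \<kappa>m: "k \<in> \<kappa> x \<rightarrow>\<^sub>M N" if "k \<in> borel \<rightarrow>\<^sub>M N" for k N x
    using that \<kappa>(2)[of x] by (simp cong: measurable_cong_sets)
  have \<kappa>sp: "space (\<kappa> x) = UNIV" for x using sets_eq_imp_space_eq[OF \<kappa>(2)] by simp
  \<comment> \<open>Null sets of \<open>M\<close> are null for almost every component, because the
    average of the components is \<open>M\<close>.\<close>
  have AE_\<kappa>: "AE x in M. AE y in \<kappa> x. P y" if "AE y in M. P y" for P
  proof -
    obtain N where N: "{y \<in> space M. \<not> P y} \<subseteq> N" "emeasure M N = 0" "N \<in> sets M" using AE_E[OF \<open>AE y in M. P y\<close>] by blast
    have Nb[measurable]: "N \<in> sets borel" using N(3) sets_M by simp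
    have "(\<integral>\<^sup>+x. \<integral>\<^sup>+y. indicator N y \<partial>\<kappa> x \<partial>M) = 0" using \<kappa>D[of "indicator N"] N by simp
    then have "AE x in M. (\<integral>\<^sup>+y. indicator N y \<partial>\<kappa> x) = 0"
      using \<kappa>f[of "indicator N"] measurable_from_subalg[OF sub] by (subst (asm) nn_integral_0_iff_AE) auto
    then show ?thesis
    proof eventually_elim
      case (elim x)
      then have "emeasure (\<kappa> x) N = 0" using \<kappa>(2) by simp
      then show ?case using N(1) Nb \<kappa>(2) by (intro AE_I[of _ _ N]) (auto simp: sp)
    qed
  qed
  obtain A :: "'y set set" where A: "countable A" "Int_stable A" "\<And>U. U \<in> A \<Longrightarrow> open U" "UNIV \<in> A" "sets borel = sigma_sets UNIV A"
    by (rule open_generating_pi_system) blast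
  have Ab[measurable]: "U \<in> A \<Longrightarrow> U \<in> sets borel" for U using A(3) by simp
  obtain G0 :: "'g set" where G0: "countable G0" "closure G0 = UNIV"
    by (rule countable_dense_closure) blast
  have F_AE: "AE x in M. act g x \<in> B \<longleftrightarrow> x \<in> B" and F_M: "B \<in> sets borel" if "B \<in> sets F" for B g
    using that unfolding sF FA_def by (auto simp: sets_M)
  \<comment> \<open>Both sides are \<open>F\<close>-measurable functions of \<open>x\<close> and
    have the same integral over each \<open>B\<close> in \<open>F\<close>: as \<open>B\<close> is
    almost invariant, the preimage of \<open>U\<close> meets \<open>B\<close> in the preimage of
    \<open>U \<inter> B\<close> up to a null set.\<close>
  have inv1: "AE x in M. emeasure (\<kappa> x) (act g -` U) = emeasure (\<kappa> x) U" if U: "U \<in> sets borel" for g U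
  proof (rule AE_restr_to_subalg[OF sub], rule R.density_unique_finite_measure)
    have gU: "act g -` U \<in> sets borel" using measurable_sets[OF am0 U] by simp
    show "(\<lambda>x. emeasure (\<kappa> x) (act g -` U)) \<in> borel_measurable (restr_to_subalg M F)"
      "(\<lambda>x. emeasure (\<kappa> x) U) \<in> borel_measurable (restr_to_subalg M F)"
      using \<kappa>F[OF gU] \<kappa>F[OF U] measurable_in_subalg[OF sub] by auto
    fix B assume "B \<in> sets (restr_to_subalg M F)"
    then have B: "B \<in> sets F" using sets_restr_to_subalg[OF sub] by simp
    have *: "(\<integral>\<^sup>+x\<in>B. emeasure (\<kappa> x) V \<partial>restr_to_subalg M F) = emeasure M (V \<inter> B)" if "V \<in> sets borel" for V
      using nn_integral_subalgebra2[OF sub, of "\<lambda>x. emeasure (\<kappa> x) V * indicator B x"] \<kappa>F[OF that] B \<kappa>I[OF that B] by simp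
    have "emeasure M (act g -` U \<inter> B) = emeasure M (act g -` (U \<inter> B))"
      by (rule emeasure_eq_AE) (use F_AE[OF B, of g] gU F_M[OF B] U measurable_sets[OF am0 F_M[OF B]] in \<open>auto simp: sets_M\<close>)
    also have "\<dots> = emeasure (distr M M (act g)) (U \<inter> B)"
      using U F_M[OF B] by (subst emeasure_distr) (auto simp: sets_M sp)
    finally have "emeasure M (act g -` U \<inter> B) = emeasure M (U \<inter> B)" by (simp add: D)
    then show "(\<integral>\<^sup>+x\<in>B. emeasure (\<kappa> x) (act g -` U) \<partial>restr_to_subalg M F) = (\<integral>\<^sup>+x\<in>B. emeasure (\<kappa> x) U \<partial>restr_to_subalg M F)"
      using *[OF gU] *[OF U] by simp
  qed auto
  have inv: "AE x in M. \<forall>g\<in>G0. \<forall>U\<in>A. emeasure (\<kappa> x) (act g -` U) = emeasure (\<kappa> x) U"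
    unfolding AE_ball_countable[OF G0(1)] AE_ball_countable[OF A(1)] by (intro ballI inv1 Ab)
  \<comment> \<open>The exceptional set depends on \<open>U\<close> alone; the quantifier over the
    invariant sets \<open>B0\<close> stands inside.\<close>
  have erg: "AE x in M. invariant_measure act (\<kappa> x) \<longrightarrow> (\<forall>B0\<in>sets borel. invariant_set act B0 \<longrightarrow>
     emeasure (\<kappa> x) (U \<inter> B0) = emeasure (\<kappa> x) U * emeasure (\<kappa> x) B0)" if U: "U \<in> A" for U
  proof -
    define f :: "'y \<Rightarrow> real" where "f = indicator U"
    have f: "f \<in> borel_measurable borel" "\<And>x. 0 \<le> f x" "\<And>x. f x \<le> 1"
      unfolding f_def using Ab[OF U] by (auto simp: indicator_def)
    obtain h f' where h: "\<And>n::nat. h n \<in> orbit_hull act f" and f': "f' \<in> borel_measurable M"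
      "AE x in M. (\<lambda>n. h n x) \<longlonglongrightarrow> f' x" "\<And>g. AE x in M. f' (act g x) = f' x"
      by (rule orbit_hull_limit[OF finite_measure_axioms assms(4) am _ _ f(2,3)]) (use f(1) in \<open>auto simp: measurable_cong_sets[OF sets_M refl]\<close>)
    have hm: "h n \<in> borel_measurable borel" for n by (rule orbit_hull_measurable[OF h f(1) am0])
    have Bq: "{x. q < f' x} \<in> sets F" for q
    proof -
      have "{x. q < f' x} \<in> sets M" using f'(1)[unfolded borel_measurable_iff_greater, rule_format, of q] by (simp add: sp)
      moreover have "AE x in M. act g x \<in> {x. q < f' x} \<longleftrightarrow> x \<in> {x. q < f' x}" for g
        using f'(3)[of g] by eventually_elim simp
      ultimately show ?thesis unfolding sF FA_def by simp
    qed
    \<comment> \<open>Sets of \<open>F\<close> are trivial for almost every component: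
      \<open>\<kappa> x\<close> is concentrated on \<open>B\<close> or on its complement, whichever
      contains \<open>x\<close>.\<close>
    have zo: "AE x in M. AE y in \<kappa> x. y \<in> B \<longleftrightarrow> x \<in> B" if B: "B \<in> sets F" for B
    proof -
      have Bb[measurable]: "B \<in> sets borel" "- B \<in> sets F" "B \<in> sets F" "- B \<in> sets borel"
        using F_M[OF B] B sets.compl_sets[OF B] by (auto simp: sF(2) Compl_eq_Diff_UNIV)
      note [measurable] = measurable_from_subalg[OF sub \<kappa>F[OF Bb(1)]] measurable_from_subalg[OF sub \<kappa>F[OF Bb(4)]]
      have "(\<integral>\<^sup>+x\<in>-B. emeasure (\<kappa> x) B \<partial>M) = 0" "(\<integral>\<^sup>+x\<in>B. emeasure (\<kappa> x) (-B) \<partial>M) = 0"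
        using \<kappa>I[OF Bb(1,2)] \<kappa>I[OF Bb(4,3)] by auto
      then have "AE x in M. emeasure (\<kappa> x) B * indicator (- B) x = 0" "AE x in M. emeasure (\<kappa> x) (- B) * indicator B x = 0"
        using Bb sets_M by (simp_all add: nn_integral_0_iff_AE del: mult_eq_0_iff)
      then show ?thesis
      proof eventually_elim
        case (elim x)
        show ?case
        proof (cases "x \<in> B")
          case True
          then have "emeasure (\<kappa> x) (- B) = 0" using elim by simp
          then show ?thesis using True Bb \<kappa>(2) by (intro AE_I[of _ _ "- B"]) auto
        next
          case False
          then have "emeasure (\<kappa> x) B = 0" using elim by simp
          then show ?thesis using False Bb \<kappa>(2) by (intro AE_I[of _ _ B]) auto
        qed
      qed
    qed
    have "AE x in M. \<forall>q::rat. AE y in \<kappa> x. y \<in> {x. of_rat q < f' x} \<longleftrightarrow> x \<in> {x. of_rat q < f' x}"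
      unfolding AE_all_countable using zo[OF Bq] by blast
    moreover have "AE x in M. AE y in \<kappa> x. (\<lambda>n. h n y) \<longlonglongrightarrow> f' y" by (rule AE_\<kappa>[OF f'(2)])
    ultimately show ?thesis
    proof eventually_elim
      case (elim x)
      interpret K: prob_space "\<kappa> x" by (rule \<kappa>)
      \<comment> \<open>For almost every \<open>y\<close> the values \<open>f' y\<close> and
        \<open>f' x\<close> lie on the same side of every rational level, so they agree.\<close>
      have const: "AE y in \<kappa> x. (\<lambda>n. h n y) \<longlonglongrightarrow> f' x"
        using AE_all_countable[THEN iffD2, OF elim(1)] elim(2)
      proof eventually_elim
        case (elim y)
        have "f' y = f' x"
        proof (rule ccontr)
          assume "f' y \<noteq> f' x"
          then consider "f' y < f' x" | "f' x < f' y" by linarith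
          then show False
          proof cases
            case 1
            then obtain q where "f' y < of_rat q" "of_rat q < f' x" using of_rat_dense by blast
            then show False using elim(1) by (auto dest!: spec[of _ q])
          next
            case 2
            then obtain q where "f' x < of_rat q" "of_rat q < f' y" using of_rat_dense by blast
            then show False using elim(1) by (auto dest!: spec[of _ q])
          qed
        qed
        then show ?case using elim(2) by simp
      qed
      \<comment> \<open>By invariance the integral of \<open>h n\<close> over \<open>B0\<close> is
        the same for all \<open>n\<close>, while \<open>h n\<close> tends to the constant
        \<open>f' x\<close>; dominated convergence equates the two values.\<close>
      have key: "measure (\<kappa> x) (U \<inter> B0) = f' x * measure (\<kappa> x) B0"
        if inv: "invariant_measure act (\<kappa> x)" and B0[measurable]: "B0 \<in> sets borel" "invariant_set act B0" for B0
      proof -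
        have B0k: "B0 \<in> sets (\<kappa> x)" using B0 \<kappa>(2) by simp
        have aa: "acts_on act UNIV" using act by (simp add: jointly_continuous_action_def)
        have amk: "act g \<in> \<kappa> x \<rightarrow>\<^sub>M \<kappa> x" for g using am0 \<kappa>(2) by (simp cong: measurable_cong_sets)
        have "(\<integral>y. indicator B0 y * h n y \<partial>\<kappa> x) = measure (\<kappa> x) (U \<inter> B0)" for n
        proof -
          have "(\<integral>y. indicator B0 y * h n y \<partial>\<kappa> x) = (\<integral>y. indicator B0 y * f y \<partial>\<kappa> x)"
            by (rule orbit_hull_integral[OF K.finite_measure_axioms inv amk \<kappa>m[OF f(1)] f(2,3) B0k _ h])
              (simp add: invariant_set_iff[OF aa B0(2)])
          also have "\<dots> = (\<integral>y. indicator (U \<inter> B0) y \<partial>\<kappa> x)"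
            by (rule Bochner_Integration.integral_cong) (auto simp: f_def indicator_def)
          also have "\<dots> = measure (\<kappa> x) (U \<inter> B0)"
            by (simp add: \<kappa>sp)
          finally show ?thesis .
        qed
        then have "(\<lambda>n. \<integral>y. indicator B0 y * h n y \<partial>\<kappa> x) \<longlonglongrightarrow> measure (\<kappa> x) (U \<inter> B0)"
          by simp
        moreover have "(\<lambda>n. \<integral>y. indicator B0 y * h n y \<partial>\<kappa> x) \<longlonglongrightarrow> (\<integral>y. indicator B0 y * f' x \<partial>\<kappa> x)"
        proof (rule integral_dominated_convergence[where w="\<lambda>_. 1"])
          show "AE y in \<kappa> x. (\<lambda>n. indicator B0 y * h n y) \<longlonglongrightarrow> indicator B0 y * f' x"
            using const by eventually_elim (intro tendsto_intros)
          show "AE y in \<kappa> x. norm (indicator B0 y * h n y) \<le> 1" for n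
            using orbit_hull_bounds[OF h f(2,3)] by (auto simp: indicator_def abs_mult)
          show "(\<lambda>y. indicator B0 y * f' x) \<in> borel_measurable (\<kappa> x)"
            by (rule \<kappa>m) (intro borel_measurable_times borel_measurable_indicator B0 borel_measurable_const)
          show "(\<lambda>y. indicator B0 y * h n y) \<in> borel_measurable (\<kappa> x)" for n
            by (rule \<kappa>m) (intro borel_measurable_times borel_measurable_indicator B0 hm)
        qed simp
        ultimately have "measure (\<kappa> x) (U \<inter> B0) = (\<integral>y. indicator B0 y * f' x \<partial>\<kappa> x)"
          by (rule LIMSEQ_unique)
        then show ?thesis by (simp add: \<kappa>sp mult.commute)
      qed
      show ?case
      proof (intro impI ballI)
        fix B0 assume B0: "invariant_measure act (\<kappa> x)" "B0 \<in> sets borel" "invariant_set act B0"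
        have "invariant_set act UNIV" unfolding invariant_set_def
          using jointly_continuous_action_simps(4)[OF act] by (metis surjI)
        then have "measure (\<kappa> x) U = f' x" using key[OF B0(1), of UNIV] K.prob_space by (simp add: \<kappa>sp)
        then have "measure (\<kappa> x) (U \<inter> B0) = measure (\<kappa> x) U * measure (\<kappa> x) B0" using key[OF B0] by simp
        then show "emeasure (\<kappa> x) (U \<inter> B0) = emeasure (\<kappa> x) U * emeasure (\<kappa> x) B0"
          by (simp add: K.emeasure_eq_measure ennreal_mult)
      qed
    qed
  qed
  have erg': "AE x in M. \<forall>U\<in>A. invariant_measure act (\<kappa> x) \<longrightarrow> (\<forall>B0\<in>sets borel. invariant_set act B0 \<longrightarrow>
     emeasure (\<kappa> x) (U \<inter> B0) = emeasure (\<kappa> x) U * emeasure (\<kappa> x) B0)"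
    unfolding AE_ball_countable[OF A(1)] by (intro ballI erg)
  show thesis
  proof (rule that[of \<kappa>])
    show "AE x in M. invariant_measure act (\<kappa> x) \<and> ergodic_measure act (\<kappa> x)"
      using inv erg'
    proof eventually_elim
      case (elim x)
      interpret K: prob_space "\<kappa> x" by (rule \<kappa>)
      have i: "invariant_measure act (\<kappa> x)"
      proof (rule invariant_measure_of_dense[OF act G0(2) K.finite_measure_axioms \<kappa>(2)])
        fix g and U :: "'y set" assume g: "g \<in> G0" and U: "open U"
        have amk: "act g \<in> \<kappa> x \<rightarrow>\<^sub>M \<kappa> x" using am0 \<kappa>(2) by (simp cong: measurable_cong_sets)
        have "distr (\<kappa> x) (\<kappa> x) (act g) = \<kappa> x"
        proof (rule measure_eqI_open_pi_system[OF _ _ _ A(2,4,5)])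
          show "emeasure (distr (\<kappa> x) (\<kappa> x) (act g)) V = emeasure (\<kappa> x) V" if "V \<in> A" for V
            using elim(1) g that amk Ab[OF that] \<kappa>(2) by (subst emeasure_distr) (auto simp: \<kappa>sp)
        qed (use \<kappa>(2) K.finite_measure_distr[OF amk] in simp_all)
        then have "emeasure (\<kappa> x) U = emeasure (distr (\<kappa> x) (\<kappa> x) (act g)) U" by simp
        also have "\<dots> = emeasure (\<kappa> x) (act g -` U)"
          using U amk \<kappa>(2) by (subst emeasure_distr) (auto simp: \<kappa>sp)
        finally show "emeasure (\<kappa> x) (act g -` U) = emeasure (\<kappa> x) U" by simp
      qed
      have "emeasure (\<kappa> x) B = 0 \<or> emeasure (\<kappa> x) (space (\<kappa> x) - B) = 0" if B: "B \<in> sets (\<kappa> x)" "invariant_set act B" for B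
      proof -
        have Bb: "B \<in> sets borel" using B \<kappa>(2) by simp
        \<comment> \<open>Independence of \<open>B\<close> from the generator extends to all Borel
          sets. Applied to \<open>B\<close> itself it says that the measure of \<open>B\<close>
          equals its square.\<close>
        have "density (\<kappa> x) (indicator B) = scale_measure (emeasure (\<kappa> x) B) (\<kappa> x)"
        proof (rule measure_eqI_open_pi_system[OF _ _ _ A(2,4,5)])
          show "finite_measure (density (\<kappa> x) (indicator B))"
            by (rule finite_measureI) (use B in \<open>simp add: emeasure_density\<close>)
          show "emeasure (density (\<kappa> x) (indicator B)) V = emeasure (scale_measure (emeasure (\<kappa> x) B) (\<kappa> x)) V" if V: "V \<in> A" for V
          proof -
            have "emeasure (density (\<kappa> x) (indicator B)) V = emeasure (\<kappa> x) (V \<inter> B)"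
              using emeasure_restricted[OF B(1), of V] Ab[OF V] \<kappa>(2) by (simp add: Int_commute)
            also have "\<dots> = emeasure (\<kappa> x) V * emeasure (\<kappa> x) B" using elim(2) V i Bb B(2) by blast
            finally show ?thesis by (simp add: emeasure_scale_measure mult.commute)
          qed
        qed (use \<kappa>(2) in simp_all)
        then have "emeasure (density (\<kappa> x) (indicator B)) B = emeasure (\<kappa> x) B * emeasure (\<kappa> x) B"
          by (simp add: emeasure_scale_measure)
        moreover have "emeasure (density (\<kappa> x) (indicator B)) B = emeasure (\<kappa> x) B"
          using emeasure_restricted[OF B(1,1)] by simp
        ultimately have "ennreal (measure (\<kappa> x) B * measure (\<kappa> x) B) = ennreal (measure (\<kappa> x) B)"
          by (simp add: K.emeasure_eq_measure ennreal_mult)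
        then have "measure (\<kappa> x) B * measure (\<kappa> x) B = measure (\<kappa> x) B"
          by (subst (asm) ennreal_inj) auto
        then have "measure (\<kappa> x) B = 0 \<or> measure (\<kappa> x) B = 1" by simp
        then show ?thesis using K.prob_compl[OF B(1)] by (auto simp: K.emeasure_eq_measure)
      qed
      with i show ?case unfolding ergodic_measure_def by blast
    qed
    show "(\<integral>\<^sup>+x. emeasure (\<kappa> x) A \<partial>M) = emeasure M A" if "A \<in> sets borel" for A
      using \<kappa>D[of "indicator A"] that \<kappa>(2) by (simp add: sets_M)
  qed (use \<kappa> in auto)
qed

text \<open>A nonzero \<open>M\<close> is normalised and decomposed, and the measure of
  \<open>S\<close> is the average of its measures under the components. This vanishing criterion is
  the form in which the decomposition enters the density argument.\<close>

proposition null_set_if_ergodic_null: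
  fixes act :: "'g::{topological_group_add, second_countable_topology} \<Rightarrow> 'y::polish_space \<Rightarrow> 'y"
  assumes act: "jointly_continuous_action act"
    and "finite_measure M" and sets_M: "sets M = sets borel" and inv: "invariant_measure act M"
    and S: "S \<in> sets borel"
    and null: "\<And>\<kappa>. prob_space \<kappa> \<Longrightarrow> sets \<kappa> = sets borel \<Longrightarrow> invariant_measure act \<kappa> \<Longrightarrow> ergodic_measure act \<kappa> \<Longrightarrow> emeasure \<kappa> S = 0"
  shows "emeasure M S = 0"
proof (cases "emeasure M UNIV = 0")
  case True
  then show ?thesis using emeasure_mono[of S UNIV M] sets.top[of M] sets_eq_imp_space_eq[OF sets_M] by auto
next
  case False
  interpret finite_measure M by fact
  have sp: "space M = UNIV" using sets_eq_imp_space_eq[OF sets_M] by simp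
  let ?M = "uniform_measure M UNIV"
  have UM: "UNIV \<in> sets M" using sets.top[of M] sp by simp
  have em: "emeasure ?M A = emeasure M A / emeasure M UNIV" if "A \<in> sets M" for A
    using emeasure_uniform_measure[OF UM that] by simp
  have am: "act g \<in> M \<rightarrow>\<^sub>M M" for g
    using jointly_continuous_action_measurable[OF act, of g] sets_M by (simp cong: measurable_cong_sets)
  have "prob_space ?M" by (rule prob_space_uniform_measure) (use False emeasure_finite[of UNIV] in auto)
  moreover have "sets ?M = sets borel" using sets_M by simp
  moreover have "invariant_measure act ?M"
    unfolding invariant_measure_def
  proof
    fix g
    show "distr ?M ?M (act g) = ?M"
    proof (rule measure_eqI)
      fix A assume "A \<in> sets (distr ?M ?M (act g))"
      then have A: "A \<in> sets M" by simp
      have "emeasure M (act g -` A) = emeasure (distr M M (act g)) A"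
        using A am by (subst emeasure_distr) (auto simp: sp)
      also have "\<dots> = emeasure M A" using inv by (simp add: invariant_measure_def)
      finally show "emeasure (distr ?M ?M (act g)) A = emeasure ?M A"
        using A am measurable_sets[OF am A, of g] em[OF A] em[of "act g -` A"] sp
        by (subst emeasure_distr) (auto cong: measurable_cong_sets)
    qed simp
  qed
  ultimately obtain \<kappa> where \<kappa>: "\<And>x. prob_space (\<kappa> x)" "\<And>x. sets (\<kappa> x) = sets borel"
    "AE x in ?M. invariant_measure act (\<kappa> x) \<and> ergodic_measure act (\<kappa> x)"
    "\<And>A. A \<in> sets borel \<Longrightarrow> (\<integral>\<^sup>+x. emeasure (\<kappa> x) A \<partial>?M) = emeasure ?M A"
    by (rule ergodic_decomposition[OF act]) blast
  have "emeasure ?M S = (\<integral>\<^sup>+x. emeasure (\<kappa> x) S \<partial>?M)" using \<kappa>(4)[OF S] by simp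
  also have "\<dots> = (\<integral>\<^sup>+x. 0 \<partial>?M)"
    by (rule nn_integral_cong_AE) (use \<kappa>(3) null[OF \<kappa>(1,2)] in auto)
  finally have "emeasure M S / emeasure M UNIV = 0" using em[of S] S sets_M by simp
  then show ?thesis using emeasure_finite[of UNIV] by (simp add: ennreal_divide_eq_0_iff)
qed

subsection \<open>Pointwise ergodic families on Polish spaces\<close>

text \<open>The topology is carried over from the Polish space along the coding and is in general
  not induced by the target, so the position of \<open>range \<iota>\<close> in the target does not
  matter.\<close>

lemma standard_borel_vimage_algebra:
  fixes \<iota> :: "'y::polish_space \<Rightarrow> 'z"
  assumes j: "\<And>y. j (\<iota> y) = y"
  shows "standard_borel (vimage_algebra (range \<iota>) j borel)"
  unfolding standard_borel_def
proof (intro exI conjI)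
  let ?T = "pullback_topology (range \<iota>) j euclidean"
  show top: "topspace ?T = space (vimage_algebra (range \<iota>) j borel)"
    by (simp add: topspace_pullback_topology)
  have "continuous_map ?T euclidean j"
    unfolding continuous_map_def by (auto simp: topspace_pullback_topology openin_pullback_topology)
  moreover have "continuous_map euclidean ?T \<iota>"
    unfolding continuous_map_def
  proof (intro conjI allI impI)
    fix U assume "openin ?T U"
    then obtain V where V: "open V" "U = j -` V \<inter> range \<iota>" by (auto simp: openin_pullback_topology)
    then have "{x \<in> topspace euclidean. \<iota> x \<in> U} = V" by (auto simp: j)
    then show "openin euclidean {x \<in> topspace euclidean. \<iota> x \<in> U}" using V(1) by simp
  qed (simp add: topspace_pullback_topology)
  ultimately have "homeomorphic_maps ?T euclidean j \<iota>"
    unfolding homeomorphic_maps_def by (auto simp: topspace_pullback_topology j)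
  then have hom: "?T homeomorphic_space (euclidean :: 'y topology)"
    unfolding homeomorphic_space_def by blast
  show "completely_metrizable_space ?T"
    using homeomorphic_completely_metrizable_space[OF hom] completely_metrizable_space_euclidean by blast
  have "second_countable (euclidean :: 'y topology)"
  proof -
    obtain B :: "'y set set" where B: "countable B" "topological_basis B"
      using ex_countable_basis by blast
    show ?thesis
      unfolding second_countable_def
    proof (intro exI[of _ B] conjI ballI allI impI)
      show "openin euclidean V" if "V \<in> B" for V using topological_basis_open[OF B(2) that] by simp
      show "\<exists>V\<in>B. x \<in> V \<and> V \<subseteq> U" if "openin euclidean U \<and> x \<in> U" for U x
        using that by (auto elim!: topological_basisE[OF B(2)])
    qed (rule B(1))
  qed
  then show "second_countable ?T"
    using homeomorphic_space_second_countability[OF hom] by blast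
  have "sets (vimage_algebra (range \<iota>) j borel) = {j -` A \<inter> range \<iota> |A. A \<in> sigma_sets UNIV {S. open S}}"
    by (subst sets_vimage_algebra2) (auto simp: borel_def)
  also have "\<dots> = sigma_sets (range \<iota>) {j -` A \<inter> range \<iota> |A. A \<in> {S. open S}}"
    by (rule sigma_sets_vimage_commute) auto
  also have "{j -` A \<inter> range \<iota> |A. A \<in> {S. open S}} = {U. openin ?T U}"
    by (auto simp: openin_pullback_topology)
  finally show "sets (vimage_algebra (range \<iota>) j borel) = sigma_sets (topspace ?T) {U. openin ?T U}"
    by (simp add: topspace_pullback_topology)
qed

text \<open>Transport along a coding \<open>\<iota>\<close> by reals, where the hypothesis on the family is formulated.\<close>

proposition pointwise_ergodic_family_polish:
  fixes act :: "'g::{topological_group_add, second_countable_topology} \<Rightarrow> 'y::polish_space \<Rightarrow> 'y"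
    and \<phi> :: "'y \<Rightarrow> real"
  assumes G: "pointwise_ergodic_family m G" and act: "jointly_continuous_action act"
    and \<phi>[measurable]: "\<phi> \<in> borel_measurable borel" and bnd: "\<And>y. \<bar>\<phi> y\<bar> \<le> C"
  defines "P \<equiv> {y. \<exists>l>0. (average m G act \<phi> y \<longlongrightarrow> l) at_top}"
  shows "P \<in> sets borel"
    and "\<And>\<kappa>. prob_space \<kappa> \<Longrightarrow> sets \<kappa> = sets borel \<Longrightarrow> invariant_measure act \<kappa> \<Longrightarrow> ergodic_measure act \<kappa> \<Longrightarrow>
      0 < (\<integral>y. \<phi> y \<partial>\<kappa>) \<Longrightarrow> \<exists>E\<in>sets borel. E \<subseteq> P \<and> invariant_set act E \<and> (AE y in \<kappa>. y \<in> E)"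
proof -
  obtain \<iota> :: "'y \<Rightarrow> real" and j :: "real \<Rightarrow> 'y" where "\<iota> \<in> borel_measurable borel"
    "j \<in> borel_measurable borel" and j\<iota>: "\<And>y. j (\<iota> y) = y" and "\<And>y. 0 \<le> \<iota> y" "\<And>y. \<iota> y < 1"
    by (rule polish_space_real_coding) blast
  define M where "M = vimage_algebra (range \<iota>) j borel"
  define act' where "act' g t = \<iota> (act g (j t))" for g t
  define \<phi>' where "\<phi>' t = \<phi> (j t)" for t
  have sp: "space M = range \<iota>" unfolding M_def by simp
  have jM[measurable]: "j \<in> M \<rightarrow>\<^sub>M borel" unfolding M_def by (rule measurable_vimage_algebra1) auto
  have j\<iota>': "(\<lambda>y. j (\<iota> y)) = (\<lambda>y. y)" by (rule ext) (rule j\<iota>)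
  have \<iota>M[measurable]: "\<iota> \<in> borel \<rightarrow>\<^sub>M M"
    unfolding M_def
  proof (rule measurable_vimage_algebra2)
    show "(\<lambda>y. j (\<iota> y)) \<in> borel \<rightarrow>\<^sub>M borel" unfolding j\<iota>' by (rule measurable_ident_sets) simp
  qed simp
  have setsM: "\<iota> -` A \<in> sets borel" if "A \<in> sets M" for A
    using measurable_sets[OF \<iota>M that] by simp
  note [simp] = jointly_continuous_action_simps(1-4)[OF act] j\<iota>
  have am[measurable]: "act g \<in> borel \<rightarrow>\<^sub>M borel" for g by (rule jointly_continuous_action_measurable[OF act])
  have "(\<lambda>(g, y). act g y) \<in> borel \<Otimes>\<^sub>M borel \<rightarrow>\<^sub>M borel"
    using borel_measurable_continuous_onI[OF jointly_continuous_action_simps(7)[OF act]] by (simp add: borel_prod)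
  then have actm: "(\<lambda>x. act (fst x) (snd x)) \<in> borel \<Otimes>\<^sub>M borel \<rightarrow>\<^sub>M borel" by (simp add: split_beta')
  have ba: "borel_action act' M"
    unfolding borel_action_def
  proof
    show "acts_on act' (space M)" unfolding acts_on_def sp act'_def by auto
    have "(\<lambda>x. (fst x, j (snd x))) \<in> borel \<Otimes>\<^sub>M M \<rightarrow>\<^sub>M borel \<Otimes>\<^sub>M borel" by measurable
    from measurable_compose[OF this actm]
    have "(\<lambda>x. act (fst x) (j (snd x))) \<in> borel \<Otimes>\<^sub>M M \<rightarrow>\<^sub>M borel" by simp
    from measurable_compose[OF this \<iota>M]
    show "(\<lambda>(g, t). act' g t) \<in> borel \<Otimes>\<^sub>M M \<rightarrow>\<^sub>M M" by (simp add: act'_def split_beta')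
  qed
 have mm: "\<phi>' \<in> borel_measurable M" unfolding \<phi>'_def[abs_def] by measurable
  have sb: "standard_borel M" unfolding M_def by (rule standard_borel_vimage_algebra) simp
  have bb: "\<exists>C. \<forall>x\<in>space M. \<bar>\<phi>' x\<bar> \<le> C" using bnd by (auto simp: \<phi>'_def)
  define E where "E = convergence_set m G act' M \<phi>'"
  define L where "L = limit_average m G act' \<phi>'"
  note H = G[unfolded pointwise_ergodic_family_def Let_def, THEN spec, of M, THEN spec, of act', THEN spec, of \<phi>',
      THEN mp, OF sb, THEN mp, OF ba, THEN mp, OF mm, THEN mp, OF bb, folded E_def L_def]
  have E: "E \<in> sets M" and L: "L \<in> borel_measurable (restrict_space M E)"
    and erg: "\<And>\<kappa>. prob_space \<kappa> \<Longrightarrow> sets \<kappa> = sets M \<Longrightarrow> invariant_measure act' \<kappa> \<Longrightarrow> ergodic_measure act' \<kappa> \<Longrightarrow>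
       \<exists>E'\<in>sets M. E' \<subseteq> E \<and> invariant_set act' E' \<and> (AE x in \<kappa>. x \<in> E') \<and> (\<forall>x\<in>E'. L x = (\<integral>y. \<phi>' y \<partial>\<kappa>))"
    using H by simp_all
  have av: "average m G act' \<phi>' (\<iota> y) = average m G act \<phi> y" for y
    unfolding average_def act'_def \<phi>'_def by simp
  \<comment> \<open>Where the averages converge, \<open>Lim\<close> picks out the limit, so
    \<open>P\<close> is the preimage of the measurable condition \<open>0 < L\<close> on the
    convergence set.\<close>
  have P: "P = \<iota> -` {t \<in> E. 0 < L t}"
  proof (intro set_eqI iffI)
    fix y assume "y \<in> P"
    then obtain l where l: "0 < l" "(average m G act \<phi> y \<longlongrightarrow> l) at_top" unfolding P_def by auto
    then have "Lim at_top (average m G act \<phi> y) = l" by (intro tendsto_Lim) auto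
    then show "y \<in> \<iota> -` {t \<in> E. 0 < L t}"
      using l unfolding E_def convergence_set_def L_def limit_average_def by (auto simp: sp av)
  next
    fix y assume y: "y \<in> \<iota> -` {t \<in> E. 0 < L t}"
    then obtain l where l: "(average m G act \<phi> y \<longlongrightarrow> l) at_top"
      unfolding E_def convergence_set_def by (auto simp: av)
    then have "Lim at_top (average m G act \<phi> y) = l" by (intro tendsto_Lim) auto
    then show "y \<in> P" using l y unfolding P_def L_def limit_average_def by (auto simp: av)
  qed
  have "{t \<in> E. 0 < L t} \<in> sets M"
  proof -
    have "L -` {0<..} \<inter> space (restrict_space M E) \<in> sets (restrict_space M E)"
      by (rule measurable_sets[OF L]) simp
    also have "L -` {0<..} \<inter> space (restrict_space M E) = {t \<in> E. 0 < L t}"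
      using sets.sets_into_space[OF E] by (auto simp: space_restrict_space)
    finally show ?thesis using E by (simp add: sets_restrict_space_iff)
  qed
  then show "P \<in> sets borel" unfolding P by (rule setsM)
  \<comment> \<open>Invariance is an equation between images. For the inclusion of \<open>A\<close>
    in its image, \<open>A \<subseteq> range \<iota>\<close> ensures that the point found is the
    code of some \<open>y'\<close>.\<close>
  have invs: "invariant_set act (\<iota> -` A)" if A: "A \<subseteq> range \<iota>" "invariant_set act' A" for A
    unfolding invariant_set_def
  proof (intro allI equalityI subsetI)
    fix g y assume "y \<in> act g ` (\<iota> -` A)"
    then obtain y' where "\<iota> y' \<in> A" "y = act g y'" by auto
    then have "act' g (\<iota> y') \<in> A" using A(2) unfolding invariant_set_def by blast
    then show "y \<in> \<iota> -` A" using \<open>y = act g y'\<close> by (simp add: act'_def)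
  next
    fix g y assume "y \<in> \<iota> -` A"
    then have "\<iota> y \<in> act' g ` A" using A(2) unfolding invariant_set_def by auto
    then obtain y' where y': "\<iota> y' \<in> A" "\<iota> y = act' g (\<iota> y')" using A(1) by blast
    then have "j (\<iota> y) = j (\<iota> (act g y'))" by (simp add: act'_def)
    then show "y \<in> act g ` (\<iota> -` A)" using y'(1) by auto
  qed
  fix \<kappa> :: "'y measure"
  assume \<kappa>: "prob_space \<kappa>" "sets \<kappa> = sets borel" "invariant_measure act \<kappa>" "ergodic_measure act \<kappa>"
    and pos: "0 < (\<integral>y. \<phi> y \<partial>\<kappa>)"
  interpret prob_space \<kappa> by fact
  have sp\<kappa>: "space \<kappa> = UNIV" using sets_eq_imp_space_eq[OF \<kappa>(2)] by simp
  have \<iota>\<kappa>: "\<iota> \<in> \<kappa> \<rightarrow>\<^sub>M M" using \<iota>M \<kappa>(2) by (simp cong: measurable_cong_sets)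
  have am\<kappa>: "act g \<in> \<kappa> \<rightarrow>\<^sub>M \<kappa>" for g using am \<kappa>(2) by (simp cong: measurable_cong_sets)
  define \<kappa>' where "\<kappa>' = distr \<kappa> M \<iota>"
  have em: "emeasure \<kappa>' A = emeasure \<kappa> (\<iota> -` A)" if "A \<in> sets M" for A
    unfolding \<kappa>'_def using emeasure_distr[OF \<iota>\<kappa> that] by (simp add: sp\<kappa>)
  have pr': "prob_space \<kappa>'" unfolding \<kappa>'_def by (rule prob_space_distr[OF \<iota>\<kappa>])
  have s': "sets \<kappa>' = sets M" unfolding \<kappa>'_def by simp
  have inv': "invariant_measure act' \<kappa>'"
    unfolding invariant_measure_def
  proof
    fix g
    have m': "act' g \<in> M \<rightarrow>\<^sub>M M" unfolding act'_def[abs_def] by measurable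
    have "distr \<kappa>' \<kappa>' (act' g) = distr \<kappa>' M (act' g)" by (rule distr_cong) (auto simp: s')
    also have "\<dots> = distr \<kappa> M (act' g \<circ> \<iota>)" unfolding \<kappa>'_def by (rule distr_distr[OF m' \<iota>\<kappa>])
    also have "act' g \<circ> \<iota> = \<iota> \<circ> act g" by (auto simp: act'_def)
    also have "distr \<kappa> M (\<iota> \<circ> act g) = distr (distr \<kappa> \<kappa> (act g)) M \<iota>"
      by (rule distr_distr[symmetric, OF \<iota>\<kappa> am\<kappa>])
    also have "\<dots> = \<kappa>'" using \<kappa>(3) by (simp add: invariant_measure_def \<kappa>'_def)
    finally show "distr \<kappa>' \<kappa>' (act' g) = \<kappa>'" .
  qed
  have erg': "ergodic_measure act' \<kappa>'"
    unfolding ergodic_measure_def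
  proof (intro ballI impI)
    fix A assume A: "A \<in> sets \<kappa>'" "invariant_set act' A"
    then have AM: "A \<in> sets M" "A \<subseteq> range \<iota>"
      using sets.sets_into_space[of A M] s' sp by simp_all
    have "space \<kappa>' = space M" by (rule sets_eq_imp_space_eq[OF s'])
    then have "emeasure \<kappa>' (space \<kappa>' - A) = emeasure \<kappa> (\<iota> -` (space M - A))"
      using em[of "space M - A"] AM by auto
    also have "\<iota> -` (space M - A) = space \<kappa> - \<iota> -` A" by (auto simp: sp sp\<kappa>)
    finally show "emeasure \<kappa>' A = 0 \<or> emeasure \<kappa>' (space \<kappa>' - A) = 0"
      using \<kappa>(4) invs[OF AM(2) A(2)] setsM[OF AM(1)] \<kappa>(2) em[OF AM(1)] unfolding ergodic_measure_def by auto
  qed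
  obtain E' where E': "E' \<in> sets M" "E' \<subseteq> E" "invariant_set act' E'" "AE x in \<kappa>'. x \<in> E'"
    "\<forall>x\<in>E'. L x = (\<integral>y. \<phi>' y \<partial>\<kappa>')"
    using erg[OF pr' s' inv' erg'] by (elim bexE conjE)
  have "(\<integral>y. \<phi>' y \<partial>\<kappa>') = (\<integral>y. \<phi>' (\<iota> y) \<partial>\<kappa>)"
    unfolding \<kappa>'_def by (rule integral_distr[OF \<iota>\<kappa>]) (simp add: \<phi>'_def[abs_def])
  then have int: "(\<integral>y. \<phi>' y \<partial>\<kappa>') = (\<integral>y. \<phi> y \<partial>\<kappa>)" by (simp add: \<phi>'_def)
  have "\<iota> -` E' \<subseteq> P" unfolding P using E'(2,5) int pos by auto
  moreover have "invariant_set act (\<iota> -` E')"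
    by (rule invs) (use E'(3) sets.sets_into_space[OF E'(1)] sp in auto)
  moreover have "AE y in \<kappa>. y \<in> \<iota> -` E'"
    using AE_distrD[OF \<iota>\<kappa> E'(4)[unfolded \<kappa>'_def]] by simp
  ultimately show "\<exists>E\<in>sets borel. E \<subseteq> P \<and> invariant_set act E \<and> (AE y in \<kappa>. y \<in> E)"
    using setsM[OF E'(1)] by blast
qed

subsection \<open>Haar measures on unimodular groups\<close>

lemma left_translate_eq_vimage: "(\<lambda>h. g + h) ` A = (\<lambda>h. - g + h) -` A" for g :: "'g::group_add"
proof (intro equalityI subsetI)
  fix x assume "x \<in> (\<lambda>h. - g + h) -` A"
  then have "- g + x \<in> A" "x = g + (- g + x)" by (simp_all add: add.assoc[symmetric])
  then show "x \<in> (\<lambda>h. g + h) ` A" by blast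
qed (auto simp: add.assoc[symmetric])

lemma right_translate_eq_vimage: "(\<lambda>h. h + g) ` A = (\<lambda>h. h + - g) -` A" for g :: "'g::group_add"
proof (intro equalityI subsetI)
  fix x assume "x \<in> (\<lambda>h. h + - g) -` A"
  then have "x + - g \<in> A" "x = x + - g + g" by (simp_all add: add.assoc)
  then show "x \<in> (\<lambda>h. h + g) ` A" by blast
qed (auto simp: add.assoc)

locale unimodular_haar =
  fixes m :: "'g::{topological_group_add, t2_space, second_countable_topology} measure"
  assumes lc: "locally_compact_space (euclidean :: 'g topology)"
    and unimod: "unimodular_group TYPE('g)"
    and haar: "haar_measure m"
begin

lemma sets_m: "sets m = sets borel"
  and m_UNIV: "emeasure m UNIV \<noteq> 0"
  and m_compact: "compact K \<Longrightarrow> emeasure m K < \<infinity>"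
  and distr_left: "distr m m (\<lambda>h. g + h) = m"
  and distr_right: "distr m m (\<lambda>h. h + g) = m"
  using haar unimod unfolding haar_measure_def unimodular_group_def by auto

lemma space_m: "space m = UNIV"
  using sets_eq_imp_space_eq[OF sets_m] by simp

lemma m_measurable: "f \<in> borel \<rightarrow>\<^sub>M N \<Longrightarrow> f \<in> m \<rightarrow>\<^sub>M N"
  using sets_m by (simp cong: measurable_cong_sets)

lemma left_measurable: "(\<lambda>h. g + h) \<in> borel \<rightarrow>\<^sub>M (borel :: 'g measure)"
  and right_measurable: "(\<lambda>h. h + g) \<in> borel \<rightarrow>\<^sub>M (borel :: 'g measure)"
  by (intro borel_measurable_continuous_onI continuous_intros)+

lemma nn_integral_left:
  assumes "f \<in> borel_measurable borel"
  shows "(\<integral>\<^sup>+h. f (g + h) \<partial>m) = (\<integral>\<^sup>+h. f h \<partial>m)"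
proof -
  have "(\<integral>\<^sup>+h. f h \<partial>m) = (\<integral>\<^sup>+h. f h \<partial>distr m m (\<lambda>h. g + h))" by (simp add: distr_left)
  also have "\<dots> = (\<integral>\<^sup>+h. f (g + h) \<partial>m)"
    by (rule nn_integral_distr) (use left_measurable assms in \<open>simp_all add: sets_m cong: measurable_cong_sets\<close>)
  finally show ?thesis by simp
qed

lemma nn_integral_right:
  assumes "f \<in> borel_measurable borel"
  shows "(\<integral>\<^sup>+h. f (h + g) \<partial>m) = (\<integral>\<^sup>+h. f h \<partial>m)"
proof -
  have "(\<integral>\<^sup>+h. f h \<partial>m) = (\<integral>\<^sup>+h. f h \<partial>distr m m (\<lambda>h. h + g))" by (simp add: distr_right)
  also have "\<dots> = (\<integral>\<^sup>+h. f (h + g) \<partial>m)"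
    by (rule nn_integral_distr) (use right_measurable assms in \<open>simp_all add: sets_m cong: measurable_cong_sets\<close>)
  finally show ?thesis by simp
qed

lemma emeasure_left:
  assumes "A \<in> sets borel"
  shows "emeasure m ((\<lambda>h. g + h) ` A) = emeasure m A" "(\<lambda>h. g + h) ` A \<in> sets borel"
proof -
  note eq = left_translate_eq_vimage[of g A]
  show s: "(\<lambda>h. g + h) ` A \<in> sets borel"
    unfolding eq using measurable_sets[OF left_measurable assms] by simp
  have "emeasure m ((\<lambda>h. g + h) ` A) = (\<integral>\<^sup>+h. indicator A (- g + h) \<partial>m)"
    using s nn_integral_indicator[of "(\<lambda>h. g + h) ` A" m] by (simp add: sets_m eq indicator_vimage)
  also have "\<dots> = emeasure m A" using assms by (subst nn_integral_left) (auto simp: sets_m)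
  finally show "emeasure m ((\<lambda>h. g + h) ` A) = emeasure m A" .
qed

lemma emeasure_right:
  assumes "A \<in> sets borel"
  shows "emeasure m ((\<lambda>h. h + g) ` A) = emeasure m A" "(\<lambda>h. h + g) ` A \<in> sets borel"
proof -
  note eq = right_translate_eq_vimage[of g A]
  show s: "(\<lambda>h. h + g) ` A \<in> sets borel"
    unfolding eq using measurable_sets[OF right_measurable assms, of "- g"] by simp
  have "emeasure m ((\<lambda>h. h + g) ` A) = (\<integral>\<^sup>+h. indicator A (h + - g) \<partial>m)"
    using s nn_integral_indicator[of "(\<lambda>h. h + g) ` A" m] by (simp add: sets_m eq indicator_vimage)
  also have "\<dots> = emeasure m A" using assms by (subst nn_integral_right) (auto simp: sets_m)
  finally show "emeasure m ((\<lambda>h. h + g) ` A) = emeasure m A" .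
qed

lemma open_translate: "open V \<Longrightarrow> open ((\<lambda>h. (k::'g) + h) ` V)"
proof -
  assume V: "open V"
  show ?thesis unfolding left_translate_eq_vimage by (rule open_vimage[OF V]) (intro continuous_intros)
qed

lemma countable_translates:
  assumes V: "open V" "0 \<in> V"
  obtains k :: "nat \<Rightarrow> 'g" where "(\<Union>n. (\<lambda>h. k n + h) ` V) = UNIV"
proof -
  define T where "T k = (\<lambda>h. k + h) ` V" for k :: 'g
  have opT: "open (T k)" for k unfolding T_def by (rule open_translate[OF V(1)])
  obtain F where F: "F \<subseteq> range T" "countable F" "\<Union>F = \<Union>(range T)"
  proof (rule Lindelof[of "range T"])
    show "open S" if "S \<in> range T" for S using that opT by (elim rangeE) simp
  qed (rule that)
  have "x \<in> T x" for x unfolding T_def using V(2) by (auto simp: image_iff intro!: bexI[of _ 0])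
  then have U: "\<Union>F = UNIV" unfolding F(3) by blast
  then have ne: "F \<noteq> {}" by auto
  have "\<forall>A\<in>F. \<exists>k. A = T k" using F(1) by blast
  then obtain c where c: "\<And>A. A \<in> F \<Longrightarrow> A = T (c A)" by metis
  have "(\<Union>n. T (c (from_nat_into F n))) = (\<Union>n. from_nat_into F n)"
    using c[OF from_nat_into[OF ne]] by simp
  also have "\<dots> = UNIV" using range_from_nat_into[OF ne F(2)] U by auto
  finally show thesis unfolding T_def by (rule that)
qed

text \<open>Continuity of the two difference maps at the identity. The bound on
  \<open>- a + b\<close> separates the pieces \<open>W q\<close> along an orbit and the points of
  \<open>L\<close> in a left translate; the bound on \<open>a - b\<close> separates the points of a
  right translate of \<open>L\<close>.\<close>

lemma small_compact_neighbourhood: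
  assumes U: "open U" "(0::'g) \<in> U"
  obtains W V where "compact W" "open V" "0 \<in> V" "V \<subseteq> W" "W \<subseteq> U"
    "\<And>a b. a \<in> W \<Longrightarrow> b \<in> W \<Longrightarrow> - a + b \<in> U" "\<And>a b. a \<in> W \<Longrightarrow> b \<in> W \<Longrightarrow> a - b \<in> U"
proof -
  let ?S = "U \<times> U \<inter> ((\<lambda>x. - fst x + snd x) -` U \<inter> (\<lambda>x. fst x - snd x) -` U)"
  have "open ?S"
    by (intro open_Int open_Times open_vimage U continuous_intros)
  moreover have "(0, 0) \<in> ?S" using U by simp
  ultimately obtain A B where AB: "open A" "open B" "(0, 0) \<in> A \<times> B" "A \<times> B \<subseteq> ?S"
    by (rule open_prod_elim)
  have nb: "neighbourhood_base_of (compactin (euclidean :: 'g topology)) euclidean"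
  proof -
    have "Hausdorff_space (euclidean :: 'g topology)"
      unfolding Hausdorff_space_def disjnt_def using hausdorff by simp blast
    then show ?thesis using locally_compact_space_neighbourhood_base[of "euclidean :: 'g topology"] lc by blast
  qed
  have "openin euclidean (A \<inter> B) \<and> 0 \<in> A \<inter> B" using AB by auto
  from nb[unfolded neighbourhood_base_of, THEN spec, THEN spec, THEN mp, OF this]
  obtain V W where W: "open V" "compact W" "0 \<in> V" "V \<subseteq> W" "W \<subseteq> A \<inter> B" by auto
  have "- a + b \<in> U" "a - b \<in> U" if "a \<in> W" "b \<in> W" for a b
  proof -
    have "(a, b) \<in> ?S" using AB(4) W(5) that by blast
    then show "- a + b \<in> U" "a - b \<in> U" by auto
  qed
  moreover have "W \<subseteq> U" using AB(4) W(5) \<open>openin euclidean (A \<inter> B) \<and> 0 \<in> A \<inter> B\<close> AB(3) by blast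
  ultimately show thesis using that[OF W(2,1,3,4)] by blast
qed

text \<open>Otherwise countably many null translates of \<open>V\<close> would cover the
  group.\<close>

lemma emeasure_open_pos:
  assumes V: "open V" "0 \<in> V"
  shows "emeasure m V > 0"
proof (rule ccontr)
  assume "\<not> 0 < emeasure m V"
  then have 0: "emeasure m V = 0" by simp
  obtain k :: "nat \<Rightarrow> 'g" where k: "(\<Union>n. (\<lambda>h. k n + h) ` V) = UNIV" by (rule countable_translates[OF V]) (rule that)
  have "(\<lambda>h. k n + h) ` V \<in> null_sets m" for n
    using emeasure_left[of V "k n"] V 0 by (auto simp: null_sets_def sets_m)
  then have "(\<Union>n. (\<lambda>h. k n + h) ` V) \<in> null_sets m" by (rule null_sets_UN)
  then show False using m_UNIV unfolding k by auto
qed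

lemma compact_borel: "compact W \<Longrightarrow> W \<in> sets (borel :: 'g measure)"
  by (intro borel_closed compact_imp_closed)

sublocale sigma_finite_measure m
proof
  obtain W V where W: "compact W" "open V" "(0::'g) \<in> V" "V \<subseteq> W"
    by (rule small_compact_neighbourhood[OF open_UNIV UNIV_I]) (rule that)
  obtain k :: "nat \<Rightarrow> 'g" where k: "(\<Union>n. (\<lambda>h. k n + h) ` V) = UNIV"
    by (rule countable_translates[OF W(2,3)]) (rule that)
  let ?A = "range (\<lambda>n. (\<lambda>h. k n + h) ` W)"
  have "\<Union>?A = UNIV"
  proof -
    have "UNIV \<subseteq> (\<Union>n. (\<lambda>h. k n + h) ` V)" using k by simp
    also have "\<dots> \<subseteq> \<Union>?A" using W(4) by blast
    finally show ?thesis by blast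
  qed
  moreover have "\<forall>a\<in>?A. emeasure m a \<noteq> \<infinity>"
    using emeasure_left(1)[OF compact_borel[OF W(1)]] m_compact[OF W(1)] by auto
  moreover have "?A \<subseteq> sets m" using emeasure_left(2)[OF compact_borel[OF W(1)]] by (auto simp: sets_m)
  ultimately show "\<exists>A. countable A \<and> A \<subseteq> sets m \<and> \<Union>A = space m \<and> (\<forall>a\<in>A. emeasure m a \<noteq> \<infinity>)"
    by (intro exI[of _ ?A]) (auto simp: space_m)
qed

end

subsection \<open>Invariant measures with given transverse measure\<close>

text \<open>Invariance under the orbit equivalence relation on a set that is not itself invariant:
  each \<open>act g\<close> is a partial bijection of \<open>Q\<close>, defined where it stays in
  \<open>Q\<close>, and \<open>B\<close> ranges over test sets in its image. Transverse measures
  have exactly this kind of invariance.\<close>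

definition partially_invariant :: "('g::group_add \<Rightarrow> 'y \<Rightarrow> 'y) \<Rightarrow> 'y set \<Rightarrow> 'y::topological_space measure \<Rightarrow> bool" where
  "partially_invariant act Q \<rho> \<longleftrightarrow>
     (\<forall>g. \<forall>B\<in>sets borel. emeasure \<rho> {x\<in>Q. act g x \<in> Q \<inter> B} = emeasure \<rho> {x\<in>Q \<inter> B. act (- g) x \<in> Q})"

text \<open>On sets this is the definition. Read as an equality between the image of a restricted
  measure and another restriction, it passes to functions.\<close>

lemma nn_integral_partially_invariant:
  assumes pinv: "partially_invariant act Q \<rho>" and \<rho>: "sets \<rho> = sets borel"
    and Q: "Q \<in> sets borel" and am: "\<And>g. act g \<in> borel \<rightarrow>\<^sub>M borel" and f: "f \<in> borel_measurable borel"
  shows "(\<integral>\<^sup>+x. f (act g x) * indicator {x\<in>Q. act g x \<in> Q} x \<partial>\<rho>) =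
         (\<integral>\<^sup>+x. f x * indicator {x\<in>Q. act (- g) x \<in> Q} x \<partial>\<rho>)"
proof -
  have sp: "space \<rho> = UNIV" using sets_eq_imp_space_eq[OF \<rho>] by simp
  have D: "{x\<in>Q. act g x \<in> B} \<in> sets \<rho>" if "B \<in> sets borel" for g B
  proof -
    have "Q \<inter> act g -` B \<in> sets borel" using Q measurable_sets[OF am[of g] that] by simp
    then show ?thesis by (simp add: \<rho> Int_def)
  qed
  let ?M = "density \<rho> (indicator {x\<in>Q. act g x \<in> Q})"
  have am': "act g \<in> ?M \<rightarrow>\<^sub>M borel" and f': "f \<in> borel_measurable \<rho>" "(\<lambda>x. f (act g x)) \<in> borel_measurable \<rho>"
    using am[of g] f measurable_compose[OF am f] by (simp_all add: \<rho> cong: measurable_cong_sets)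
  have eq: "distr ?M borel (act g) = density \<rho> (indicator {x\<in>Q. act (- g) x \<in> Q})"
  proof (rule measure_eqI)
    fix B assume "B \<in> sets (distr ?M borel (act g))"
    then have B: "B \<in> sets borel" by simp
    then have gB: "act g -` B \<in> sets \<rho>" using measurable_sets[OF am[of g] B] by (simp add: \<rho>)
    have "emeasure (distr ?M borel (act g)) B = emeasure ?M (act g -` B)"
      using emeasure_distr[OF am' B] by (simp add: sp)
    also have "\<dots> = emeasure \<rho> ({x\<in>Q. act g x \<in> Q} \<inter> act g -` B)" by (rule emeasure_restricted[OF D[OF Q] gB])
    also have "{x\<in>Q. act g x \<in> Q} \<inter> act g -` B = {x\<in>Q. act g x \<in> Q \<inter> B}" by auto
    also have "emeasure \<rho> \<dots> = emeasure \<rho> {x\<in>Q \<inter> B. act (- g) x \<in> Q}"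
      using pinv B unfolding partially_invariant_def by blast
    also have "{x\<in>Q \<inter> B. act (- g) x \<in> Q} = {x\<in>Q. act (- g) x \<in> Q} \<inter> B" by auto
    also have "emeasure \<rho> \<dots> = emeasure (density \<rho> (indicator {x\<in>Q. act (- g) x \<in> Q})) B"
      by (rule emeasure_restricted[OF D[OF Q], symmetric]) (use B in \<open>simp add: \<rho>\<close>)
    finally show "emeasure (distr ?M borel (act g)) B = emeasure (density \<rho> (indicator {x\<in>Q. act (- g) x \<in> Q})) B" .
  qed (simp add: \<rho>)
  have "(\<integral>\<^sup>+x. f (act g x) * indicator {x\<in>Q. act g x \<in> Q} x \<partial>\<rho>) = (\<integral>\<^sup>+x. f (act g x) \<partial>?M)"
    by (subst nn_integral_density[OF borel_measurable_indicator[OF D[OF Q]] f'(2)]) (simp add: mult.commute)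
  also have "\<dots> = (\<integral>\<^sup>+x. f x \<partial>distr ?M borel (act g))"
    by (rule nn_integral_distr[OF am', symmetric]) (use f in simp)
  also have "\<dots> = (\<integral>\<^sup>+x. f x * indicator {x\<in>Q. act (- g) x \<in> Q} x \<partial>\<rho>)"
    unfolding eq by (subst nn_integral_density[OF borel_measurable_indicator[OF D[OF Q]] f'(1)]) (simp add: mult.commute)
  finally show ?thesis .
qed

text \<open>In the condition for \<open>P\<close>, the test set is cut down to those points of
  \<open>B \<inter> Q\<close> that come from \<open>Q\<close> under \<open>g\<close>; what results
  is the condition for \<open>Q\<close>.\<close>

lemma partially_invariant_subset:
  fixes act :: "'g::group_add \<Rightarrow> 'y::topological_space \<Rightarrow> 'y"
  assumes pinv: "partially_invariant act P \<rho>" and "Q \<subseteq> P" "Q \<in> sets borel"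
    and am: "\<And>g. act g \<in> borel \<rightarrow>\<^sub>M borel"
    and act: "\<And>g x. act (- g) (act g x) = x" "\<And>g x. act g (act (- g) x) = x"
  shows "partially_invariant act Q \<rho>"
  unfolding partially_invariant_def
proof (intro allI ballI)
  fix g :: 'g and B :: "'y set" assume B: "B \<in> sets borel"
  let ?B = "B \<inter> Q \<inter> act (- g) -` Q"
  have "?B \<in> sets borel" using B assms(3) measurable_sets[OF am assms(3), of "- g"] by simp
  then have "emeasure \<rho> {x\<in>P. act g x \<in> P \<inter> ?B} = emeasure \<rho> {x\<in>P \<inter> ?B. act (- g) x \<in> P}"
    using pinv unfolding partially_invariant_def by blast
  moreover have "{x\<in>P. act g x \<in> P \<inter> ?B} = {x\<in>Q. act g x \<in> Q \<inter> B}" using assms(2) act by auto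
  moreover have "{x\<in>P \<inter> ?B. act (- g) x \<in> P} = {x\<in>Q \<inter> B. act (- g) x \<in> Q}" using assms(2) act by auto
  ultimately show "emeasure \<rho> {x\<in>Q. act g x \<in> Q \<inter> B} = emeasure \<rho> {x\<in>Q \<inter> B. act (- g) x \<in> Q}" by simp
qed

text \<open>
  The invariant measure with given transverse measure \<open>\<rho>\<close> on \<open>Q\<close> is \<open>w \<cdot> (\<rho> \<Otimes> m)\<close> pushed forward by
  \<open>(q, g) \<mapsto> g q\<close>, where the weight \<open>w\<close> sums to \<open>1\<close> over the points of \<open>Q\<close> in each orbit; by mass
  transport over the return times the result does not depend on the weight.
\<close>

locale suspension = unimodular_haar m
  for m :: "'g::{topological_group_add, t2_space, second_countable_topology} measure" +
  fixes act :: "'g \<Rightarrow> 'y::polish_space \<Rightarrow> 'y" and Q :: "'y set" and R :: "'g set" and \<rho> :: "'y measure"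
  assumes action: "jointly_continuous_action act"
    and finite_\<rho>: "finite_measure \<rho>" and sets_\<rho>: "sets \<rho> = sets borel"
    and pinv: "partially_invariant act Q \<rho>" and Q_borel: "Q \<in> sets borel"
    and R: "countable R" "uminus ` R = R"
    and return: "\<And>g x. x \<in> Q \<Longrightarrow> act g x \<in> Q \<Longrightarrow> g \<in> R"
begin

lemmas act_simps = jointly_continuous_action_simps(1-4)[OF action]

lemma act_measurable: "act g \<in> borel \<rightarrow>\<^sub>M borel"
  by (rule jointly_continuous_action_measurable[OF action])

lemma act_pair_measurable: "(\<lambda>x. act (fst x) (snd x)) \<in> borel \<Otimes>\<^sub>M borel \<rightarrow>\<^sub>M borel"
proof -
  have "(\<lambda>(g, y). act g y) \<in> borel \<Otimes>\<^sub>M borel \<rightarrow>\<^sub>M borel"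
    using borel_measurable_continuous_onI[OF jointly_continuous_action_simps(7)[OF action]] by (simp add: borel_prod)
  then show ?thesis by (simp add: split_beta')
qed

lemma act_measurable2 [measurable (raw)]:
  assumes "f \<in> M \<rightarrow>\<^sub>M borel" "h \<in> M \<rightarrow>\<^sub>M borel"
  shows "(\<lambda>x. act (f x) (h x)) \<in> M \<rightarrow>\<^sub>M borel"
  using measurable_compose[OF measurable_Pair[OF assms] act_pair_measurable] by simp

lemma group_measurable [measurable (raw)]:
  fixes f h :: "'b \<Rightarrow> 'g"
  assumes "f \<in> M \<rightarrow>\<^sub>M borel" "h \<in> M \<rightarrow>\<^sub>M borel"
  shows "(\<lambda>x. f x + h x) \<in> M \<rightarrow>\<^sub>M borel"
proof -
  have "(\<lambda>x. fst x + snd x) \<in> borel \<Otimes>\<^sub>M borel \<rightarrow>\<^sub>M (borel :: 'g measure)"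
    unfolding borel_prod by (intro borel_measurable_continuous_onI continuous_intros)
  from measurable_compose[OF measurable_Pair[OF assms] this] show ?thesis by simp
qed

section \<open>Weights and mass transport over the return times\<close>

abbreviation weight_measurable :: "('y \<Rightarrow> 'g \<Rightarrow> ennreal) \<Rightarrow> bool" where
  "weight_measurable w \<equiv> (\<lambda>x. w (fst x) (snd x)) \<in> borel_measurable (borel \<Otimes>\<^sub>M borel)"

lemma measurable_weight:
  assumes "weight_measurable w" "f \<in> M \<rightarrow>\<^sub>M borel" "h \<in> M \<rightarrow>\<^sub>M borel"
  shows "(\<lambda>x. w (f x) (h x)) \<in> borel_measurable M"
  using measurable_compose[OF measurable_Pair[OF assms(2,3)] assms(1)] by simp

definition weight :: "('y \<Rightarrow> 'g \<Rightarrow> ennreal) \<Rightarrow> bool" where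
  "weight w \<longleftrightarrow> weight_measurable w \<and> (\<forall>p g. p \<notin> Q \<longrightarrow> w p g = 0)"

text \<open>The pairs \<open>(q, h)\<close> with \<open>q\<close> in \<open>Q\<close> and
  \<open>h q = g p\<close> are the pairs \<open>(l p, g - l)\<close> where \<open>l\<close> is a
  return time of \<open>p\<close>. So this is the total weight that the point \<open>act g p\<close>
  receives from all its representations, expressed through one of them.\<close>

definition weight_sum :: "('y \<Rightarrow> 'g \<Rightarrow> ennreal) \<Rightarrow> 'y \<Rightarrow> 'g \<Rightarrow> ennreal" where
  "weight_sum w p g = (\<integral>\<^sup>+l. w (act l p) (g - l) \<partial>count_space R)"

lemma sets_pair: "sets (\<rho> \<Otimes>\<^sub>M m) = sets (borel \<Otimes>\<^sub>M borel)"
  by (intro sets_pair_measure_cong sets_\<rho> sets_m)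

lemma space_\<rho>: "space \<rho> = UNIV" using sets_eq_imp_space_eq[OF sets_\<rho>] by simp

lemma iterated:
  fixes f :: "'y \<Rightarrow> 'g \<Rightarrow> ennreal"
  assumes f: "(\<lambda>x. f (fst x) (snd x)) \<in> borel_measurable (borel \<Otimes>\<^sub>M borel)"
  shows "(\<integral>\<^sup>+p. \<integral>\<^sup>+g. f p g \<partial>m \<partial>\<rho>) = (\<integral>\<^sup>+x. f (fst x) (snd x) \<partial>(\<rho> \<Otimes>\<^sub>M m))"
  using nn_integral_fst[of "\<lambda>x. f (fst x) (snd x)" \<rho>] f by (simp add: sets_pair cong: measurable_cong_sets)

lemma inner_measurable:
  fixes f :: "'y \<Rightarrow> 'g \<Rightarrow> ennreal"
  assumes f: "(\<lambda>x. f (fst x) (snd x)) \<in> borel_measurable (borel \<Otimes>\<^sub>M borel)"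
  shows "(\<lambda>p. \<integral>\<^sup>+g. f p g \<partial>m) \<in> borel_measurable borel"
proof -
  have "(\<lambda>p. \<integral>\<^sup>+g. f p g \<partial>m) \<in> borel_measurable \<rho>"
    using borel_measurable_nn_integral[of "\<lambda>p g. f p g" \<rho>] f by (simp add: sets_pair split_beta' cong: measurable_cong_sets)
  then show ?thesis by (simp add: sets_\<rho> cong: measurable_cong_sets)
qed

text \<open>The summand for \<open>l\<close> pairs the representation of a point through
  \<open>p\<close> with the one through \<open>act l p\<close>. Right translation by
  \<open>l\<close> in the group, where unimodularity enters, and partial invariance of
  \<open>\<rho>\<close> under \<open>act l\<close> exchange these two representations. This turns
  the summand for \<open>l\<close> into the one for \<open>- l\<close> with the weights
  interchanged, and \<open>R\<close> is symmetric.\<close>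

lemma mass_transport:
  assumes w: "weight w" and w': "weight w'" and F: "F \<in> borel_measurable borel"
  shows "(\<integral>\<^sup>+p. \<integral>\<^sup>+g. F (act g p) * w p g * weight_sum w' p g \<partial>m \<partial>\<rho>) =
         (\<integral>\<^sup>+p. \<integral>\<^sup>+g. F (act g p) * w' p g * weight_sum w p g \<partial>m \<partial>\<rho>)"
proof -
  have expand: "(\<integral>\<^sup>+p. \<integral>\<^sup>+g. F (act g p) * w p g * weight_sum w' p g \<partial>m \<partial>\<rho>) =
      (\<integral>\<^sup>+l. (\<integral>\<^sup>+p. \<integral>\<^sup>+g. F (act g p) * w p g * w' (act l p) (g - l) \<partial>m \<partial>\<rho>) \<partial>count_space R)"
    if w: "weight w" and w': "weight w'" for w w'
  proof -
    have wm: "weight_measurable w" "weight_measurable w'" using w w' unfolding weight_def by auto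
    have fm: "(\<lambda>x. F (act (snd x) (fst x)) * w (fst x) (snd x) * w' (act l (fst x)) (snd x - l)) \<in> borel_measurable (borel \<Otimes>\<^sub>M borel)" for l
      unfolding diff_conv_add_uminus
      by (intro borel_measurable_times_ennreal measurable_compose[OF _ F] measurable_weight[OF wm(1)] measurable_weight[OF wm(2)]
          act_measurable2 group_measurable measurable_fst measurable_snd measurable_const) auto
    have "(\<integral>\<^sup>+p. \<integral>\<^sup>+g. F (act g p) * w p g * weight_sum w' p g \<partial>m \<partial>\<rho>) =
       (\<integral>\<^sup>+p. \<integral>\<^sup>+g. \<integral>\<^sup>+l. F (act g p) * w p g * w' (act l p) (g - l) \<partial>count_space R \<partial>m \<partial>\<rho>)"
      unfolding weight_sum_def by (simp add: nn_integral_cmult)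
    also have "\<dots> = (\<integral>\<^sup>+p. \<integral>\<^sup>+l. \<integral>\<^sup>+g. F (act g p) * w p g * w' (act l p) (g - l) \<partial>m \<partial>count_space R \<partial>\<rho>)"
    proof (intro nn_integral_cong nn_integral_count_space_nn_integral[OF R(1)])
      fix p :: 'y and l
      have "(\<lambda>g. (p, g)) \<in> borel \<rightarrow>\<^sub>M borel \<Otimes>\<^sub>M (borel :: 'g measure)" by simp
      from measurable_compose[OF this fm]
      show "(\<lambda>g. F (act g p) * w p g * w' (act l p) (g - l)) \<in> borel_measurable m"
        by (intro m_measurable) simp
    qed
    also have "\<dots> = (\<integral>\<^sup>+l. (\<integral>\<^sup>+p. \<integral>\<^sup>+g. F (act g p) * w p g * w' (act l p) (g - l) \<partial>m \<partial>\<rho>) \<partial>count_space R)"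
      by (rule nn_integral_count_space_nn_integral[OF R(1)])
        (use inner_measurable[OF fm] in \<open>simp add: sets_\<rho> cong: measurable_cong_sets\<close>)
    finally show ?thesis .
  qed
  have wm: "weight_measurable w" "weight_measurable w'" using w w' unfolding weight_def by auto
  have zero: "p \<notin> Q \<Longrightarrow> w p g = 0" "p \<notin> Q \<Longrightarrow> w' p g = 0" for p g using w w' unfolding weight_def by auto
  have step: "(\<integral>\<^sup>+p. \<integral>\<^sup>+g. F (act g p) * w p g * w' (act l p) (g - l) \<partial>m \<partial>\<rho>) =
      (\<integral>\<^sup>+p. \<integral>\<^sup>+g. F (act g p) * w' p g * w (act (- l) p) (g - (- l)) \<partial>m \<partial>\<rho>)" for l
  proof -
    \<comment> \<open>The inner integral seen from the point \<open>act l p\<close>, since partial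
      invariance moves functions of that point.\<close>
    define H where "H p = (\<integral>\<^sup>+g. F (act g p) * w (act (- l) p) (g + l) * w' p g \<partial>m)" for p
    have Hm: "H \<in> borel_measurable borel"
      unfolding H_def
      by (intro inner_measurable borel_measurable_times_ennreal measurable_compose[OF _ F] measurable_weight[OF wm(1)] measurable_weight[OF wm(2)]
          act_measurable2 group_measurable measurable_fst measurable_snd measurable_const) auto
    have "(\<integral>\<^sup>+g. F (act g p) * w p g * w' (act l p) (g - l) \<partial>m) = H (act l p) * indicator {x\<in>Q. act l x \<in> Q} p" for p
    proof (cases "p \<in> Q \<and> act l p \<in> Q")
      case True
      have "(\<integral>\<^sup>+g. F (act g p) * w p g * w' (act l p) (g - l) \<partial>m)
          = (\<integral>\<^sup>+g. F (act (g + l) p) * w p (g + l) * w' (act l p) (g + l - l) \<partial>m)"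
        unfolding diff_conv_add_uminus
        by (rule nn_integral_right[symmetric])
          (intro borel_measurable_times_ennreal measurable_compose[OF _ F] measurable_weight[OF wm(1)] measurable_weight[OF wm(2)]
          act_measurable2 group_measurable measurable_ident measurable_const, auto)
      also have "\<dots> = H (act l p)"
        unfolding H_def by (simp add: act_simps)
      finally show ?thesis using True by simp
    next
      case False
      then show ?thesis using zero by (auto simp: indicator_def)
    qed
    then have "(\<integral>\<^sup>+p. \<integral>\<^sup>+g. F (act g p) * w p g * w' (act l p) (g - l) \<partial>m \<partial>\<rho>) =
        (\<integral>\<^sup>+p. H (act l p) * indicator {x\<in>Q. act l x \<in> Q} p \<partial>\<rho>)" by simp
    also have "\<dots> = (\<integral>\<^sup>+p. H p * indicator {x\<in>Q. act (- l) x \<in> Q} p \<partial>\<rho>)"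
      by (rule nn_integral_partially_invariant[OF pinv sets_\<rho> Q_borel act_measurable Hm])
    also have "\<dots> = (\<integral>\<^sup>+p. \<integral>\<^sup>+g. F (act g p) * w' p g * w (act (- l) p) (g - (- l)) \<partial>m \<partial>\<rho>)"
    proof (rule nn_integral_cong)
      fix p
      show "H p * indicator {x\<in>Q. act (- l) x \<in> Q} p = (\<integral>\<^sup>+g. F (act g p) * w' p g * w (act (- l) p) (g - (- l)) \<partial>m)"
        by (cases "p \<in> Q \<and> act (- l) p \<in> Q") (auto simp: H_def zero indicator_def mult_ac)
    qed
    finally show ?thesis .
  qed
  have bij: "bij_betw uminus R R"
    using R(2) by (auto simp: bij_betw_def)
  show ?thesis
    unfolding expand[OF w w'] expand[OF w' w] step
    by (rule nn_integral_bij_count_space[OF bij])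
qed

definition suspension_measure :: "('y \<Rightarrow> 'g \<Rightarrow> ennreal) \<Rightarrow> 'y measure" where
  "suspension_measure w = distr (density (\<rho> \<Otimes>\<^sub>M m) (\<lambda>x. w (fst x) (snd x))) borel (\<lambda>x. act (snd x) (fst x))"

lemma nn_integral_suspension:
  assumes w: "weight w" and F: "F \<in> borel_measurable borel"
  shows "(\<integral>\<^sup>+y. F y \<partial>suspension_measure w) = (\<integral>\<^sup>+p. \<integral>\<^sup>+g. F (act g p) * w p g \<partial>m \<partial>\<rho>)"
proof -
  have wm: "(\<lambda>x. w (fst x) (snd x)) \<in> borel_measurable (\<rho> \<Otimes>\<^sub>M m)"
    using w unfolding weight_def by (simp add: sets_pair cong: measurable_cong_sets)
  have am: "(\<lambda>x. act (snd x) (fst x)) \<in> borel \<Otimes>\<^sub>M borel \<rightarrow>\<^sub>M borel"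
    by (intro act_measurable2 measurable_fst measurable_snd)
  have am': "(\<lambda>x. act (snd x) (fst x)) \<in> \<rho> \<Otimes>\<^sub>M m \<rightarrow>\<^sub>M borel"
    using am by (simp add: sets_pair cong: measurable_cong_sets)
  have "(\<integral>\<^sup>+y. F y \<partial>suspension_measure w) =
      (\<integral>\<^sup>+x. F (act (snd x) (fst x)) \<partial>density (\<rho> \<Otimes>\<^sub>M m) (\<lambda>x. w (fst x) (snd x)))"
    unfolding suspension_measure_def
    by (rule nn_integral_distr) (use am' F in \<open>simp_all cong: measurable_cong_sets\<close>)
  also have "\<dots> = (\<integral>\<^sup>+x. w (fst x) (snd x) * F (act (snd x) (fst x)) \<partial>(\<rho> \<Otimes>\<^sub>M m))"
    by (rule nn_integral_density[OF wm]) (rule measurable_compose[OF am' F])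
  also have "\<dots> = (\<integral>\<^sup>+p. \<integral>\<^sup>+g. w p g * F (act g p) \<partial>m \<partial>\<rho>)"
    by (rule iterated[symmetric])
      (intro borel_measurable_times_ennreal measurable_compose[OF am F], use w in \<open>simp add: weight_def\<close>)
  finally show ?thesis by (simp add: mult.commute)
qed

lemma sets_suspension: "sets (suspension_measure w) = sets borel"
  by (simp add: suspension_measure_def)

text \<open>The sum of \<open>w\<close> equals 1 and can be inserted as a factor; mass transport
  trades it for the sum of \<open>w'\<close>, which is at most 1. Used in both directions it shows
  that all weights with sum 1 give the same measure.\<close>

lemma suspension_mono:
  assumes w: "weight w" "\<And>p g. p \<in> Q \<Longrightarrow> weight_sum w p g = 1"
    and w': "weight w'" "\<And>p g. p \<in> Q \<Longrightarrow> weight_sum w' p g \<le> 1"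
    and F: "F \<in> borel_measurable borel"
  shows "(\<integral>\<^sup>+y. F y \<partial>suspension_measure w') \<le> (\<integral>\<^sup>+y. F y \<partial>suspension_measure w)"
proof -
  have "(\<integral>\<^sup>+y. F y \<partial>suspension_measure w') = (\<integral>\<^sup>+p. \<integral>\<^sup>+g. F (act g p) * w' p g \<partial>m \<partial>\<rho>)"
    by (rule nn_integral_suspension[OF w'(1) F])
  also have "\<dots> = (\<integral>\<^sup>+p. \<integral>\<^sup>+g. F (act g p) * w' p g * weight_sum w p g \<partial>m \<partial>\<rho>)"
  proof (intro nn_integral_cong)
    fix p g
    show "F (act g p) * w' p g = F (act g p) * w' p g * weight_sum w p g"
      using w(2)[of p g] w'(1) unfolding weight_def by (cases "p \<in> Q") auto
  qed
  also have "\<dots> = (\<integral>\<^sup>+p. \<integral>\<^sup>+g. F (act g p) * w p g * weight_sum w' p g \<partial>m \<partial>\<rho>)"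
    by (rule mass_transport[OF w'(1) w(1) F])
  also have "\<dots> \<le> (\<integral>\<^sup>+p. \<integral>\<^sup>+g. F (act g p) * w p g \<partial>m \<partial>\<rho>)"
  proof (intro nn_integral_mono)
    fix p g
    show "F (act g p) * w p g * weight_sum w' p g \<le> F (act g p) * w p g"
    proof (cases "p \<in> Q")
      case True
      then show ?thesis using mult_left_mono[OF w'(2)[of p g], of "F (act g p) * w p g"] by simp
    next
      case False
      then show ?thesis using w(1) unfolding weight_def by auto
    qed
  qed
  also have "\<dots> = (\<integral>\<^sup>+y. F y \<partial>suspension_measure w)"
    by (rule nn_integral_suspension[OF w(1) F, symmetric])
  finally show ?thesis .
qed

text \<open>Translation by \<open>h\<close> amounts to passing from \<open>w\<close> to another
  weight with sum 1, and the measure does not depend on that choice.\<close>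

lemma suspension_invariant:
  assumes w: "weight w" "\<And>p g. p \<in> Q \<Longrightarrow> weight_sum w p g = 1"
  shows "invariant_measure act (suspension_measure w)"
  unfolding invariant_measure_def
proof
  fix h
  let ?N = "suspension_measure w"
  define w' where "w' p g = w p (- h + g)" for p g
  have wm: "weight_measurable w" using w(1) unfolding weight_def by auto
  have w': "weight w'"
    unfolding weight_def w'_def
    using w(1) by (auto simp: weight_def intro!: measurable_weight[OF wm] group_measurable)
  have s': "weight_sum w' p g = 1" if "p \<in> Q" for p g
    using w(2)[OF that, of "- h + g"] unfolding weight_sum_def w'_def by (simp add: add_diff_eq)
  have am: "act h \<in> ?N \<rightarrow>\<^sub>M ?N" using act_measurable by (simp add: sets_suspension cong: measurable_cong_sets)
  show "distr ?N ?N (act h) = ?N"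
  proof (rule measure_eqI)
    fix A assume "A \<in> sets (distr ?N ?N (act h))"
    then have A: "A \<in> sets borel" by (simp add: sets_suspension)
    then have F: "indicator A \<in> borel_measurable borel" by simp
    have "emeasure (distr ?N ?N (act h)) A = (\<integral>\<^sup>+y. indicator A y \<partial>distr ?N ?N (act h))"
      using A by (simp add: sets_suspension)
    also have "\<dots> = (\<integral>\<^sup>+y. indicator A (act h y) \<partial>?N)"
      by (rule nn_integral_distr[OF am]) (use F in \<open>simp add: sets_suspension cong: measurable_cong_sets\<close>)
    also have "\<dots> = (\<integral>\<^sup>+p. \<integral>\<^sup>+g. indicator A (act h (act g p)) * w p g \<partial>m \<partial>\<rho>)"
      by (rule nn_integral_suspension[OF w(1)]) (rule measurable_compose[OF act_measurable F])
    also have "\<dots> = (\<integral>\<^sup>+p. \<integral>\<^sup>+g. indicator A (act g p) * w' p g \<partial>m \<partial>\<rho>)"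
    proof (rule nn_integral_cong)
      fix p
      have "(\<lambda>g. indicator A (act g p) * w' p g) \<in> borel_measurable borel"
        unfolding w'_def
        by (intro borel_measurable_times_ennreal measurable_compose[OF _ F] measurable_weight[OF wm] act_measurable2 group_measurable measurable_ident measurable_const) auto
      from nn_integral_left[OF this, of h]
      show "(\<integral>\<^sup>+g. indicator A (act h (act g p)) * w p g \<partial>m) = (\<integral>\<^sup>+g. indicator A (act g p) * w' p g \<partial>m)"
        by (simp add: w'_def act_simps add.assoc[symmetric])
    qed
    also have "\<dots> = (\<integral>\<^sup>+y. indicator A y \<partial>suspension_measure w')"
      by (rule nn_integral_suspension[OF w' F, symmetric])
    also have "\<dots> = (\<integral>\<^sup>+y. indicator A y \<partial>?N)"
      by (intro antisym suspension_mono w w' F) (use w(2) s' in auto)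
    also have "\<dots> = emeasure ?N A" using A by (simp add: sets_suspension)
    finally show "emeasure (distr ?N ?N (act h)) A = emeasure ?N A" .
  qed simp
qed

text \<open>Two return times that both contribute would differ by an element of \<open>R\<close> in
  \<open>U\<close>, hence by 0.\<close>

lemma weight_sum_translate_le:
  assumes W: "\<And>a b. a \<in> W \<Longrightarrow> b \<in> W \<Longrightarrow> - a + b \<in> U" and U: "R \<inter> U \<subseteq> {0}"
    and w: "\<And>p g. w p g = indicator W g * indicator Q p"
  shows "weight_sum w p g \<le> 1"
proof -
  have uniq: "l = l'"
    if "act l p \<in> Q" "g - l \<in> W" "act l' p \<in> Q" "g - l' \<in> W" for l l'
  proof -
    have "- (g - l') + (g - l) \<in> U" using W that by blast
    moreover have "- (g - l') + (g - l) = l' - l" by (simp add: diff_conv_add_uminus minus_add add.assoc del: add_uminus_conv_diff)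
    moreover have "act (l' - l) (act l p) \<in> Q"
      using that(3) act_simps(2)[of "l' - l" l p] by simp
    then have "l' - l \<in> R" by (rule return[OF that(1)])
    ultimately have "l' - l = 0" using U by auto
    then show ?thesis by simp
  qed
  define L where "L = {l \<in> R. act l p \<in> Q \<and> g - l \<in> W}"
  have "L = {} \<or> (\<exists>l. L = {l})" using uniq unfolding L_def by blast
  then have L: "finite L" "card L \<le> 1" by auto
  have "weight_sum w p g = (\<integral>\<^sup>+l. indicator L l \<partial>count_space R)"
    unfolding weight_sum_def by (rule nn_integral_cong) (auto simp: w L_def indicator_def)
  also have "\<dots> = emeasure (count_space R) L" by (rule nn_integral_indicator) (auto simp: L_def)
  also have "\<dots> \<le> 1" using L by (subst emeasure_count_space_finite) (auto simp: L_def)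
  finally show ?thesis .
qed

text \<open>Finitely many translates \<open>T (k i)\<close> of a small compact \<open>W\<close>
  cover \<open>K\<close>, so the sets \<open>T (k i) Q\<close> cover the saturation of
  \<open>Q\<close>. A point is assigned to the first of these sets that contains it and has a unique
  representation there, because \<open>W\<close> is small; marking this representation is a weight
  with sum 1. The mass is at most that of \<open>\<rho>\<close> times the sum of the Haar measures
  of the translates. The last conclusion compares this weight with that of a single small set, whose
  sum is at most 1.\<close>

proposition invariant_measure_of_transversal:
  assumes \<sigma>: "\<And>n::nat. compact (C n)" "Q = (\<Union>n. C n)"
    and U: "open U" "0 \<in> U" "R \<inter> U \<subseteq> {0}"
    and K: "compact K" "\<And>g q. q \<in> Q \<Longrightarrow> \<exists>k\<in>K. \<exists>q'\<in>Q. act g q = act k q'"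
  obtains \<eta> where "finite_measure \<eta>" "sets \<eta> = sets borel" "invariant_measure act \<eta>"
    "\<forall>S\<in>sets borel. \<forall>W\<in>sets borel. (\<forall>a\<in>W. \<forall>b\<in>W. - a + b \<in> U) \<longrightarrow>
      (\<integral>\<^sup>+p. \<integral>\<^sup>+g. indicator S (act g p) * (indicator W g * indicator Q p) \<partial>m \<partial>\<rho>) \<le> emeasure \<eta> S"
proof -
  obtain W V where W: "compact W" "open V" "(0::'g) \<in> V" "V \<subseteq> W" "\<And>a b. a \<in> W \<Longrightarrow> b \<in> W \<Longrightarrow> - a + b \<in> U"
    by (rule small_compact_neighbourhood[OF U(1,2)]) (rule that)
  define T where "T k = (\<lambda>h. k + h) ` W" for k
  have Tc: "compact (T k)" for k
    unfolding T_def by (rule compact_continuous_image[OF _ W(1)]) (intro continuous_intros)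
  have Tb: "T k \<in> sets borel" for k by (rule compact_borel[OF Tc])
  have "K \<subseteq> (\<Union>k\<in>K. (\<lambda>h. k + h) ` V)"
  proof
    fix k assume "k \<in> K"
    moreover have "k \<in> (\<lambda>h. k + h) ` V" using W(3) by (auto simp: image_iff intro!: bexI[of _ 0])
    ultimately show "k \<in> (\<Union>k\<in>K. (\<lambda>h. k + h) ` V)" by blast
  qed
  then obtain J where J: "J \<subseteq> K" "finite J" "K \<subseteq> (\<Union>k\<in>J. (\<lambda>h. k + h) ` V)"
    using compactE_image[OF K(1), of K "\<lambda>k. (\<lambda>h. k + h) ` V"] open_translate[OF W(2)] by metis
  obtain n and k :: "nat \<Rightarrow> 'g" where k: "J = k ` {i. i < n}"
    using finite_imp_nat_seg_image_inj_on[OF J(2)] by blast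
  have cover: "\<exists>i<n. x \<in> T (k i)" if "x \<in> K" for x
    using that J(3) W(4) unfolding k T_def by blast
  \<comment> \<open>Since \<open>Q\<close> is a countable union of compact sets, these images are
    sigma-compact and therefore Borel.\<close>
  define A where "A i = (\<lambda>(g, q). act g q) ` (T (k i) \<times> Q)" for i
  have Ab: "A i \<in> sets borel" for i
  proof -
    have "A i = (\<Union>j. (\<lambda>(g, q). act g q) ` (T (k i) \<times> C j))" unfolding A_def \<sigma>(2) by blast
    moreover have "compact ((\<lambda>(g, q). act g q) ` (T (k i) \<times> C j))" for j
      by (intro compact_continuous_image compact_Times Tc \<sigma>(1) jointly_continuous_action_simps(7)[OF action])
    then have "(\<lambda>(g, q). act g q) ` (T (k i) \<times> C j) \<in> sets borel" for j
      by (intro borel_closed compact_imp_closed)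
    then have "(\<Union>j. (\<lambda>(g, q). act g q) ` (T (k i) \<times> C j)) \<in> sets borel"
      by (intro sets.countable_UN) auto
    ultimately show ?thesis by simp
  qed
  define Y where "Y i = disjointed A i" for i
  have Yb: "Y i \<in> sets borel" for i
    unfolding Y_def disjointed_def using Ab by auto
  have Y_disj: "i = j" if "y \<in> Y i" "y \<in> Y j" for i j y
    using disjoint_family_disjointed[of A] that unfolding Y_def disjoint_family_on_def by blast
  \<comment> \<open>The sets \<open>Y i\<close> are disjoint, so at most one summand is nonzero and
    \<open>w\<close> takes only the values 0 and 1.\<close>
  define w where "w p g = (\<Sum>i<n. indicator (T (k i)) g * indicator (Y i) (act g p)) * (indicator Q p :: ennreal)" for p g
  have w: "weight w"
    unfolding weight_def w_def
  proof (intro conjI allI impI borel_measurable_times_ennreal borel_measurable_sum)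
    fix i
    show "(\<lambda>x. indicator (T (k i)) (snd x) :: ennreal) \<in> borel_measurable (borel \<Otimes>\<^sub>M borel)"
      by (rule measurable_compose[OF measurable_snd borel_measurable_indicator[OF Tb]])
    show "(\<lambda>x. indicator (Y i) (act (snd x) (fst x)) :: ennreal) \<in> borel_measurable (borel \<Otimes>\<^sub>M borel)"
      by (rule measurable_compose[OF act_measurable2[OF measurable_snd measurable_fst] borel_measurable_indicator[OF Yb]])
    show "(\<lambda>x. indicator Q (fst x) :: ennreal) \<in> borel_measurable (borel \<Otimes>\<^sub>M borel)"
      by (rule measurable_compose[OF measurable_fst borel_measurable_indicator[OF Q_borel]])
  qed simp
  have sum1: "weight_sum w p g = 1" if p: "p \<in> Q" for p g
  proof -
    obtain x q where xq: "x \<in> K" "q \<in> Q" "act g p = act x q" using K(2)[OF p, of g] by blast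
    obtain i where "i < n" "x \<in> T (k i)" using cover[OF xq(1)] by blast
    then have "act g p \<in> A i" unfolding A_def xq(3) using xq(2) by auto
    then have "act g p \<in> (\<Union>i<n. disjointed A i)"
      using \<open>i < n\<close> finite_UN_disjointed_eq[of A n] by (auto simp: lessThan_atLeast0)
    then obtain i0 where i0: "i0 < n" "act g p \<in> Y i0" unfolding Y_def by auto
    then have "act g p \<in> A i0" using disjointed_subset[of A i0] unfolding Y_def by auto
    then obtain a q0 where aq: "a \<in> W" "q0 \<in> Q" "act g p = act (k i0 + a) q0"
      unfolding A_def T_def by auto
    \<comment> \<open>The only return time that contributes: it takes \<open>p\<close> to the
      representative \<open>q0\<close> of \<open>act g p\<close> that belongs to the piece
      \<open>Y i0\<close>.\<close>
    define l0 where "l0 = - (k i0 + a) + g"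
    have l0p: "act l0 p = q0" 
      unfolding l0_def act_simps(2)[of "- (k i0 + a)" g] aq(3) by (rule act_simps(3))
    have "l0 \<in> R" by (rule return[OF p]) (simp add: l0p aq(2))
    have uniq: "l = l0" if l1: "act l p \<in> Q" and l2: "g - l \<in> T (k i0)" for l
    proof -
      obtain b where b: "b \<in> W" "g - l = k i0 + b" using l2 unfolding T_def by auto
      have e: "- (k i0 + b) + (k i0 + a) = l - l0"
        unfolding b(2)[symmetric] l0_def by (simp add: diff_conv_add_uminus minus_add add.assoc del: add_uminus_conv_diff)
      have "- (k i0 + b) + (k i0 + a) = - b + a" by (simp add: diff_conv_add_uminus minus_add add.assoc del: add_uminus_conv_diff)
      then have "l - l0 \<in> U" using W(5)[OF b(1) aq(1)] e by simp
      moreover have "act (l - l0) (act l0 p) = act l p" using act_simps(2)[of "l - l0" l0 p] by simp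
      then have "l - l0 \<in> R" using return[of "act l0 p" "l - l0"] l1 l0p aq(2) by simp
      ultimately have "l - l0 = 0" using U(3) by auto
      then show ?thesis by simp
    qed
    have gl0: "g - l0 \<in> T (k i0)" unfolding T_def l0_def
      using aq(1) by (simp add: diff_conv_add_uminus minus_add add.assoc del: add_uminus_conv_diff)
    have wt: "w (act l p) (g - l) = indicator {l0} l" if "l \<in> R" for l
    proof -
      have "act (g - l) (act l p) = act g p" using act_simps(2)[of "g - l" l p] by simp
      then have "w (act l p) (g - l) = (\<Sum>i<n. indicator (T (k i)) (g - l) * indicator (Y i) (act g p)) * indicator Q (act l p)"
        unfolding w_def by simp
      also have "(\<Sum>i<n. indicator (T (k i)) (g - l) * indicator (Y i) (act g p)) =
          (\<Sum>i<n. if i = i0 then indicator (T (k i0)) (g - l) else (0::ennreal))"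
      proof (rule sum.cong[OF refl])
        fix i
        show "indicator (T (k i)) (g - l) * indicator (Y i) (act g p) = (if i = i0 then indicator (T (k i0)) (g - l) else (0::ennreal))"
        proof (cases "i = i0")
          case True
          then show ?thesis using i0(2) by simp
        next
          case False
          then have "act g p \<notin> Y i" using Y_disj[OF _ i0(2)] by blast
          then show ?thesis using False by simp
        qed
      qed
      also have "\<dots> = indicator (T (k i0)) (g - l)" using i0(1) by simp
      also have "indicator (T (k i0)) (g - l) * indicator Q (act l p) = (indicator {l0} l :: ennreal)"
      proof (cases "l = l0")
        case True
        then show ?thesis using gl0 l0p aq(2) by simp
      next
        case False
        then have "\<not> (act l p \<in> Q \<and> g - l \<in> T (k i0))" using uniq by blast
        then show ?thesis using False by (cases "act l p \<in> Q") simp_all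
      qed
      finally show ?thesis .
    qed
    have "weight_sum w p g = (\<integral>\<^sup>+l. indicator {l0} l \<partial>count_space R)"
      unfolding weight_sum_def by (rule nn_integral_cong) (simp add: wt)
    also have "\<dots> = emeasure (count_space R) {l0}" using \<open>l0 \<in> R\<close> by (intro nn_integral_indicator) simp
    also have "\<dots> = 1" using \<open>l0 \<in> R\<close> by simp
    finally show ?thesis .
  qed
  show thesis
  proof (rule that[of "suspension_measure w"])
    show "sets (suspension_measure w) = sets borel" by (rule sets_suspension)
    show "invariant_measure act (suspension_measure w)" by (rule suspension_invariant[OF w sum1])
    show "finite_measure (suspension_measure w)"
    proof (rule finite_measureI)
      have sp: "space (suspension_measure w) = UNIV"
        using sets_eq_imp_space_eq[OF sets_suspension] by simp
      have "emeasure (suspension_measure w) UNIV = (\<integral>\<^sup>+y. 1 \<partial>suspension_measure w)"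
        by (simp add: sp)
      also have "\<dots> = (\<integral>\<^sup>+p. \<integral>\<^sup>+g. 1 * w p g \<partial>m \<partial>\<rho>)" by (rule nn_integral_suspension[OF w]) simp
      also have "\<dots> \<le> (\<integral>\<^sup>+p. \<integral>\<^sup>+g. (\<Sum>i<n. indicator (T (k i)) g) \<partial>m \<partial>\<rho>)"
      proof (intro nn_integral_mono)
        fix p g
        have "(\<Sum>i<n. indicator (T (k i)) g * indicator (Y i) (act g p)) \<le> (\<Sum>i<n. indicator (T (k i)) g :: ennreal)"
          by (intro sum_mono) (simp add: indicator_def)
        then show "1 * w p g \<le> (\<Sum>i<n. indicator (T (k i)) g)"
          by (cases "p \<in> Q") (simp_all add: w_def)
      qed
      also have "(\<integral>\<^sup>+g. (\<Sum>i<n. indicator (T (k i)) g) \<partial>m) = (\<Sum>i<n. emeasure m (T (k i)))"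
      proof (subst nn_integral_sum)
        show "indicator (T (k i)) \<in> borel_measurable m" for i
          by (intro m_measurable borel_measurable_indicator Tb)
      qed (use Tb in \<open>simp add: sets_m\<close>)
      also have "(\<integral>\<^sup>+p. (\<Sum>i<n. emeasure m (T (k i))) \<partial>\<rho>) = (\<Sum>i<n. emeasure m (T (k i))) * emeasure \<rho> UNIV"
        by (simp add: space_\<rho>)
      also have "\<dots> < \<infinity>"
      proof -
        have "emeasure \<rho> UNIV < top"
          using finite_measure.emeasure_finite[OF finite_\<rho>, of UNIV] by (simp add: less_top)
        moreover have "(\<Sum>i<n. emeasure m (T (k i))) < top" using m_compact[OF Tc] by simp
        ultimately show ?thesis by (simp add: ennreal_mult_less_top)
      qed
      finally show "emeasure (suspension_measure w) (space (suspension_measure w)) \<noteq> \<infinity>" by (simp add: sp)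
    qed
    show "\<forall>S\<in>sets borel. \<forall>W\<in>sets borel. (\<forall>a\<in>W. \<forall>b\<in>W. - a + b \<in> U) \<longrightarrow>
      (\<integral>\<^sup>+p. \<integral>\<^sup>+g. indicator S (act g p) * (indicator W g * indicator Q p) \<partial>m \<partial>\<rho>) \<le> emeasure (suspension_measure w) S"
    proof (intro ballI impI)
      fix S :: "'y set" and W' :: "'g set"
      assume S: "S \<in> sets borel" and W'1: "W' \<in> sets borel" and W'2: "\<forall>a\<in>W'. \<forall>b\<in>W'. - a + b \<in> U"
      note W' = W'1 W'2[rule_format]
      define w' :: "'y \<Rightarrow> 'g \<Rightarrow> ennreal" where "w' p g = indicator W' g * indicator Q p" for p g
      have w': "weight w'"
        unfolding weight_def w'_def
        by (auto intro!: borel_measurable_times_ennreal measurable_compose[OF measurable_snd borel_measurable_indicator[OF W'(1)]]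
          measurable_compose[OF measurable_fst borel_measurable_indicator[OF Q_borel]])
      have "(\<integral>\<^sup>+p. \<integral>\<^sup>+g. indicator S (act g p) * w' p g \<partial>m \<partial>\<rho>) = (\<integral>\<^sup>+y. indicator S y \<partial>suspension_measure w')"
        by (rule nn_integral_suspension[OF w', symmetric]) (use S in simp)
      also have "\<dots> \<le> (\<integral>\<^sup>+y. indicator S y \<partial>suspension_measure w)"
      proof (rule suspension_mono[OF w sum1 w'])
        show "weight_sum w' p g \<le> 1" for p g
          by (rule weight_sum_translate_le[OF W'(2) U(3)]) (simp_all add: w'_def)
      qed (use S in auto)
      also have "\<dots> = emeasure (suspension_measure w) S" using S by (simp add: sets_suspension)
      finally show "(\<integral>\<^sup>+p. \<integral>\<^sup>+g. indicator S (act g p) * (indicator W' g * indicator Q p) \<partial>m \<partial>\<rho>) \<le> emeasure (suspension_measure w) S"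
        unfolding w'_def .
    qed
  qed
qed

end

subsection \<open>The transverse measure on the saturated cross section\<close>

locale transversal = unimodular_haar m
  for m :: "'g::{topological_group_add, t2_space, second_countable_topology} measure" +
  fixes act :: "'g \<Rightarrow> 'x::polish_space \<Rightarrow> 'x" and Z :: "'x set" and \<mu> \<nu> :: "'x measure"
  assumes action: "jointly_continuous_action act" and Z_borel: "Z \<in> sets borel"
    and prob_\<mu>: "prob_space \<mu>" and transverse: "transverse_measure m act Z \<mu> \<nu>"
begin

lemmas act_simps = jointly_continuous_action_simps(1-4)[OF action]

lemma act_measurable: "act g \<in> borel \<rightarrow>\<^sub>M borel"
  by (rule jointly_continuous_action_measurable[OF action])

lemma finite_\<nu>: "finite_measure \<nu>" and space_\<nu>: "space \<nu> = Z" and sets_\<nu>: "sets \<nu> = sets (restrict_space borel Z)"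
  using transverse unfolding transverse_measure_def by auto

lemma Int_Z_sets: "A \<in> sets borel \<Longrightarrow> A \<inter> Z \<in> sets \<nu>"
  unfolding sets_\<nu> using Z_borel by (simp add: sets_restrict_space_iff)

definition \<nu>' :: "'x measure" where "\<nu>' = distr \<nu> borel (\<lambda>x. x)"

lemma sets_\<nu>': "sets \<nu>' = sets borel" by (simp add: \<nu>'_def)

lemma id_measurable_\<nu>: "(\<lambda>x. x) \<in> \<nu> \<rightarrow>\<^sub>M borel"
proof (rule measurableI)
  show "(\<lambda>x. x) -` A \<inter> space \<nu> \<in> sets \<nu>" if "A \<in> sets borel" for A
    using Int_Z_sets[OF that] by (simp add: space_\<nu>)
qed simp

lemma emeasure_\<nu>': "A \<in> sets borel \<Longrightarrow> emeasure \<nu>' A = emeasure \<nu> (A \<inter> Z)"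
  unfolding \<nu>'_def using emeasure_distr[OF id_measurable_\<nu>] by (simp add: space_\<nu>)

lemma finite_\<nu>': "finite_measure \<nu>'"
  unfolding \<nu>'_def by (rule finite_measure.finite_measure_distr[OF finite_\<nu> id_measurable_\<nu>])

text \<open>All \<open>n\<close> are put into one test function because measurability in
  \<open>x\<close> of the inner sum is not established, so the integral over \<open>\<mu>\<close>
  could not be split afterwards; a finite range keeps the function bounded. As
  \<open>A n \<subseteq> Z\<close>, the sum over the hitting times extends by zero to the whole
  group.\<close>

lemma transverse_sum:
  fixes S :: "nat \<Rightarrow> 'g set" and A :: "nat \<Rightarrow> 'x set"
  assumes S: "\<And>n. S n \<in> sets borel" and A: "\<And>n. A n \<in> sets borel" "\<And>n. A n \<subseteq> Z"
  shows "(\<integral>\<^sup>+x. (\<integral>\<^sup>+g. (\<Sum>n<N. indicator (S n) (- g) * indicator (A n) (act g x)) \<partial>count_space UNIV) \<partial>\<mu>) =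
    (\<Sum>n<N. emeasure m (S n) * emeasure \<nu>' (A n))"
proof -
  define f :: "'g \<times> 'x \<Rightarrow> real" where
    "f z = (\<Sum>n<N. indicator (S n) (fst z) * indicator (A n) (snd z))" for z
  have ef: "ennreal (f (g, x)) = (\<Sum>n<N. indicator (S n) g * indicator (A n) x)" for g x
    by (simp add: f_def indicator_def ennreal_of_nat_eq_real_of_nat)
  have snd_m: "snd \<in> borel \<Otimes>\<^sub>M restrict_space borel Z \<rightarrow>\<^sub>M (borel :: 'x measure)"
    using measurable_compose[OF measurable_snd, of "\<lambda>x. x" "restrict_space borel Z" borel borel]
    by (simp add: measurable_restrict_space1)
  have fm: "f \<in> borel_measurable (borel \<Otimes>\<^sub>M restrict_space borel Z)"
    unfolding f_def[abs_def]
    by (intro borel_measurable_sum borel_measurable_times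
        measurable_compose[OF measurable_fst borel_measurable_indicator[OF S]]
        measurable_compose[OF snd_m borel_measurable_indicator[OF A(1)]])
  have fb: "\<exists>C. \<forall>g. \<forall>z\<in>Z. 0 \<le> f (g, z) \<and> f (g, z) \<le> C"
  proof (intro exI allI ballI conjI)
    fix g z
    show "0 \<le> f (g, z)" unfolding f_def by (intro sum_nonneg) simp
    have "f (g, z) \<le> (\<Sum>n<N. 1)" unfolding f_def by (intro sum_mono) (simp add: indicator_def)
    then show "f (g, z) \<le> real N" by simp
  qed
  have "(\<integral>\<^sup>+x. (\<integral>\<^sup>+g. (\<Sum>n<N. indicator (S n) (- g) * indicator (A n) (act g x)) \<partial>count_space UNIV) \<partial>\<mu>) =
      (\<integral>\<^sup>+x. (\<integral>\<^sup>+g. ennreal (f (- g, act g x)) \<partial>count_space (hitting_times act Z x)) \<partial>\<mu>)"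
    unfolding ef
  proof (intro nn_integral_cong nn_integral_count_space_eq)
    fix x g assume "g \<in> UNIV - hitting_times act Z x"
    then have "act g x \<notin> A n" for n using A(2) unfolding hitting_times_def by blast
    then show "(\<Sum>n<N. indicator (S n) (- g) * indicator (A n) (act g x)) = (0::ennreal)" by simp
  qed simp
  also have "\<dots> = (\<integral>\<^sup>+g. (\<integral>\<^sup>+z. ennreal (f (g, z)) \<partial>\<nu>) \<partial>m)"
    using transverse fm fb unfolding transverse_measure_def by blast
  also have "\<dots> = (\<integral>\<^sup>+g. (\<Sum>n<N. indicator (S n) g * emeasure \<nu>' (A n)) \<partial>m)"
  proof (rule nn_integral_cong)
    fix g
    have Am: "indicator (A n) \<in> borel_measurable \<nu>" for n
      using measurable_compose[OF id_measurable_\<nu> borel_measurable_indicator[OF A(1)[of n]]] by simp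
    have "A n \<inter> Z = A n" for n using A(2) by blast
    then have An: "A n \<in> sets \<nu>" "emeasure \<nu>' (A n) = emeasure \<nu> (A n)" for n
      using Int_Z_sets[OF A(1)[of n]] emeasure_\<nu>'[OF A(1)[of n]] by simp_all
    have "(\<integral>\<^sup>+z. ennreal (f (g, z)) \<partial>\<nu>) = (\<Sum>n<N. \<integral>\<^sup>+z. indicator (S n) g * indicator (A n) z \<partial>\<nu>)"
      unfolding ef by (rule nn_integral_sum) (intro borel_measurable_times_ennreal borel_measurable_const Am)
    also have "\<dots> = (\<Sum>n<N. indicator (S n) g * emeasure \<nu>' (A n))"
      using An by (simp add: nn_integral_cmult Am)
    finally show "(\<integral>\<^sup>+z. ennreal (f (g, z)) \<partial>\<nu>) = (\<Sum>n<N. indicator (S n) g * emeasure \<nu>' (A n))" .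
  qed
  also have "\<dots> = (\<Sum>n<N. \<integral>\<^sup>+g. indicator (S n) g * emeasure \<nu>' (A n) \<partial>m)"
    by (rule nn_integral_sum) (intro borel_measurable_times_ennreal borel_measurable_const m_measurable borel_measurable_indicator S)
  also have "\<dots> = (\<Sum>n<N. emeasure m (S n) * emeasure \<nu>' (A n))"
    using S by (intro sum.cong refl nn_integral_multc[THEN trans]) (auto simp: sets_m intro: m_measurable borel_measurable_indicator)
  finally show ?thesis .
qed

lemma compact_pos:
  assumes "open U" "(0::'g) \<in> U"
  obtains W where "W \<in> sets borel" "0 < emeasure m W" "emeasure m W < \<infinity>" "compact W" "W \<subseteq> U"
    "\<And>a b. a \<in> W \<Longrightarrow> b \<in> W \<Longrightarrow> - a + b \<in> U" "\<exists>V. open V \<and> 0 \<in> V \<and> V \<subseteq> W"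
proof -
  obtain W V where W: "compact W" "open V" "(0::'g) \<in> V" "V \<subseteq> W" "W \<subseteq> U" "\<And>a b. a \<in> W \<Longrightarrow> b \<in> W \<Longrightarrow> - a + b \<in> U"
    by (rule small_compact_neighbourhood[OF assms]) (rule that)
  have Wb: "W \<in> sets borel" by (rule compact_borel[OF W(1)])
  have "0 < emeasure m V" by (rule emeasure_open_pos[OF W(2,3)])
  also have "emeasure m V \<le> emeasure m W" by (rule emeasure_mono[OF W(4)]) (simp add: sets_m Wb)
  finally show thesis
    by (rule that[OF Wb _ m_compact[OF W(1)] W(1,5,6)]) (use W in auto)
qed

lemma translate_measurable:
  assumes "A \<in> sets borel"
  shows "act g -` A \<in> sets borel"
  using measurable_sets[OF act_measurable assms, of g] by simp

text \<open>Along an orbit, the visits to the domain and to the image of the partial translation by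
  \<open>c\<close> correspond under \<open>g \<mapsto> c + g\<close>. The transverse formula with
  the windows \<open>W + c\<close> and \<open>W\<close> thus gives the same value twice, and the
  windows have equal Haar measure by right invariance.\<close>

lemma partially_invariant_\<nu>': "partially_invariant act Z \<nu>'"
  unfolding partially_invariant_def
proof (intro allI ballI)
  fix c :: 'g and B :: "'x set" assume B: "B \<in> sets borel"
  let ?A = "{x\<in>Z. act c x \<in> Z \<inter> B}" and ?A' = "{x\<in>Z \<inter> B. act (- c) x \<in> Z}"
  have "?A = Z \<inter> act c -` (Z \<inter> B)" "?A' = Z \<inter> B \<inter> act (- c) -` Z" by auto
  moreover have "Z \<inter> act c -` (Z \<inter> B) \<in> sets borel" "Z \<inter> B \<inter> act (- c) -` Z \<in> sets borel"
    using translate_measurable[of "Z \<inter> B" c] translate_measurable[OF Z_borel, of "- c"] Z_borel B by auto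
  ultimately have Ab: "?A \<in> sets borel" "?A' \<in> sets borel" by simp_all
  obtain W where W: "W \<in> sets borel" "0 < emeasure m W" "emeasure m W < \<infinity>"
    by (rule compact_pos[OF open_UNIV UNIV_I]) (rule that)
  let ?W = "(\<lambda>h. h + c) ` W"
  have W': "emeasure m ?W = emeasure m W" "?W \<in> sets borel" by (rule emeasure_right[OF W(1)])+
  have eq1: "(\<integral>\<^sup>+x. (\<integral>\<^sup>+g. indicator S (- g) * indicator A (act g x) \<partial>count_space UNIV) \<partial>\<mu>) = emeasure m S * emeasure \<nu>' A"
    if "S \<in> sets borel" "A \<in> sets borel" "A \<subseteq> Z" for S A
    using transverse_sum[of "\<lambda>_. S" "\<lambda>_. A" "Suc 0"] that by (simp add: lessThan_Suc)
  have bij: "bij_betw (\<lambda>g. c + g) UNIV UNIV"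
    by (rule bij_betw_byWitness[of _ "\<lambda>g. - c + g"]) (auto simp: add.assoc[symmetric])
  have term_eq: "indicator ?W (- g) * indicator ?A (act g x) = (indicator W (- (c + g)) * indicator ?A' (act (c + g) x) :: ennreal)" for g x
  proof -
    have "- g \<in> ?W \<longleftrightarrow> - (c + g) \<in> W"
      unfolding right_translate_eq_vimage by (simp add: minus_add)
    moreover have "act g x \<in> ?A \<longleftrightarrow> act (c + g) x \<in> ?A'" by (auto simp: act_simps)
    ultimately show ?thesis by (simp add: indicator_def)
  qed
  have "emeasure m W * emeasure \<nu>' ?A = emeasure m ?W * emeasure \<nu>' ?A" by (simp add: W')
  also have "\<dots> = (\<integral>\<^sup>+x. (\<integral>\<^sup>+g. indicator ?W (- g) * indicator ?A (act g x) \<partial>count_space UNIV) \<partial>\<mu>)"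
    by (rule eq1[OF W'(2) Ab(1), symmetric]) auto
  also have "\<dots> = (\<integral>\<^sup>+x. (\<integral>\<^sup>+g. indicator W (- g) * indicator ?A' (act g x) \<partial>count_space UNIV) \<partial>\<mu>)"
    unfolding term_eq
    by (intro nn_integral_cong nn_integral_bij_count_space[OF bij, of "\<lambda>g. indicator W (- g) * indicator ?A' (act g _)"])
  also have "\<dots> = emeasure m W * emeasure \<nu>' ?A'"
    by (rule eq1[OF W(1) Ab(2)]) auto
  finally show "emeasure \<nu>' ?A = emeasure \<nu>' ?A'"
    using W(2,3) by (auto simp: ennreal_mult_cancel_left)
qed

end

text \<open>In the application \<open>l\<close> enumerates the return times of \<open>Z\<close>, and
  \<open>R\<close> consists of all products of three of them, which contain the return times between
  translates of \<open>Z\<close> by such elements.\<close>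

locale saturated_transversal = transversal m act Z \<mu> \<nu>
  for m :: "'g::{topological_group_add, t2_space, second_countable_topology} measure"
    and act :: "'g \<Rightarrow> 'x::polish_space \<Rightarrow> 'x" and Z \<mu> \<nu> +
  fixes l :: "nat \<Rightarrow> 'g" and R U :: "'g set"
  assumes l0: "0 \<in> range l"
    and U: "open U" "0 \<in> U" "R \<inter> U \<subseteq> {0}"
    and return: "\<And>i j h x z. x \<in> Z \<Longrightarrow> z \<in> Z \<Longrightarrow> act h (act (l i) x) = act (l j) z \<Longrightarrow> h \<in> R"
begin

definition P :: "'x set" where "P = (\<Union>n. act (l n) ` Z)"

text \<open>A point of \<open>P\<close> may lie in several translates of \<open>Z\<close>. The first
  of them is selected, so that the extended measure counts the point once.\<close>

definition piece :: "nat \<Rightarrow> 'x set" where "piece = disjointed (\<lambda>n. act (l n) ` Z)"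

lemma translate_Z_borel: "act g ` Z \<in> sets borel"
proof -
  have "act g ` Z = act (- g) -` Z"
  proof (intro equalityI subsetI)
    fix x assume "x \<in> act (- g) -` Z"
    then have "act g (act (- g) x) \<in> act g ` Z" by blast
    then show "x \<in> act g ` Z" by (simp add: act_simps)
  qed (auto simp: act_simps)
  then show ?thesis using translate_measurable[OF Z_borel, of "- g"] by simp
qed

lemma P_borel: "P \<in> sets borel"
  unfolding P_def using translate_Z_borel by (intro sets.countable_UN) auto

lemma piece_borel: "piece n \<in> sets borel"
  unfolding piece_def disjointed_def using translate_Z_borel by auto

lemma piece_subset: "piece n \<subseteq> act (l n) ` Z"
  unfolding piece_def by (rule disjointed_subset)

lemma piece_disjoint: "disjoint_family piece"
  unfolding piece_def by (rule disjoint_family_disjointed)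

lemma piece_UN: "(\<Union>n. piece n) = P"
  unfolding piece_def P_def by (rule UN_disjointed_eq)

lemma Z_subset_P: "Z \<subseteq> P"
proof
  fix z assume "z \<in> Z"
  obtain n where n: "l n = 0" using l0 by (metis rangeE)
  then have "z = act (l n) z" by (simp add: act_simps)
  then have "z \<in> act (l n) ` Z" using \<open>z \<in> Z\<close> by (rule image_eqI)
  then show "z \<in> P" unfolding P_def by blast
qed

lemma return_P: "x \<in> P \<Longrightarrow> act h x \<in> P \<Longrightarrow> h \<in> R"
  unfolding P_def using return by blast

text \<open>The sum over \<open>n\<close> of the images under \<open>l n\<close> of the part of
  \<open>\<nu>'\<close> that lands in \<open>piece n\<close>. Writing it as a single image measure
  of a product with the counting measure provides countable additivity.\<close>

definition \<nu>P :: "'x measure" where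
  "\<nu>P = distr (density (count_space UNIV \<Otimes>\<^sub>M \<nu>') (\<lambda>x. indicator Z (snd x) * indicator (piece (fst x)) (act (l (fst x)) (snd x))))
     borel (\<lambda>x. act (l (fst x)) (snd x))"

lemma sets_\<nu>P: "sets \<nu>P = sets borel" by (simp add: \<nu>P_def)

lemma emeasure_\<nu>P:
  assumes A: "A \<in> sets borel"
  shows "emeasure \<nu>P A = (\<Sum>n. emeasure \<nu>' {z\<in>Z. act (l n) z \<in> piece n \<inter> A})"
proof -
  interpret N: finite_measure \<nu>' by (rule finite_\<nu>')
  let ?M = "count_space (UNIV::nat set) \<Otimes>\<^sub>M \<nu>'"
  let ?f = "\<lambda>x. indicator Z (snd x) * indicator (piece (fst x)) (act (l (fst x)) (snd x)) :: ennreal"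
  have am: "(\<lambda>x. act (l (fst x)) (snd x)) \<in> ?M \<rightarrow>\<^sub>M borel"
  proof (rule measurable_pair_measure_countable1)
    show "(\<lambda>y. act (l (fst (x, y))) (snd (x, y))) \<in> \<nu>' \<rightarrow>\<^sub>M borel" for x
      using act_measurable[of "l x"] by (simp add: sets_\<nu>' cong: measurable_cong_sets)
  qed simp
  have fm: "?f \<in> borel_measurable ?M"
  proof (rule measurable_pair_measure_countable1)
    fix x
    have "(\<lambda>y. indicator Z y * indicator (piece x) (act (l x) y) :: ennreal) \<in> borel_measurable borel"
      by (intro borel_measurable_times_ennreal borel_measurable_indicator Z_borel
          measurable_compose[OF act_measurable borel_measurable_indicator] piece_borel)
    then show "(\<lambda>y. ?f (x, y)) \<in> borel_measurable \<nu>'" by (simp add: sets_\<nu>' cong: measurable_cong_sets)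
  qed simp
  have sA: "(\<lambda>x. act (l (fst x)) (snd x)) -` A \<inter> space ?M \<in> sets ?M" by (rule measurable_sets[OF am A])
  have "emeasure \<nu>P A = emeasure (density ?M ?f) ((\<lambda>x. act (l (fst x)) (snd x)) -` A \<inter> space ?M)"
    unfolding \<nu>P_def using am A by (subst emeasure_distr) simp_all
  also have "\<dots> = (\<integral>\<^sup>+x. ?f x * indicator ((\<lambda>x. act (l (fst x)) (snd x)) -` A \<inter> space ?M) x \<partial>?M)"
    by (rule emeasure_density[OF fm sA])
  also have "\<dots> = (\<integral>\<^sup>+n. \<integral>\<^sup>+z. ?f (n, z) * indicator ((\<lambda>x. act (l (fst x)) (snd x)) -` A \<inter> space ?M) (n, z) \<partial>\<nu>' \<partial>count_space UNIV)"
    by (rule N.nn_integral_fst[symmetric]) (intro borel_measurable_times_ennreal fm borel_measurable_indicator sA)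
  also have "\<dots> = (\<integral>\<^sup>+n. emeasure \<nu>' {z\<in>Z. act (l n) z \<in> piece n \<inter> A} \<partial>count_space UNIV)"
  proof (rule nn_integral_cong)
    fix n :: nat
    have "{z\<in>Z. act (l n) z \<in> piece n \<inter> A} = Z \<inter> act (l n) -` (piece n \<inter> A)" by auto
    then have s: "{z\<in>Z. act (l n) z \<in> piece n \<inter> A} \<in> sets \<nu>'"
      using Z_borel translate_measurable[of "piece n \<inter> A" "l n"] piece_borel[of n] A by (simp add: sets_\<nu>')
    have "(\<integral>\<^sup>+z. ?f (n, z) * indicator ((\<lambda>x. act (l (fst x)) (snd x)) -` A \<inter> space ?M) (n, z) \<partial>\<nu>')
        = (\<integral>\<^sup>+z. indicator {z\<in>Z. act (l n) z \<in> piece n \<inter> A} z \<partial>\<nu>')"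
      by (rule nn_integral_cong) (auto simp: indicator_def space_pair_measure)
    also have "\<dots> = emeasure \<nu>' {z\<in>Z. act (l n) z \<in> piece n \<inter> A}"
      by (rule nn_integral_indicator[OF s])
    finally show "(\<integral>\<^sup>+z. ?f (n, z) * indicator ((\<lambda>x. act (l (fst x)) (snd x)) -` A \<inter> space ?M) (n, z) \<partial>\<nu>')
        = emeasure \<nu>' {z\<in>Z. act (l n) z \<in> piece n \<inter> A}" .
  qed
  also have "\<dots> = (\<Sum>n. emeasure \<nu>' {z\<in>Z. act (l n) z \<in> piece n \<inter> A})"
    by (rule nn_integral_count_space_nat)
  finally show ?thesis .
qed

lemma pinv_\<nu>':
  assumes "B \<in> sets borel"
  shows "emeasure \<nu>' {x\<in>Z. act g x \<in> Z \<inter> B} = emeasure \<nu>' {x\<in>Z \<inter> B. act (- g) x \<in> Z}"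
  using partially_invariant_\<nu>' assms unfolding partially_invariant_def by blast

text \<open>Moving \<open>piece n \<inter> A\<close> back by \<open>l n\<close> is a partial
  translation within \<open>Z\<close>, so it preserves \<open>\<nu>'\<close>; the pieces partition
  \<open>A\<close>.\<close>

lemma emeasure_\<nu>P_Z:
  assumes A: "A \<in> sets borel" "A \<subseteq> Z"
  shows "emeasure \<nu>P A = emeasure \<nu>' A"
proof -
  have "{z\<in>Z. act (l n) z \<in> piece n \<inter> A} = {z\<in>Z. act (l n) z \<in> Z \<inter> (piece n \<inter> A)}" for n using A(2) by auto
  moreover have "{x\<in>Z \<inter> (piece n \<inter> A). act (- l n) x \<in> Z} = piece n \<inter> A" for n
    using A(2) piece_subset[of n] by (auto simp: act_simps)
  ultimately have "emeasure \<nu>P A = (\<Sum>n. emeasure \<nu>' (piece n \<inter> A))"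
    unfolding emeasure_\<nu>P[OF A(1)] using pinv_\<nu>'[of "piece _ \<inter> A"] piece_borel A(1) by simp
  also have "\<dots> = emeasure \<nu>' (\<Union>n. piece n \<inter> A)"
  proof (rule suminf_emeasure)
    show "range (\<lambda>n. piece n \<inter> A) \<subseteq> sets \<nu>'" using piece_borel A(1) by (auto simp: sets_\<nu>')
    show "disjoint_family (\<lambda>n. piece n \<inter> A)" using piece_disjoint unfolding disjoint_family_on_def by blast
  qed
  also have "(\<Union>n. piece n \<inter> A) = A" using piece_UN A(2) Z_subset_P by blast
  finally show ?thesis .
qed

text \<open>For points that \<open>g\<close> takes from \<open>piece i\<close> to
  \<open>piece j\<close>, the translation by \<open>g\<close> corresponds to a partial translation
  of \<open>Z\<close> between representatives, and this preserves \<open>\<nu>'\<close>. Summing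
  over all pairs of pieces gives the claim.\<close>

lemma partially_invariant_\<nu>P: "partially_invariant act P \<nu>P"
  unfolding partially_invariant_def
proof (intro allI ballI)
  fix g :: 'g and B :: "'x set" assume B: "B \<in> sets borel"
  define E where "E i j = {z\<in>Z. act (l i) z \<in> piece i \<and> act g (act (l i) z) \<in> piece j \<inter> B}" for i j
  define E' where "E' j i = {z\<in>Z. act (l j) z \<in> piece j \<inter> B \<and> act (- g) (act (l j) z) \<in> piece i}" for i j
  have vim: "act h -` A \<in> sets borel" if "A \<in> sets borel" for h A using that by (rule translate_measurable)
  have EE': "emeasure \<nu>' (E i j) = emeasure \<nu>' (E' j i)" for i j
  proof -
    \<comment> \<open>The group element that takes the representative in \<open>Z\<close> of a point
      of \<open>piece i\<close> to the representative of its translate in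
      \<open>piece j\<close>.\<close>
    let ?c = "- l j + g + l i"
    let ?B = "act (l j) -` (piece j \<inter> B) \<inter> act (- g + l j) -` piece i"
    have "?B \<in> sets borel" using vim piece_borel B by auto
    note pinv_\<nu>'[OF this, of ?c]
    moreover have "{x\<in>Z. act ?c x \<in> Z \<inter> ?B} = E i j"
    proof (intro equalityI subsetI)
      fix x assume x: "x \<in> E i j"
      then have "act g (act (l i) x) \<in> act (l j) ` Z" using piece_subset[of j] unfolding E_def by blast
      then obtain z where z: "z \<in> Z" "act g (act (l i) x) = act (l j) z" by blast
      then have "act ?c x = z" by (simp add: act_simps)
      then show "x \<in> {x\<in>Z. act ?c x \<in> Z \<inter> ?B}" using x z unfolding E_def by (auto simp: act_simps)
    next
      fix x assume "x \<in> {x\<in>Z. act ?c x \<in> Z \<inter> ?B}"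
      then show "x \<in> E i j" unfolding E_def by (auto simp: act_simps)
    qed
    moreover have "{x\<in>Z \<inter> ?B. act (- ?c) x \<in> Z} = E' j i"
    proof (intro equalityI subsetI)
      have mc: "- ?c = - l i + (- g + l j)" by (simp add: minus_add add.assoc diff_conv_add_uminus del: add_uminus_conv_diff)
      {
        fix x assume x: "x \<in> E' j i"
        then have "act (- g) (act (l j) x) \<in> act (l i) ` Z" using piece_subset[of i] unfolding E'_def by blast
        then obtain z where z: "z \<in> Z" "act (- g) (act (l j) x) = act (l i) z" by blast
        then have "act (- ?c) x = z" unfolding mc act_simps(2) by (simp add: act_simps(3))
        then show "x \<in> {x\<in>Z \<inter> ?B. act (- ?c) x \<in> Z}" using x z unfolding E'_def by (simp add: act_simps(2))
      next
        fix x assume "x \<in> {x\<in>Z \<inter> ?B. act (- ?c) x \<in> Z}"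
        then show "x \<in> E' j i" unfolding E'_def by (simp add: act_simps(2))
      }
    qed
    ultimately show ?thesis by simp
  qed
  have Eb: "E i j \<in> sets \<nu>'" "E' j i \<in> sets \<nu>'" for i j
  proof -
    have "E i j = Z \<inter> act (l i) -` piece i \<inter> act (l i) -` (act g -` (piece j \<inter> B))"
      "E' j i = Z \<inter> act (l j) -` (piece j \<inter> B) \<inter> act (l j) -` (act (- g) -` piece i)"
      unfolding E_def E'_def by auto
    moreover have "Z \<inter> act (l i) -` piece i \<inter> act (l i) -` (act g -` (piece j \<inter> B)) \<in> sets borel"
      "Z \<inter> act (l j) -` (piece j \<inter> B) \<inter> act (l j) -` (act (- g) -` piece i) \<in> sets borel"
      by (intro sets.Int vim Z_borel piece_borel B)+
    ultimately show "E i j \<in> sets \<nu>'" "E' j i \<in> sets \<nu>'" by (simp_all add: sets_\<nu>')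
  qed
  have "{x\<in>P. act g x \<in> P \<inter> B} = P \<inter> act g -` (P \<inter> B)" "{x\<in>P \<inter> B. act (- g) x \<in> P} = P \<inter> B \<inter> act (- g) -` P" by auto
  moreover have "P \<inter> act g -` (P \<inter> B) \<in> sets borel" "P \<inter> B \<inter> act (- g) -` P \<in> sets borel"
    by (intro sets.Int vim P_borel B)+
  ultimately have sb: "{x\<in>P. act g x \<in> P \<inter> B} \<in> sets borel" "{x\<in>P \<inter> B. act (- g) x \<in> P} \<in> sets borel" by simp_all
  have "emeasure \<nu>P {x\<in>P. act g x \<in> P \<inter> B} = (\<Sum>i. \<Sum>j. emeasure \<nu>' (E i j))"
    unfolding emeasure_\<nu>P[OF sb(1)]
  proof (rule suminf_cong)
    fix i
    have "{z\<in>Z. act (l i) z \<in> piece i \<inter> {x\<in>P. act g x \<in> P \<inter> B}} = (\<Union>j. E i j)"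
      unfolding E_def using piece_UN by blast
    also have "emeasure \<nu>' \<dots> = (\<Sum>j. emeasure \<nu>' (E i j))"
    proof (rule suminf_emeasure[symmetric])
      show "disjoint_family (E i)" using piece_disjoint unfolding disjoint_family_on_def E_def by blast
    qed (use Eb in blast)
    finally show "emeasure \<nu>' {z\<in>Z. act (l i) z \<in> piece i \<inter> {x\<in>P. act g x \<in> P \<inter> B}} = (\<Sum>j. emeasure \<nu>' (E i j))" .
  qed
  also have "\<dots> = (\<integral>\<^sup>+i. \<integral>\<^sup>+j. emeasure \<nu>' (E i j) \<partial>count_space UNIV \<partial>count_space UNIV)"
    by (simp add: nn_integral_count_space_nat)
  also have "\<dots> = (\<integral>\<^sup>+j. \<integral>\<^sup>+i. emeasure \<nu>' (E i j) \<partial>count_space UNIV \<partial>count_space UNIV)"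
    by (rule nn_integral_count_space_nn_integral) auto
  also have "\<dots> = (\<Sum>j. \<Sum>i. emeasure \<nu>' (E' j i))"
    by (simp add: nn_integral_count_space_nat EE')
  also have "\<dots> = emeasure \<nu>P {x\<in>P \<inter> B. act (- g) x \<in> P}"
    unfolding emeasure_\<nu>P[OF sb(2)]
  proof (rule suminf_cong)
    fix j
    have "{z\<in>Z. act (l j) z \<in> piece j \<inter> {x\<in>P \<inter> B. act (- g) x \<in> P}} = (\<Union>i. E' j i)"
      unfolding E'_def using piece_UN by blast
    also have "emeasure \<nu>' \<dots> = (\<Sum>i. emeasure \<nu>' (E' j i))"
    proof (rule suminf_emeasure[symmetric])
      show "disjoint_family (E' j)" using piece_disjoint unfolding disjoint_family_on_def E'_def by blast
    qed (use Eb in blast)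
    finally show "(\<Sum>i. emeasure \<nu>' (E' j i)) = emeasure \<nu>' {z\<in>Z. act (l j) z \<in> piece j \<inter> {x\<in>P \<inter> B. act (- g) x \<in> P}}" by simp
  qed
  finally show "emeasure \<nu>P {x\<in>P. act g x \<in> P \<inter> B} = emeasure \<nu>P {x\<in>P \<inter> B. act (- g) x \<in> P}" .
qed

text \<open>Since \<open>P\<close> is separated, every orbit meets it at most once within a small set of times; so \<open>\<mu>\<close>
  being finite bounds the total mass.\<close>

lemma finite_\<nu>P: "finite_measure \<nu>P"
proof (rule finite_measureI)
  obtain W where W: "W \<in> sets borel" "0 < emeasure m W" "emeasure m W < \<infinity>"
    "\<And>a b. a \<in> W \<Longrightarrow> b \<in> W \<Longrightarrow> - a + b \<in> U"
    by (rule compact_pos[OF U(1,2)]) (rule that)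
  \<comment> \<open>With this shift, a visit to \<open>A n\<close> at time \<open>g\<close> with
    \<open>- g\<close> in \<open>S n\<close> is a visit to \<open>piece n\<close> at time
    \<open>h = l n + g\<close> with \<open>- h\<close> in \<open>W\<close>. So the visits for all
    \<open>n\<close> are compared in one small window.\<close>
  define S where "S n = (\<lambda>h. h + l n) ` W" for n
  define A where "A n = {z\<in>Z. act (l n) z \<in> piece n}" for n
  have Sb: "S n \<in> sets borel" "emeasure m (S n) = emeasure m W" for n
    unfolding S_def by (rule emeasure_right[OF W(1)])+
  have Ab: "A n \<in> sets borel" for n
  proof -
    have "A n = Z \<inter> act (l n) -` piece n" unfolding A_def by auto
    then show ?thesis using Z_borel translate_measurable[OF piece_borel[of n], of "l n"] by simp
  qed
  have AZ: "A n \<subseteq> Z" for n unfolding A_def by auto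
  have uniq: "h = h'" if "- h \<in> W" "act h x \<in> P" "- h' \<in> W" "act h' x \<in> P" for h h' x
  proof -
    have "act (h' - h) (act h x) \<in> P" using that(4) act_simps(2)[of "h' - h" h x] by simp
    then have "h' - h \<in> R" by (rule return_P[OF that(2)])
    moreover have "h' - h \<in> U" using W(4)[OF that(3,1)] by simp
    ultimately have "h' - h = 0" using U(3) by blast
    then show ?thesis by simp
  qed
  have bound: "(\<integral>\<^sup>+g. (\<Sum>n<N. indicator (S n) (- g) * indicator (A n) (act g x)) \<partial>count_space UNIV) \<le> (1::ennreal)" for N x
  proof -
    let ?F = "\<lambda>n h. indicator W (- h) * indicator (piece n) (act h x) :: ennreal"
    have le: "indicator (S n) (- g) * indicator (A n) (act g x) \<le> ?F n (l n + g)" for n g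
    proof -
      have "- g \<in> S n \<longleftrightarrow> - (l n + g) \<in> W"
        unfolding S_def right_translate_eq_vimage by (simp add: minus_add)
      then show ?thesis by (auto simp: A_def act_simps(2) indicator_def)
    qed
    have bij: "bij_betw (\<lambda>g. c + g) UNIV UNIV" for c :: 'g
      by (rule bij_betw_byWitness[of _ "\<lambda>g. - c + g"]) (auto simp: add.assoc[symmetric])
    have "(\<integral>\<^sup>+g. (\<Sum>n<N. indicator (S n) (- g) * indicator (A n) (act g x)) \<partial>count_space UNIV)
        = (\<Sum>n<N. \<integral>\<^sup>+g. indicator (S n) (- g) * indicator (A n) (act g x) \<partial>count_space UNIV)"
      by (rule nn_integral_sum) simp
    also have "\<dots> \<le> (\<Sum>n<N. \<integral>\<^sup>+g. ?F n (l n + g) \<partial>count_space UNIV)"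
      by (intro sum_mono nn_integral_mono le)
    also have "\<dots> = (\<Sum>n<N. \<integral>\<^sup>+h. ?F n h \<partial>count_space UNIV)"
      by (intro sum.cong refl nn_integral_bij_count_space[OF bij])
    also have "\<dots> = (\<integral>\<^sup>+h. (\<Sum>n<N. ?F n h) \<partial>count_space UNIV)"
      by (rule nn_integral_sum[symmetric]) simp
    \<comment> \<open>At each \<open>h\<close> at most one summand is nonzero, as the pieces are
      disjoint; \<open>uniq\<close> then allows at most one \<open>h\<close>.\<close>
    also have "\<dots> \<le> (\<integral>\<^sup>+h. indicator {h. - h \<in> W \<and> act h x \<in> P} h \<partial>count_space UNIV)"
    proof (rule nn_integral_mono)
      fix h
      show "(\<Sum>n<N. ?F n h) \<le> indicator {h. - h \<in> W \<and> act h x \<in> P} h"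
      proof (cases "- h \<in> W \<and> (\<exists>n. act h x \<in> piece n)")
        case True
        then obtain n where n: "act h x \<in> piece n" by blast
        then have hP: "act h x \<in> P" using piece_UN by blast
        have ne: "act h x \<notin> piece i" if "i \<noteq> n" for i
          using piece_disjoint n that unfolding disjoint_family_on_def by blast
        have "(\<Sum>n<N. ?F n h) \<le> (\<Sum>i<N. if i = n then 1 else 0)"
          by (rule sum_mono) (use ne in \<open>simp add: indicator_def\<close>)
        also have "\<dots> \<le> 1" by simp
        also have "1 = (indicator {h. - h \<in> W \<and> act h x \<in> P} h :: ennreal)"
          using True hP by simp
        finally show ?thesis .
      next
        case False
        then have "?F n h = 0" for n by (auto simp: indicator_def)
        then have "(\<Sum>n<N. ?F n h) = 0" by (intro sum.neutral) blast
        then show ?thesis by (simp only: zero_le)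
      qed
    qed
    also have "\<dots> = emeasure (count_space UNIV) {h. - h \<in> W \<and> act h x \<in> P}"
      by (rule nn_integral_indicator) simp
    also have "\<dots> \<le> 1"
    proof -
      define L where "L = {h. - h \<in> W \<and> act h x \<in> P}"
      have "L = {} \<or> (\<exists>h. L = {h})" using uniq unfolding L_def by blast
      then show ?thesis unfolding L_def[symmetric] by auto
    qed
    finally show ?thesis .
  qed
  have "emeasure m W * (\<Sum>n<N. emeasure \<nu>' (A n)) \<le> 1" for N
  proof -
    have "emeasure m W * (\<Sum>n<N. emeasure \<nu>' (A n)) = (\<Sum>n<N. emeasure m (S n) * emeasure \<nu>' (A n))"
      by (simp add: Sb sum_distrib_left)
    also have "\<dots> = (\<integral>\<^sup>+x. (\<integral>\<^sup>+g. (\<Sum>n<N. indicator (S n) (- g) * indicator (A n) (act g x)) \<partial>count_space UNIV) \<partial>\<mu>)"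
      by (rule transverse_sum[OF Sb(1) Ab AZ, symmetric])
    also have "\<dots> \<le> (\<integral>\<^sup>+x. 1 \<partial>\<mu>)" by (intro nn_integral_mono bound)
    also have "\<dots> = 1" using prob_space.emeasure_space_1[OF prob_\<mu>] by simp
    finally show ?thesis .
  qed
  then have "emeasure m W * (\<Sum>n. emeasure \<nu>' (A n)) \<le> 1"
    unfolding suminf_eq_SUP SUP_mult_left_ennreal by (intro SUP_least)
  then have "(\<Sum>n. emeasure \<nu>' (A n)) \<noteq> top"
  proof (rule contrapos_pn)
    assume "(\<Sum>n. emeasure \<nu>' (A n)) = top"
    moreover have "emeasure m W \<noteq> 0" using W(2) by simp
    ultimately show "\<not> emeasure m W * (\<Sum>n. emeasure \<nu>' (A n)) \<le> 1"
      by (simp add: ennreal_mult_top top_unique)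
  qed
  moreover have "space \<nu>P = UNIV" using sets_eq_imp_space_eq[OF sets_\<nu>P] by simp
  ultimately show "emeasure \<nu>P (space \<nu>P) \<noteq> \<infinity>"
    using emeasure_\<nu>P[of UNIV] by (simp add: A_def)
qed

end

subsection \<open>The diagonal action\<close>

definition diagonal_action :: "('g \<Rightarrow> 'x \<Rightarrow> 'x) \<Rightarrow> 'g \<Rightarrow> (nat \<Rightarrow> 'x) \<Rightarrow> nat \<Rightarrow> 'x" where
  "diagonal_action act g z = (\<lambda>i. act g (z i))"

text \<open>Repeating the first coordinate embeds \<open>X\<^sup>r\<close> equivariantly into the Polish type \<open>nat \<Rightarrow> X\<close>.\<close>

definition repeat_first :: "nat \<Rightarrow> (nat \<Rightarrow> 'x) \<Rightarrow> nat \<Rightarrow> 'x" where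
  "repeat_first r z = (\<lambda>i. if i \<in> {1..r} then z i else z 1)"

lemma diagonal_action_continuous:
  fixes act :: "'g::topological_group_add \<Rightarrow> 'x::topological_space \<Rightarrow> 'x"
  assumes "jointly_continuous_action act"
  shows "jointly_continuous_action (diagonal_action act)"
proof -
  note s = jointly_continuous_action_simps[OF assms]
  have "acts_on (diagonal_action act) UNIV"
    unfolding acts_on_def diagonal_action_def using s(1,2) by simp
  moreover have "continuous_on UNIV (\<lambda>x. act (fst x) (snd x (i::nat)))" for i
  proof -
    have "continuous_on UNIV (\<lambda>x :: 'g \<times> (nat \<Rightarrow> 'x). (\<lambda>(g, x). act g x) (fst x, snd x i))"
    proof (rule continuous_on_compose2[OF s(7)[of UNIV]])
      have "continuous_on UNIV (\<lambda>x :: 'g \<times> (nat \<Rightarrow> 'x). (\<lambda>z. z i) (snd x))"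
        by (rule continuous_on_compose2[OF continuous_on_product_coordinates continuous_on_snd[OF continuous_on_id]]) simp
      then show "continuous_on UNIV (\<lambda>x :: 'g \<times> (nat \<Rightarrow> 'x). (fst x, snd x i))"
        by (intro continuous_on_Pair continuous_on_fst continuous_on_id) simp
    qed simp
    then show ?thesis by simp
  qed
  then have "continuous_on UNIV (\<lambda>x. \<lambda>i::nat. act (fst x) (snd x i))"
    by (rule continuous_on_coordinatewise_then_product)
  then have "continuous_on UNIV (\<lambda>(g, z). diagonal_action act g z)"
    by (simp add: diagonal_action_def split_beta')
  ultimately show ?thesis unfolding jointly_continuous_action_def by blast
qed

lemma repeat_first_measurable:
  fixes N :: "'x::{second_countable_topology} measure"
  assumes "1 \<le> r" "(\<lambda>x. x) \<in> N \<rightarrow>\<^sub>M borel"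
  shows "repeat_first r \<in> (\<Pi>\<^sub>M i\<in>{1..r}. N) \<rightarrow>\<^sub>M borel"
proof -
  have c: "(\<lambda>z. z i) \<in> (\<Pi>\<^sub>M i\<in>{1..r}. N) \<rightarrow>\<^sub>M borel" if "i \<in> {1..r}" for i
    using measurable_compose[OF measurable_component_singleton[OF that] assms(2)] by simp
  have "(\<lambda>z. repeat_first r z i) \<in> (\<Pi>\<^sub>M i\<in>{1..r}. N) \<rightarrow>\<^sub>M borel" for i
    unfolding repeat_first_def using c[of i] c[of 1] assms(1) by (cases "i \<in> {1..r}") auto
  then show ?thesis by (rule measurable_coordinatewise_then_product)
qed

lemma all_repeat_first:
  assumes "1 \<le> r"
  shows "(\<forall>i. Q (repeat_first r z i)) \<longleftrightarrow> (\<forall>i\<in>{1..r}. Q (z i))"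
  using assms unfolding repeat_first_def by auto

lemma all_coordinates_borel:
  assumes "P \<in> sets (borel :: 'x::second_countable_topology measure)"
  shows "{z :: nat \<Rightarrow> 'x. \<forall>i. z i \<in> P} \<in> sets borel"
proof -
  have "(\<lambda>z::nat \<Rightarrow> 'x. z i) \<in> borel \<rightarrow>\<^sub>M borel" for i
    by (rule borel_measurable_continuous_onI) (rule continuous_on_product_coordinates)
  from measurable_sets[OF this assms] have "(\<lambda>z::nat \<Rightarrow> 'x. z i) -` P \<in> sets borel" for i by simp
  then have "(\<Inter>i. (\<lambda>z::nat \<Rightarrow> 'x. z i) -` P) \<in> sets borel" by (intro sets.countable_INT) auto
  moreover have "(\<Inter>i. (\<lambda>z::nat \<Rightarrow> 'x. z i) -` P) = {z. \<forall>i. z i \<in> P}" by auto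
  ultimately show ?thesis by simp
qed

lemma measure_eqI_PiM_rectangles:
  assumes I: "finite I" and s: "sets P = sets (PiM I M)" "sets Q = sets (PiM I M)"
    and fin: "finite_measure P"
    and eq: "\<And>A. (\<And>i. i \<in> I \<Longrightarrow> A i \<in> sets (M i)) \<Longrightarrow> emeasure P (Pi\<^sub>E I A) = emeasure Q (Pi\<^sub>E I A)"
  shows "P = Q"
proof (rule measure_eqI_PiM_finite[OF I s(1,2) eq, where A="\<lambda>_. \<Pi>\<^sub>E i\<in>I. space (M i)"])
  show "range (\<lambda>_::nat. \<Pi>\<^sub>E i\<in>I. space (M i)) \<subseteq> prod_algebra I M"
    using prod_algebraI_finite[OF I, of "\<lambda>i. space (M i)" M] by auto
  show "emeasure P (\<Pi>\<^sub>E i\<in>I. space (M i)) \<noteq> \<infinity>"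
    using finite_measure.emeasure_finite[OF fin] by simp
qed (simp_all add: space_PiM)

text \<open>On rectangles the claim factorises into the coordinates, where it is the assumption on
  \<open>\<rho>\<close>. Rectangles determine a finite measure, so an equality of measures on the
  product is proved first and then evaluated on the preimage of \<open>B\<close>.\<close>

lemma partially_invariant_product:
  fixes act :: "'g::topological_group_add \<Rightarrow> 'x::second_countable_topology \<Rightarrow> 'x"
  assumes act: "jointly_continuous_action act" and r: "1 \<le> r"
    and \<rho>: "finite_measure \<rho>" "sets \<rho> = sets borel" and P: "P \<in> sets borel"
    and pinv: "partially_invariant act P \<rho>"
  shows "partially_invariant (diagonal_action act) {z. \<forall>i. z i \<in> P} (distr (\<Pi>\<^sub>M i\<in>{1..r}. \<rho>) borel (repeat_first r))"
  unfolding partially_invariant_def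
proof (intro allI ballI)
  fix g :: 'g and B :: "(nat \<Rightarrow> 'x) set" assume B: "B \<in> sets borel"
  let ?I = "{1..r}" and ?M = "\<Pi>\<^sub>M i\<in>{1..r}. \<rho>" and ?PP = "{z :: nat \<Rightarrow> 'x. \<forall>i. z i \<in> P}" and ?e = "repeat_first r"
  interpret F: finite_measure \<rho> by fact
  interpret product_sigma_finite "\<lambda>_::nat. \<rho>" ..
  have sp: "space \<rho> = UNIV" using sets_eq_imp_space_eq[OF \<rho>(2)] by simp
  have am: "act h \<in> borel \<rightarrow>\<^sub>M borel" for h by (rule jointly_continuous_action_measurable[OF act])
  have am\<rho>: "act h \<in> \<rho> \<rightarrow>\<^sub>M \<rho>" for h using am[of h] by (simp add: \<rho> cong: measurable_cong_sets)
  have vim: "act h -` A \<in> sets borel" if "A \<in> sets borel" for h A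
    using measurable_sets[OF am that] by simp
  have idm: "(\<lambda>x. x) \<in> \<rho> \<rightarrow>\<^sub>M borel" by (rule measurable_ident_sets[OF \<rho>(2)])
  note em = repeat_first_measurable[OF r idm]
  define D where "D h = P \<inter> act h -` P" for h
  have Db: "D h \<in> sets \<rho>" for h unfolding D_def using P vim by (simp add: \<rho>)
  define T where "T z = (\<lambda>i\<in>?I. act g (z i))" for z :: "nat \<Rightarrow> 'x"
  have Tm: "T \<in> ?M \<rightarrow>\<^sub>M ?M"
    unfolding T_def
  proof (rule measurable_restrict)
    fix i assume "i \<in> ?I"
    from measurable_compose[OF measurable_component_singleton[OF this, of "\<lambda>_. \<rho>"] am\<rho>[of g]]
    show "(\<lambda>z. act g (z i)) \<in> ?M \<rightarrow>\<^sub>M \<rho>" by simp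
  qed
  have DM: "Pi\<^sub>E ?I (\<lambda>_. D h) \<in> sets ?M" for h by (intro sets_PiM_I_finite) (use Db in auto)
  have finM: "finite_measure ?M"
  proof (rule finite_measureI)
    have "emeasure ?M (Pi\<^sub>E ?I (\<lambda>_. space \<rho>)) = (\<Prod>i\<in>?I. emeasure \<rho> (space \<rho>))"
      by (rule emeasure_PiM) auto
    then show "emeasure ?M (space ?M) \<noteq> \<infinity>"
      by (simp add: space_PiM ennreal_prod_eq_top power_eq_top_ennreal)
  qed
  interpret FM: finite_measure ?M by (rule finM)
  let ?K = "density ?M (indicator (Pi\<^sub>E ?I (\<lambda>_. D g)))"
  have TK: "T \<in> ?K \<rightarrow>\<^sub>M ?M" using Tm by (simp cong: measurable_cong_sets)
  have finK: "finite_measure (distr ?K ?M T)"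
  proof (rule finite_measureI)
    have "emeasure (distr ?K ?M T) (space ?M) = emeasure ?K (T -` space ?M \<inter> space ?K)"
      by (rule emeasure_distr[OF TK]) simp
    also have "\<dots> = emeasure ?M (Pi\<^sub>E ?I (\<lambda>_. D g) \<inter> (T -` space ?M \<inter> space ?M))"
      using emeasure_restricted[OF DM[of g] measurable_sets[OF Tm sets.top]] by simp
    finally show "emeasure (distr ?K ?M T) (space (distr ?K ?M T)) \<noteq> \<infinity>"
      using FM.emeasure_finite by simp
  qed
  have eq: "distr ?K ?M T = density ?M (indicator (Pi\<^sub>E ?I (\<lambda>_. D (- g))))"
  proof (rule measure_eqI_PiM_rectangles[OF _ _ _ finK])
    fix A :: "nat \<Rightarrow> 'x set" assume A: "\<And>i. i \<in> ?I \<Longrightarrow> A i \<in> sets \<rho>"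
    have AM: "Pi\<^sub>E ?I A \<in> sets ?M" by (intro sets_PiM_I_finite) (use A in auto)
    have "emeasure (distr ?K ?M T) (Pi\<^sub>E ?I A) = emeasure ?K (T -` Pi\<^sub>E ?I A \<inter> space ?K)"
      by (rule emeasure_distr[OF TK AM])
    also have "\<dots> = emeasure ?M (Pi\<^sub>E ?I (\<lambda>_. D g) \<inter> (T -` Pi\<^sub>E ?I A \<inter> space ?M))"
      using emeasure_restricted[OF DM[of g] measurable_sets[OF Tm AM]] by simp
    also have "Pi\<^sub>E ?I (\<lambda>_. D g) \<inter> (T -` Pi\<^sub>E ?I A \<inter> space ?M) = (\<Pi>\<^sub>E i\<in>?I. {x\<in>P. act g x \<in> P \<inter> A i})"
      by (auto simp: T_def D_def space_PiM sp PiE_iff)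
    also have "emeasure ?M \<dots> = (\<Prod>i\<in>?I. emeasure \<rho> {x\<in>P. act g x \<in> P \<inter> A i})"
    proof (rule emeasure_PiM)
      fix i assume "i \<in> ?I"
      then have "P \<inter> act g -` (P \<inter> A i) \<in> sets borel" using vim[of "P \<inter> A i" g] P A[of i] by (simp add: \<rho>)
      moreover have "{x\<in>P. act g x \<in> P \<inter> A i} = P \<inter> act g -` (P \<inter> A i)" by auto
      ultimately show "{x\<in>P. act g x \<in> P \<inter> A i} \<in> sets \<rho>" by (simp add: \<rho>)
    qed simp
    also have "\<dots> = (\<Prod>i\<in>?I. emeasure \<rho> {x\<in>P \<inter> A i. act (- g) x \<in> P})"
      by (intro prod.cong refl) (use pinv A in \<open>simp add: partially_invariant_def \<rho>\<close>)
    also have "\<dots> = emeasure ?M (\<Pi>\<^sub>E i\<in>?I. {x\<in>P \<inter> A i. act (- g) x \<in> P})"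
    proof (rule emeasure_PiM[symmetric])
      fix i assume "i \<in> ?I"
      then have "D (- g) \<inter> A i \<in> sets \<rho>" using Db A by blast
      moreover have "{x\<in>P \<inter> A i. act (- g) x \<in> P} = D (- g) \<inter> A i" unfolding D_def by auto
      ultimately show "{x\<in>P \<inter> A i. act (- g) x \<in> P} \<in> sets \<rho>" by simp
    qed simp
    also have "(\<Pi>\<^sub>E i\<in>?I. {x\<in>P \<inter> A i. act (- g) x \<in> P}) = Pi\<^sub>E ?I (\<lambda>_. D (- g)) \<inter> Pi\<^sub>E ?I A"
      unfolding PiE_Int by (rule PiE_cong) (auto simp: D_def)
    also have "emeasure ?M \<dots> = emeasure (density ?M (indicator (Pi\<^sub>E ?I (\<lambda>_. D (- g))))) (Pi\<^sub>E ?I A)"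
      by (rule emeasure_restricted[OF DM AM, symmetric])
    finally show "emeasure (distr ?K ?M T) (Pi\<^sub>E ?I A) = emeasure (density ?M (indicator (Pi\<^sub>E ?I (\<lambda>_. D (- g))))) (Pi\<^sub>E ?I A)" .
  qed simp_all
  have eB: "?e -` B \<inter> space ?M \<in> sets ?M" by (rule measurable_sets[OF em B])
  have PPb: "?PP \<in> sets borel" by (rule all_coordinates_borel[OF P])
  have dm: "diagonal_action act h -` A \<in> sets borel" if "A \<in> sets borel" for h A
    using measurable_sets[OF jointly_continuous_action_measurable[OF diagonal_action_continuous[OF act]] that] by simp
  have s1: "{z\<in>?PP. diagonal_action act g z \<in> ?PP \<inter> B} \<in> sets borel"
  proof -
    have "?PP \<inter> diagonal_action act g -` (?PP \<inter> B) \<in> sets borel" using PPb dm B by blast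
    then show ?thesis by (simp add: Int_def)
  qed
  have s2: "{z\<in>?PP \<inter> B. diagonal_action act (- g) z \<in> ?PP} \<in> sets borel"
  proof -
    have "?PP \<inter> B \<inter> diagonal_action act (- g) -` ?PP \<in> sets borel" using PPb dm B by blast
    then show ?thesis by (simp add: Int_def)
  qed
  have eT: "diagonal_action act g (?e z) = ?e (T z)" for z
    using r by (auto simp: diagonal_action_def repeat_first_def T_def)
  have mem: "?e z \<in> ?PP \<longleftrightarrow> (\<forall>i\<in>?I. z i \<in> P)" for z using all_repeat_first[OF r, of "\<lambda>x. x \<in> P" z] by simp
  have memg: "diagonal_action act h (?e z) \<in> ?PP \<longleftrightarrow> (\<forall>i\<in>?I. act h (z i) \<in> P)" for z h
    using all_repeat_first[OF r, of "\<lambda>x. act h x \<in> P" z] by (simp add: diagonal_action_def)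
  have "emeasure (distr ?M borel ?e) {z\<in>?PP. diagonal_action act g z \<in> ?PP \<inter> B}
      = emeasure ?M (?e -` {z\<in>?PP. diagonal_action act g z \<in> ?PP \<inter> B} \<inter> space ?M)"
    by (rule emeasure_distr[OF em s1])
  also have "?e -` {z\<in>?PP. diagonal_action act g z \<in> ?PP \<inter> B} \<inter> space ?M = Pi\<^sub>E ?I (\<lambda>_. D g) \<inter> (T -` (?e -` B \<inter> space ?M) \<inter> space ?M)"
  proof (intro set_eqI)
    fix z
    have "z \<in> ?e -` {z\<in>?PP. diagonal_action act g z \<in> ?PP \<inter> B} \<inter> space ?M \<longleftrightarrow>
        z \<in> space ?M \<and> ?e z \<in> ?PP \<and> diagonal_action act g (?e z) \<in> ?PP \<and> diagonal_action act g (?e z) \<in> B"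
      by (simp only: vimage_eq Int_iff mem_Collect_eq conj_ac)
    also have "\<dots> \<longleftrightarrow> z \<in> space ?M \<and> (\<forall>i\<in>?I. z i \<in> D g) \<and> ?e (T z) \<in> B"
      unfolding mem memg D_def unfolding eT by (simp only: vimage_eq Int_iff ball_conj_distrib conj_ac)
    also have "\<dots> \<longleftrightarrow> z \<in> Pi\<^sub>E ?I (\<lambda>_. D g) \<inter> (T -` (?e -` B \<inter> space ?M) \<inter> space ?M)"
      using measurable_space[OF Tm, of z] by (auto simp: space_PiM sp PiE_iff)
    finally show "z \<in> ?e -` {z\<in>?PP. diagonal_action act g z \<in> ?PP \<inter> B} \<inter> space ?M \<longleftrightarrow>
        z \<in> Pi\<^sub>E ?I (\<lambda>_. D g) \<inter> (T -` (?e -` B \<inter> space ?M) \<inter> space ?M)" .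
  qed
  also have "emeasure ?M \<dots> = emeasure ?K (T -` (?e -` B \<inter> space ?M) \<inter> space ?K)"
    using emeasure_restricted[OF DM[of g] measurable_sets[OF Tm eB]] by simp
  also have "\<dots> = emeasure (distr ?K ?M T) (?e -` B \<inter> space ?M)"
    by (rule emeasure_distr[OF TK eB, symmetric])
  also have "\<dots> = emeasure ?M (Pi\<^sub>E ?I (\<lambda>_. D (- g)) \<inter> (?e -` B \<inter> space ?M))"
    unfolding eq by (rule emeasure_restricted[OF DM eB])
  also have "Pi\<^sub>E ?I (\<lambda>_. D (- g)) \<inter> (?e -` B \<inter> space ?M) = ?e -` {z\<in>?PP \<inter> B. diagonal_action act (- g) z \<in> ?PP} \<inter> space ?M"
  proof (intro set_eqI)
    fix z
    have "z \<in> ?e -` {z\<in>?PP \<inter> B. diagonal_action act (- g) z \<in> ?PP} \<inter> space ?M \<longleftrightarrow>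
        z \<in> space ?M \<and> ?e z \<in> ?PP \<and> ?e z \<in> B \<and> diagonal_action act (- g) (?e z) \<in> ?PP"
      by (simp only: vimage_eq Int_iff mem_Collect_eq conj_ac)
    also have "\<dots> \<longleftrightarrow> z \<in> space ?M \<and> (\<forall>i\<in>?I. z i \<in> D (- g)) \<and> ?e z \<in> B"
      unfolding mem memg D_def by (simp only: vimage_eq Int_iff ball_conj_distrib conj_ac)
    also have "\<dots> \<longleftrightarrow> z \<in> Pi\<^sub>E ?I (\<lambda>_. D (- g)) \<inter> (?e -` B \<inter> space ?M)"
      by (auto simp: space_PiM sp PiE_iff)
    finally show "z \<in> Pi\<^sub>E ?I (\<lambda>_. D (- g)) \<inter> (?e -` B \<inter> space ?M) \<longleftrightarrow>
        z \<in> ?e -` {z\<in>?PP \<inter> B. diagonal_action act (- g) z \<in> ?PP} \<inter> space ?M" by (rule sym)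
  qed
  also have "emeasure ?M \<dots> = emeasure (distr ?M borel ?e) {z\<in>?PP \<inter> B. diagonal_action act (- g) z \<in> ?PP}"
    by (rule emeasure_distr[OF em s2, symmetric])
  finally show "emeasure (distr ?M borel ?e) {z\<in>?PP. diagonal_action act g z \<in> ?PP \<inter> B}
      = emeasure (distr ?M borel ?e) {z\<in>?PP \<inter> B. diagonal_action act (- g) z \<in> ?PP}" .
qed

text \<open>The factors \<open>\<nu>\<close> live on the space \<open>Z\<close>, the factors
  \<open>\<rho>\<close> on the whole type. Moved to the sigma-algebra of the second product, the
  first one becomes its restriction to \<open>Z^r\<close>. The inequality serves to transfer null
  sets.\<close>

lemma emeasure_product_le:
  fixes \<nu> \<rho> :: "'x::second_countable_topology measure"
  assumes r: "1 \<le> r" and \<rho>: "finite_measure \<rho>" "sets \<rho> = sets borel"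
    and \<nu>: "finite_measure \<nu>" "(\<lambda>x. x) \<in> \<nu> \<rightarrow>\<^sub>M borel" "space \<nu> = Z" and Z: "Z \<in> sets borel"
    and eq: "\<And>A. A \<in> sets borel \<Longrightarrow> A \<subseteq> Z \<Longrightarrow> emeasure \<nu> A = emeasure \<rho> A" and \<nu>s: "\<And>A. A \<in> sets borel \<Longrightarrow> A \<inter> Z \<in> sets \<nu>"
    and C: "C \<in> sets borel"
  shows "emeasure (distr (\<Pi>\<^sub>M i\<in>{1..r}. \<nu>) borel (repeat_first r)) C \<le> emeasure (distr (\<Pi>\<^sub>M i\<in>{1..r}. \<rho>) borel (repeat_first r)) C"
proof -
  let ?I = "{1..r}" and ?M = "\<Pi>\<^sub>M i\<in>{1..r}. \<rho>" and ?N = "\<Pi>\<^sub>M i\<in>{1..r}. \<nu>" and ?e = "repeat_first r"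
  interpret F: finite_measure \<rho> by fact
  interpret R: product_sigma_finite "\<lambda>_::nat. \<rho>" ..
  interpret F': finite_measure \<nu> by fact
  interpret R': product_sigma_finite "\<lambda>_::nat. \<nu>" ..
  have sp: "space \<rho> = UNIV" using sets_eq_imp_space_eq[OF \<rho>(2)] by simp
  have idm: "(\<lambda>x. x) \<in> \<rho> \<rightarrow>\<^sub>M borel" by (rule measurable_ident_sets[OF \<rho>(2)])
  note e\<rho> = repeat_first_measurable[OF r idm] and e\<nu> = repeat_first_measurable[OF r \<nu>(2)]
  have \<nu>\<rho>: "(\<lambda>x. x) \<in> \<nu> \<rightarrow>\<^sub>M \<rho>" using \<nu>(2) by (simp add: \<rho> cong: measurable_cong_sets)
  have NM: "(\<lambda>z. z) \<in> ?N \<rightarrow>\<^sub>M ?M"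
  proof (rule measurable_PiM_single')
    show "(\<lambda>z. z i) \<in> ?N \<rightarrow>\<^sub>M \<rho>" if "i \<in> ?I" for i
      using measurable_compose[OF measurable_component_singleton[OF that] \<nu>\<rho>] by simp
    show "(\<lambda>z. z) \<in> space ?N \<rightarrow> (\<Pi>\<^sub>E i\<in>?I. space \<rho>)" by (auto simp: space_PiM sp PiE_iff)
  qed
  have finN: "finite_measure (distr ?N ?M (\<lambda>z. z))"
  proof (rule finite_measure.finite_measure_distr[OF finite_measureI NM])
    have "emeasure ?N (Pi\<^sub>E ?I (\<lambda>_. space \<nu>)) = (\<Prod>i\<in>?I. emeasure \<nu> (space \<nu>))"
      by (rule R'.emeasure_PiM) auto
    then show "emeasure ?N (space ?N) \<noteq> \<infinity>"
      by (simp add: space_PiM ennreal_prod_eq_top power_eq_top_ennreal)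
  qed
  have ZM: "Pi\<^sub>E ?I (\<lambda>_. Z) \<in> sets ?M" by (intro sets_PiM_I_finite) (use Z in \<open>auto simp: \<rho>\<close>)
  have eqM: "distr ?N ?M (\<lambda>z. z) = density ?M (indicator (Pi\<^sub>E ?I (\<lambda>_. Z)))"
  proof (rule measure_eqI_PiM_rectangles[OF _ _ _ finN])
    fix A :: "nat \<Rightarrow> 'x set" assume A: "\<And>i. i \<in> ?I \<Longrightarrow> A i \<in> sets \<rho>"
    have AM: "Pi\<^sub>E ?I A \<in> sets ?M" by (intro sets_PiM_I_finite) (use A in auto)
    have Z\<rho>: "Z \<inter> A i \<in> sets \<rho>" if "i \<in> ?I" for i using A[OF that] Z by (simp add: \<rho>)
    have "emeasure (distr ?N ?M (\<lambda>z. z)) (Pi\<^sub>E ?I A) = emeasure ?N ((\<lambda>z. z) -` Pi\<^sub>E ?I A \<inter> space ?N)"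
      by (rule emeasure_distr[OF NM AM])
    also have "(\<lambda>z. z) -` Pi\<^sub>E ?I A \<inter> space ?N = (\<Pi>\<^sub>E i\<in>?I. Z \<inter> A i)"
      by (auto simp: space_PiM \<nu>(3) PiE_iff)
    also have "emeasure ?N \<dots> = (\<Prod>i\<in>?I. emeasure \<nu> (Z \<inter> A i))"
    proof (rule R'.emeasure_PiM)
      fix i assume "i \<in> ?I"
      then have "A i \<inter> Z \<in> sets \<nu>" using \<nu>s A by (simp add: \<rho>)
      then show "Z \<inter> A i \<in> sets \<nu>" by (simp add: Int_commute)
    qed simp
    also have "\<dots> = (\<Prod>i\<in>?I. emeasure \<rho> (Z \<inter> A i))"
      by (intro prod.cong refl eq) (use Z\<rho> in \<open>auto simp: \<rho>\<close>)
    also have "\<dots> = emeasure ?M (\<Pi>\<^sub>E i\<in>?I. Z \<inter> A i)"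
      by (rule R.emeasure_PiM[symmetric]) (use Z\<rho> in auto)
    also have "(\<Pi>\<^sub>E i\<in>?I. Z \<inter> A i) = Pi\<^sub>E ?I (\<lambda>_. Z) \<inter> Pi\<^sub>E ?I A" unfolding PiE_Int ..
    also have "emeasure ?M \<dots> = emeasure (density ?M (indicator (Pi\<^sub>E ?I (\<lambda>_. Z)))) (Pi\<^sub>E ?I A)"
      by (rule emeasure_restricted[OF ZM AM, symmetric])
    finally show "emeasure (distr ?N ?M (\<lambda>z. z)) (Pi\<^sub>E ?I A) = emeasure (density ?M (indicator (Pi\<^sub>E ?I (\<lambda>_. Z)))) (Pi\<^sub>E ?I A)" .
  qed simp_all
  have eC: "?e -` C \<inter> space ?M \<in> sets ?M" by (rule measurable_sets[OF e\<rho> C])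
  have "emeasure (distr ?N borel ?e) C = emeasure ?N (?e -` C \<inter> space ?N)"
    by (rule emeasure_distr[OF e\<nu> C])
  also have "?e -` C \<inter> space ?N = (\<lambda>z. z) -` (?e -` C \<inter> space ?M) \<inter> space ?N"
    by (auto simp: space_PiM sp PiE_iff)
  also have "emeasure ?N \<dots> = emeasure (distr ?N ?M (\<lambda>z. z)) (?e -` C \<inter> space ?M)"
    by (rule emeasure_distr[OF NM eC, symmetric])
  also have "\<dots> = emeasure ?M (Pi\<^sub>E ?I (\<lambda>_. Z) \<inter> (?e -` C \<inter> space ?M))"
    unfolding eqM by (rule emeasure_restricted[OF ZM eC])
  also have "\<dots> \<le> emeasure ?M (?e -` C \<inter> space ?M)"
    by (rule emeasure_mono[OF _ eC]) auto
  also have "\<dots> = emeasure (distr ?M borel ?e) C"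
    by (rule emeasure_distr[OF e\<rho> C, symmetric])
  finally show ?thesis .
qed

subsection \<open>Lower densities\<close>

lemma lower_density_mono:
  assumes "A \<subseteq> B"
  shows "lower_density m G A \<le> lower_density m G B"
  unfolding lower_density_def
  by (intro Liminf_mono always_eventually allI divide_right_mono_ennreal emeasure_mono) (use assms in auto)

text \<open>In the application \<open>k\<close> is the number of visits to \<open>C\<close> in
  \<open>G (t + \<delta>)\<close>, possibly infinite; \<open>a\<close> is the Haar measure of the
  visits to \<open>WC\<close> in \<open>G t\<close>, and \<open>w\<close> that of \<open>W\<close>;
  \<open>M1\<close> and \<open>M2\<close> are those of \<open>G t\<close> and
  \<open>G (t + \<delta>)\<close>; \<open>l\<close> is the limit of the averages and
  \<open>e\<close> bounds the growth.\<close>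

lemma density_ratio_bound:
  fixes k :: ennreal
  assumes a: "ennreal a \<le> k * ennreal w" and pos: "0 < M1" "0 < M2" "0 < w" "0 < l" "0 < e" "0 \<le> a"
    and l: "l / 2 < a / M1" and M: "M2 / M1 < e"
  shows "ennreal (l / (2 * w * e)) \<le> k / ennreal M2"
proof (cases k)
  case (real c)
  have "a \<le> c * w"
    using a pos real by (simp add: ennreal_mult[symmetric] ennreal_le_iff)
  have "l / 2 * M1 < a" using l pos by (simp add: field_simps)
  have "M2 < e * M1" using M pos by (simp add: field_simps)
  have "l * M2 \<le> l * (e * M1)" using \<open>M2 < e * M1\<close> pos by (intro mult_left_mono) auto
  also have "\<dots> = (l / 2 * M1) * (2 * e)" by simp
  also have "\<dots> \<le> (c * w) * (2 * e)" using \<open>l / 2 * M1 < a\<close> \<open>a \<le> c * w\<close> pos by (intro mult_right_mono) auto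
  finally have "l / (2 * w * e) \<le> c / M2" using pos by (simp add: field_simps)
  then show ?thesis using pos real by (simp add: divide_ennreal ennreal_leI)
next
  case top
  then show ?thesis by (simp add: ennreal_top_divide)
qed

context unimodular_haar
begin

lemma emeasure_le_card_translates:
  assumes W: "W \<in> sets borel" "0 < emeasure m W" and S: "S \<subseteq> (\<Union>h\<in>A. (\<lambda>w. w + h) ` W)"
  shows "emeasure m S \<le> emeasure (count_space UNIV) A * emeasure m W"
proof (cases "finite A")
  case True
  have "emeasure m S \<le> emeasure m (\<Union>h\<in>A. (\<lambda>w. w + h) ` W)"
    by (rule emeasure_mono[OF S]) (use True emeasure_right(2)[OF W(1)] in \<open>auto simp: sets_m\<close>)
  also have "\<dots> \<le> (\<Sum>h\<in>A. emeasure m ((\<lambda>w. w + h) ` W))"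
    by (rule emeasure_subadditive_finite[OF True]) (use emeasure_right(2)[OF W(1)] in \<open>auto simp: sets_m\<close>)
  also have "\<dots> = emeasure (count_space UNIV) A * emeasure m W"
    using True by (simp add: emeasure_right(1)[OF W(1)])
  finally show ?thesis .
next
  case False
  then show ?thesis using W(2) by (simp add: ennreal_top_mult)
qed

lemma lower_density_pos_if_average_pos:
  fixes act :: "'g \<Rightarrow> 'y::polish_space \<Rightarrow> 'y"
  assumes act: "jointly_continuous_action act"
    and G: "\<And>t. 0 < t \<Longrightarrow> G t \<in> sets borel \<and> compact (closure (G t)) \<and> 0 < emeasure m (G t)"
    and t0: "0 < t0" "0 < \<delta>" "0 < \<epsilon>"
    and outer: "\<And>t. t0 < t \<Longrightarrow> outer_set V (G t) \<subseteq> G (t + \<delta>)"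
    and growth: "Limsup at_top (\<lambda>t. ereal (measure m (G (t + \<delta>)) / measure m (G t))) \<le> ereal (1 + \<epsilon>)"
    and W: "compact W" "W \<subseteq> V" "0 < emeasure m W" and C: "compact C"
    and lim: "(average m G act (indicator ((\<lambda>(g, q). act g q) ` (W \<times> C))) z \<longlongrightarrow> l) at_top" "0 < l"
  shows "0 < lower_density m G {g. act g z \<in> C}"
proof -
  let ?S = "(\<lambda>(g, q). act g q) ` (W \<times> C)" and ?A = "{g. act g z \<in> C}"
  have Wb: "W \<in> sets borel" by (rule compact_borel[OF W(1)])
  have Gt: "G t \<in> sets borel" "0 < emeasure m (G t)" "emeasure m (G t) < \<infinity>" if "0 < t" for t
  proof -
    have cl: "compact (closure (G t))" using G[OF that] by blast
    have "emeasure m (G t) \<le> emeasure m (closure (G t))"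
      by (rule emeasure_mono[OF closure_subset]) (use compact_borel[OF cl] in \<open>simp add: sets_m\<close>)
    then show "emeasure m (G t) < \<infinity>" using m_compact[OF cl] by (rule le_less_trans)
  qed (use G[OF that] in auto)
  have meas: "emeasure m A = ennreal (measure m A)" if "emeasure m A < \<infinity>" for A
    using that by (intro emeasure_eq_ennreal_measure) (simp add: less_top)
  have Gpos: "0 < measure m (G t)" if "0 < t" for t
    using Gt(2)[OF that] meas[OF Gt(3)[OF that]] by simp
  have Wpos: "0 < measure m W" using W(3) meas[OF m_compact[OF W(1)]] by simp
  have "compact ?S"
    by (intro compact_continuous_image compact_Times W(1) C jointly_continuous_action_simps(7)[OF act])
  then have Sb: "?S \<in> sets borel" by (intro borel_closed compact_imp_closed)
  have "(\<lambda>g. act g z) \<in> borel \<rightarrow>\<^sub>M borel"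
    by (intro borel_measurable_continuous_onI jointly_continuous_action_simps(6)[OF act])
  from measurable_sets[OF this Sb] have vS: "(\<lambda>g. act g z) -` ?S \<in> sets borel" by simp
  define H where "H t = G t \<inter> (\<lambda>g. act g z) -` ?S" for t
  have Hfin: "emeasure m (H t) < \<infinity>" if "0 < t" for t
  proof -
    have "emeasure m (H t) \<le> emeasure m (G t)"
      by (rule emeasure_mono) (use Gt(1)[OF that] in \<open>auto simp: H_def sets_m\<close>)
    then show ?thesis using Gt(3)[OF that] by (rule le_less_trans)
  qed
  have avg: "average m G act (indicator ?S) z t = measure m (H t) / measure m (G t)" if "0 < t" for t
  proof -
    have "(LINT g:G t|m. indicator ?S (act g z)) = (\<integral>g. indicator (H t) g \<partial>m)"
      unfolding set_lebesgue_integral_def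
      by (rule Bochner_Integration.integral_cong) (auto simp: H_def indicator_def)
    also have "\<dots> = measure m (H t)" using Bochner_Integration.integral_indicator[of m "H t"] by (simp add: space_m)
    finally show ?thesis by (simp add: average_def)
  qed
  \<comment> \<open>If \<open>act g z = act w c\<close>, then \<open>- w + g\<close> is a visit to
    \<open>C\<close>, and it lies in the outer set of \<open>G t\<close> because \<open>w\<close> is
    in \<open>V\<close>.\<close>
  have count: "emeasure m (H t) \<le> emeasure (count_space UNIV) (?A \<inter> G (t + \<delta>)) * emeasure m W" if "t0 < t" for t
  proof (rule emeasure_le_card_translates[OF Wb W(3)])
    show "H t \<subseteq> (\<Union>h\<in>?A \<inter> G (t + \<delta>). (\<lambda>w. w + h) ` W)"
    proof
      fix g assume "g \<in> H t"
      then obtain w c where g: "g \<in> G t" "w \<in> W" "c \<in> C" "act g z = act w c" unfolding H_def by auto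
      have "act (- w + g) z = c"
        unfolding jointly_continuous_action_simps(2)[OF act] g(4) by (rule jointly_continuous_action_simps(3)[OF act])
      then have "- w + g \<in> ?A" using g(3) by simp
      moreover have "- w + g \<in> outer_set V (G t)"
        unfolding outer_set_def elt_set_plus_def using g(1,2) W(2) by blast
      then have "- w + g \<in> G (t + \<delta>)" using outer[OF that] by blast
      moreover have "g = w + (- w + g)" by (simp add: add.assoc[symmetric])
      ultimately show "g \<in> (\<Union>h\<in>?A \<inter> G (t + \<delta>). (\<lambda>w. w + h) ` W)" using g(2) by blast
    qed
  qed
  \<comment> \<open>A bound strictly above \<open>1 + \<epsilon>\<close>, so that the estimate of
    the upper limit becomes an inequality for all large \<open>t\<close>.\<close>
  have "eventually (\<lambda>t. ereal (measure m (G (t + \<delta>)) / measure m (G t)) < ereal (2 + \<epsilon>)) at_top"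
  proof (rule Limsup_lessD)
    show "Limsup at_top (\<lambda>t. ereal (measure m (G (t + \<delta>)) / measure m (G t))) < ereal (2 + \<epsilon>)"
      by (rule le_less_trans[OF growth]) simp
  qed
  moreover have "eventually (\<lambda>t. l / 2 < average m G act (indicator ?S) z t) at_top"
    using order_tendstoD(1)[OF lim(1), of "l / 2"] lim(2) by simp
  moreover have "eventually (\<lambda>t. t0 < t) at_top" by (rule eventually_gt_at_top)
  ultimately have "eventually (\<lambda>t. ennreal (l / (2 * measure m W * (2 + \<epsilon>))) \<le>
      emeasure (count_space UNIV) (?A \<inter> G (t + \<delta>)) / emeasure m (G (t + \<delta>))) at_top"
  proof eventually_elim
    case (elim t)
    have t: "0 < t" "0 < t + \<delta>" using elim(3) t0 by auto
    have "ennreal (l / (2 * measure m W * (2 + \<epsilon>))) \<le>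
        emeasure (count_space UNIV) (?A \<inter> G (t + \<delta>)) / ennreal (measure m (G (t + \<delta>)))"
    proof (rule density_ratio_bound)
      show "ennreal (measure m (H t)) \<le> emeasure (count_space UNIV) (?A \<inter> G (t + \<delta>)) * ennreal (measure m W)"
        using count[OF elim(3)] meas[OF Hfin[OF t(1)]] meas[OF m_compact[OF W(1)]] by simp
      show "l / 2 < measure m (H t) / measure m (G t)" using elim(2) avg[OF t(1)] by simp
      show "measure m (G (t + \<delta>)) / measure m (G t) < 2 + \<epsilon>" using elim(1) by simp
    qed (use Gpos[OF t(1)] Gpos[OF t(2)] Wpos lim(2) t0 in auto)
    then show ?case using meas[OF Gt(3)[OF t(2)]] by simp
  qed
  then obtain s where s: "\<And>t. s \<le> t \<Longrightarrow> ennreal (l / (2 * measure m W * (2 + \<epsilon>))) \<le>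
      emeasure (count_space UNIV) (?A \<inter> G (t + \<delta>)) / emeasure m (G (t + \<delta>))"
    unfolding eventually_at_top_linorder by blast
  \<comment> \<open>The previous bound concerns \<open>G (t + \<delta>)\<close>; as \<open>t\<close>
    is a real parameter, substituting \<open>t - \<delta>\<close> gives it for every large
    index.\<close>
  have "eventually (\<lambda>t. ennreal (l / (2 * measure m W * (2 + \<epsilon>))) \<le>
      emeasure (count_space UNIV) (?A \<inter> G t) / emeasure m (G t)) at_top"
    unfolding eventually_at_top_linorder
  proof (intro exI[of _ "s + \<delta>"] allI impI)
    fix t assume "s + \<delta> \<le> t"
    then show "ennreal (l / (2 * measure m W * (2 + \<epsilon>))) \<le> emeasure (count_space UNIV) (?A \<inter> G t) / emeasure m (G t)"
      using s[of "t - \<delta>"] by simp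
  qed
  then have "ennreal (l / (2 * measure m W * (2 + \<epsilon>))) \<le> lower_density m G ?A"
    unfolding lower_density_def by (rule Liminf_bounded)
  moreover have "0 < ennreal (l / (2 * measure m W * (2 + \<epsilon>)))" using lim(2) Wpos t0 by simp
  ultimately show ?thesis by (rule less_le_trans[rotated])
qed

end

text \<open>The exceptional set consists of the points of \<open>C0\<close> at which the averages of
  \<open>S0\<close> fail to have a positive limit. That it is null is shown through ergodic
  measures, since convergence almost everywhere for \<open>\<eta>\<close> says nothing about the
  value of the limit.\<close>

lemma (in suspension) lower_density_pos:
  assumes \<sigma>: "\<And>n::nat. compact (C n)" "Q = (\<Union>n. C n)"
    and U: "open U" "0 \<in> U" "R \<inter> U \<subseteq> {0}"
    and K: "compact K" "\<And>g q. q \<in> Q \<Longrightarrow> \<exists>k\<in>K. \<exists>q'\<in>Q. act g q = act k q'"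
    and conv: "convenient_sequence m G" and C0: "compact C0" "C0 \<subseteq> Q"
  obtains N where "N \<in> sets borel" "emeasure \<rho> N = 0" "\<And>y. y \<in> C0 - N \<Longrightarrow> 0 < lower_density m G {g. act g y \<in> C0}"
proof -
  have G: "\<And>t. 0 < t \<Longrightarrow> G t \<in> sets borel \<and> compact (closure (G t)) \<and> 0 < emeasure m (G t)"
    and reg: "regular_family m G" and erg: "pointwise_ergodic_family m G"
    using conv unfolding convenient_sequence_def by auto
  obtain V :: "nat \<Rightarrow> 'g set" and \<delta> \<epsilon> t0 :: "nat \<Rightarrow> real"
    where V: "\<forall>n. open (V n) \<and> 0 \<in> V n" and pos: "\<forall>n. 0 < \<delta> n \<and> 0 < \<epsilon> n \<and> 0 < t0 n"
    and outer: "\<forall>n. \<forall>t > t0 n. G (t - \<delta> n) \<subseteq> inner_set (V n) (G t) \<and>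
             inner_set (V n) (G t) \<subseteq> outer_set (V n) (G t) \<and> outer_set (V n) (G t) \<subseteq> G (t + \<delta> n)"
    and growth: "\<forall>n. ereal (1 - \<epsilon> n) \<le> Liminf at_top (\<lambda>t. ereal (measure m (G (t - \<delta> n)) / measure m (G t))) \<and>
             Limsup at_top (\<lambda>t. ereal (measure m (G (t + \<delta> n)) / measure m (G t))) \<le> ereal (1 + \<epsilon> n)"
    using reg unfolding regular_family_def by (elim exE conjE)
  \<comment> \<open>Inside \<open>U\<close>, so that small windows see each orbit in
    \<open>Q\<close> at most once; inside \<open>V 0\<close>, so that translates by \<open>W\<close>
    stay within the next set of the family.\<close>
  have UV: "open (U \<inter> V 0)" "0 \<in> U \<inter> V 0" using U V by auto
  obtain W V' where W: "compact W" "open V'" "(0::'g) \<in> V'" "V' \<subseteq> W" "W \<subseteq> U \<inter> V 0"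
    "\<And>a b. a \<in> W \<Longrightarrow> b \<in> W \<Longrightarrow> - a + b \<in> U \<inter> V 0"
    by (rule small_compact_neighbourhood[OF UV]) (rule that)
  have Wb: "W \<in> sets borel" by (rule compact_borel[OF W(1)])
  have Wpos: "0 < emeasure m W"
    using emeasure_open_pos[OF W(2,3)] emeasure_mono[OF W(4), of m] Wb by (simp add: sets_m less_le_trans)
  have comp: "(\<lambda>(g, q). act g q) ` (W \<times> D) \<in> sets borel" if "compact D" for D
  proof -
    have "compact ((\<lambda>(g, q). act g q) ` (W \<times> D))"
      by (intro compact_continuous_image compact_Times W(1) that jointly_continuous_action_simps(7)[OF action])
    then show ?thesis by (intro borel_closed compact_imp_closed)
  qed
  define S0 where "S0 = (\<lambda>(g, q). act g q) ` (W \<times> C0)"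
  have S0b: "S0 \<in> sets borel" unfolding S0_def by (rule comp[OF C0(1)])
  define P where "P = {y. \<exists>l>0. (average m G act (indicator S0) y \<longlongrightarrow> l) at_top}"
  have ind: "indicator S0 \<in> borel_measurable borel" "\<And>y. \<bar>indicator S0 y :: real\<bar> \<le> 1"
    using S0b by (auto simp: indicator_def)
  have Pb: "P \<in> sets borel" unfolding P_def by (rule pointwise_ergodic_family_polish(1)[OF erg action ind])
  define N where "N = C0 - P"
  have Nb: "N \<in> sets borel" unfolding N_def using Pb C0(1) by (auto intro: borel_closed compact_imp_closed)
  have "emeasure \<rho> N = 0"
  proof (rule ccontr)
    assume "emeasure \<rho> N \<noteq> 0"
    then have "0 < emeasure \<rho> N" by (simp add: zero_less_iff_neq_zero)
    \<comment> \<open>Inner regularity yields a compact subset, whose product with \<open>W\<close>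
      is compact and hence Borel.\<close>
    also have "emeasure \<rho> N = (SUP K \<in> {K. K \<subseteq> N \<and> compact K}. emeasure \<rho> K)"
      by (rule inner_regular[OF sets_\<rho> _ Nb]) (use finite_measure.emeasure_finite[OF finite_\<rho>] in simp)
    finally obtain C' where C': "C' \<subseteq> N" "compact C'" "0 < emeasure \<rho> C'" unfolding less_SUP_iff by blast
    obtain \<eta> where \<eta>: "finite_measure \<eta>" "sets \<eta> = sets borel" "invariant_measure act \<eta>"
      and mass: "\<forall>S\<in>sets borel. \<forall>W\<in>sets borel. (\<forall>a\<in>W. \<forall>b\<in>W. - a + b \<in> U) \<longrightarrow>
      (\<integral>\<^sup>+p. \<integral>\<^sup>+g. indicator S (act g p) * (indicator W g * indicator Q p) \<partial>m \<partial>\<rho>) \<le> emeasure \<eta> S"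
    proof (rule invariant_measure_of_transversal[OF \<sigma> U K(1)])
      show "\<exists>k\<in>K. \<exists>q'\<in>Q. act g q = act k q'" if "q \<in> Q" for g q by (rule K(2)[OF that])
    qed (rule that)
    define S where "S = (\<lambda>(g, q). act g q) ` (W \<times> C')"
    have Sb: "S \<in> sets borel" unfolding S_def by (rule comp[OF C'(2)])
    have "emeasure \<eta> S = 0"
    proof (rule null_set_if_ergodic_null[OF action \<eta> Sb])
      fix \<kappa> :: "'y measure"
      assume \<kappa>: "prob_space \<kappa>" "sets \<kappa> = sets borel" "invariant_measure act \<kappa>" "ergodic_measure act \<kappa>"
      interpret K: prob_space \<kappa> by (rule \<kappa>(1))
      have sp: "space \<kappa> = UNIV" using sets_eq_imp_space_eq[OF \<kappa>(2)] by simp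
      have int: "(\<integral>y. indicator S0 y \<partial>\<kappa>) = measure \<kappa> S0"
        using Bochner_Integration.integral_indicator[of \<kappa> S0] by (simp add: sp)
      show "emeasure \<kappa> S = 0"
      proof (cases "0 < measure \<kappa> S0")
        case True
        then obtain E where E: "E \<in> sets borel" "E \<subseteq> P" "invariant_set act E" "AE y in \<kappa>. y \<in> E"
          using pointwise_ergodic_family_polish(2)[OF erg action ind \<kappa>] int unfolding P_def by auto
        \<comment> \<open>An invariant set that meets \<open>WC'\<close> meets \<open>C'\<close>,
          but \<open>C'\<close> lies outside \<open>P\<close>. Invariance of \<open>E\<close> is
          essential here, as \<open>P\<close> itself is not known to be invariant.\<close>
        have "S \<inter> E = {}"
        proof (rule ccontr)
          assume "S \<inter> E \<noteq> {}"
          then obtain g c where "c \<in> C'" "act g c \<in> E" unfolding S_def by auto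
          moreover have "acts_on act UNIV" using action by (simp add: jointly_continuous_action_def)
          ultimately have "c \<in> E" using invariant_set_iff[OF _ E(3)] by blast
          then show False using \<open>c \<in> C'\<close> C'(1) E(2) unfolding N_def by blast
        qed
        then have "AE y in \<kappa>. y \<notin> S" using E(4) by (auto elim!: eventually_mono)
        then show ?thesis using Sb by (subst (asm) AE_iff_measurable[of S]) (auto simp: sp \<kappa>(2))
      next
        case False
        then have "emeasure \<kappa> S0 = 0"
          using measure_nonneg[of \<kappa> S0] by (simp add: K.emeasure_eq_measure)
        moreover have "S \<subseteq> S0" unfolding S_def S0_def using C'(1) unfolding N_def by blast
        ultimately show ?thesis using emeasure_mono[of S S0 \<kappa>] S0b by (simp add: \<kappa>(2))
      qed
    qed
    \<comment> \<open>Each point of \<open>C'\<close> contributes the full Haar measure of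
      \<open>W\<close>, because \<open>W\<close> carries it into \<open>S\<close>.\<close>
    moreover have "emeasure m W * emeasure \<rho> C' \<le> emeasure \<eta> S"
    proof -
      have C'b: "C' \<in> sets \<rho>" using C'(2) by (auto simp: sets_\<rho> intro: borel_closed compact_imp_closed)
      have "emeasure m W * emeasure \<rho> C' = (\<integral>\<^sup>+p. emeasure m W * indicator C' p \<partial>\<rho>)"
        using C'b by (simp add: nn_integral_cmult_indicator)
      also have "\<dots> = (\<integral>\<^sup>+p. \<integral>\<^sup>+g. indicator C' p * indicator W g \<partial>m \<partial>\<rho>)"
        using Wb by (intro nn_integral_cong) (simp add: nn_integral_cmult_indicator sets_m mult.commute[of "emeasure m W"])
      also have "\<dots> \<le> (\<integral>\<^sup>+p. \<integral>\<^sup>+g. indicator S (act g p) * (indicator W g * indicator Q p) \<partial>m \<partial>\<rho>)"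
      proof (intro nn_integral_mono)
        fix p g
        have "act g p \<in> S \<and> p \<in> Q" if "p \<in> C'" "g \<in> W"
          unfolding S_def using that C'(1) C0(2) unfolding N_def by blast
        then show "(indicator C' p * indicator W g :: ennreal) \<le> indicator S (act g p) * (indicator W g * indicator Q p)"
          by (simp add: indicator_def)
      qed
      also have "\<dots> \<le> emeasure \<eta> S" by (rule mass[rule_format, OF Sb Wb]) (use W(6) in blast)
      finally show ?thesis .
    qed
    ultimately show False using Wpos C'(3) by auto
  qed
  moreover have "0 < lower_density m G {g. act g y \<in> C0}" if y: "y \<in> C0 - N" for y
  proof -
    obtain l where l: "(average m G act (indicator S0) y \<longlongrightarrow> l) at_top" "0 < l"
      using y unfolding N_def P_def by blast
    show ?thesis
    proof (rule lower_density_pos_if_average_pos[OF action G _ _ _ _ _ W(1) _ Wpos C0(1) l[unfolded S0_def]])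
      show "0 < t0 0" "0 < \<delta> 0" "0 < \<epsilon> 0" using pos by auto
      show "outer_set (V 0) (G t) \<subseteq> G (t + \<delta> 0)" if "t0 0 < t" for t using outer that by blast
      show "Limsup at_top (\<lambda>t. ereal (measure m (G (t + \<delta> 0)) / measure m (G t))) \<le> ereal (1 + \<epsilon> 0)"
        using growth by blast
      show "W \<subseteq> V 0" using W(5) by blast
    qed
  qed
  ultimately show thesis using that[OF Nb] by blast
qed

text \<open>Using \<open>L + L \<subseteq> L + F\<close> twice puts the threefold sum into
  \<open>L + (F + F)\<close>, a finite union of right translates of \<open>L\<close>. By uniform
  discreteness each of them meets a small \<open>V\<close> at most once, so \<open>V\<close>
  contains finitely many points of the threefold sum and the nonzero ones can be removed.
  Countability holds since countably many left translates of \<open>V\<close> cover the group and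
  each meets \<open>L\<close> at most once.\<close>

lemma (in unimodular_haar) approximate_lattice_return_times:
  assumes L: "uniform_approximate_lattice (L :: 'g set)"
  shows "countable L" "\<exists>U. open U \<and> 0 \<in> U \<and> (L + (L + L)) \<inter> U \<subseteq> {0}"
proof -
  have sym: "uminus ` L = L" using L unfolding uniform_approximate_lattice_def by auto
  obtain F U where F: "finite F" "L + L \<subseteq> L + F" and U: "open U" "0 \<in> U" "(L + uminus ` L) \<inter> U = {0}"
    using L unfolding uniform_approximate_lattice_def by auto
  have neg: "- a \<in> L" if "a \<in> L" for a using sym that by blast
  obtain W V where V: "open V" "(0::'g) \<in> V" "V \<subseteq> W" "\<And>a b. a \<in> W \<Longrightarrow> b \<in> W \<Longrightarrow> - a + b \<in> U"
    "\<And>a b. a \<in> W \<Longrightarrow> b \<in> W \<Longrightarrow> a - b \<in> U"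
    by (rule small_compact_neighbourhood[OF U(1,2)]) (rule that)
  have LL: "a + b = 0" if "a \<in> L" "b \<in> L" "a + b \<in> U" for a b
  proof -
    have "a + b \<in> L + uminus ` L" using that sym by (auto intro: set_plus_intro)
    then show ?thesis using U(3) that(3) by blast
  qed
  show "countable L"
  proof -
    obtain k :: "nat \<Rightarrow> 'g" where k: "(\<Union>n. (\<lambda>h. k n + h) ` V) = UNIV" by (rule countable_translates[OF V(1,2)]) (rule that)
    have "a = b" if a: "a \<in> L \<inter> (\<lambda>h. k n + h) ` V" and b: "b \<in> L \<inter> (\<lambda>h. k n + h) ` V" for a b n
    proof -
      obtain v v' where v: "a = k n + v" "b = k n + v'" "v \<in> V" "v' \<in> V" using a b by blast
      have "- a + b = - v + v'" unfolding v by (simp add: minus_add diff_conv_add_uminus add.assoc del: add_uminus_conv_diff)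
      then have "- a + b \<in> U" using V(3,4) v by auto
      then have "- a + b = 0" by (intro LL neg) (use a b in auto)
      then show ?thesis by (simp add: add_eq_0_iff)
    qed
    then have "L \<inter> (\<lambda>h. k n + h) ` V = {} \<or> (\<exists>a. L \<inter> (\<lambda>h. k n + h) ` V = {a})" for n by blast
    then have "countable (L \<inter> (\<lambda>h. k n + h) ` V)" for n by (metis countable_empty countable_insert)
    then have "countable (\<Union>n. L \<inter> (\<lambda>h. k n + h) ` V)" by (rule countable_UN[OF countableI_type])
    moreover have "(\<Union>n. L \<inter> (\<lambda>h. k n + h) ` V) = L" using k by blast
    ultimately show ?thesis by simp
  qed
  define F' where "F' = F + F"
  have F': "finite F'" unfolding F'_def by (rule finite_set_plus[OF F(1) F(1)])
  have "L + (L + L) \<subseteq> L + (L + F)" by (rule set_plus_mono2[OF subset_refl F(2)])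
  also have "\<dots> = (L + L) + F" by (simp add: add.assoc)
  also have "\<dots> \<subseteq> (L + F) + F" by (rule set_plus_mono2[OF F(2) subset_refl])
  also have "\<dots> = L + F'" by (simp add: F'_def add.assoc)
  finally have sub: "L + (L + L) \<subseteq> L + F'" .
  have fin: "finite (((\<lambda>a. a + f) ` L) \<inter> V)" for f
  proof -
    have "x = y" if x: "x \<in> ((\<lambda>a. a + f) ` L) \<inter> V" and y: "y \<in> ((\<lambda>a. a + f) ` L) \<inter> V" for x y
    proof -
      obtain a b where ab: "a \<in> L" "b \<in> L" "x = a + f" "y = b + f" using x y by blast
      have "x - y = a + - b" unfolding ab by (simp add: minus_add diff_conv_add_uminus add.assoc del: add_uminus_conv_diff)
      moreover have "x - y \<in> U" using x y V(3,5) by blast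
      ultimately have "a + - b = 0" by (intro LL neg ab) simp
      then show ?thesis using ab by simp
    qed
    then have "((\<lambda>a. a + f) ` L) \<inter> V = {} \<or> (\<exists>x. ((\<lambda>a. a + f) ` L) \<inter> V = {x})" by blast
    then show ?thesis by (metis finite.emptyI finite.insertI)
  qed
  have "(L + (L + L)) \<inter> V \<subseteq> (\<Union>f\<in>F'. ((\<lambda>a. a + f) ` L) \<inter> V)"
  proof
    fix x assume x: "x \<in> (L + (L + L)) \<inter> V"
    then have "x \<in> L + F'" using sub by blast
    then obtain a f where "a \<in> L" "f \<in> F'" "x = a + f" by (rule set_plus_elim) blast
    then show "x \<in> (\<Union>f\<in>F'. ((\<lambda>a. a + f) ` L) \<inter> V)" using x by blast
  qed
  then have finR: "finite ((L + (L + L)) \<inter> V)" by (rule finite_subset) (use F' fin in blast)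
  let ?U = "V - ((L + (L + L)) \<inter> V - {0})"
  have "open ?U" using finR V(1) by (intro open_Diff finite_imp_closed finite_Diff)
  moreover have "0 \<in> ?U" using V(2) by blast
  moreover have "(L + (L + L)) \<inter> ?U \<subseteq> {0}" by blast
  ultimately show "\<exists>U. open U \<and> 0 \<in> U \<and> (L + (L + L)) \<inter> U \<subseteq> {0}" by blast
qed

theorem theorem1p6:
  fixes m :: "'g::{topological_group_add, t2_space, second_countable_topology} measure"
    and act :: "'g \<Rightarrow> 'x::polish_space \<Rightarrow> 'x"
    and Z :: "'x set"
    and \<mu> \<nu> :: "'x measure"
    and r :: nat
    and G :: "real \<Rightarrow> 'g set"
  assumes "locally_compact_space (euclidean :: 'g topology)"
    and "unimodular_group TYPE('g)"
    and "haar_measure m"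
    and "jointly_continuous_action act"
    and "cross_section act Z"
    and "separated act Z"
    and "prob_space \<mu>"
    and "sets \<mu> = sets borel"
    and "invariant_measure act \<mu>"
    and "transverse_measure m act Z \<mu> \<nu>"
    and "r \<ge> 1"
    and "uniform_approximate_lattice (return_time_set act Z)"
    and "convenient_sequence m G"
  shows "AE z in (\<Pi>\<^sub>M i\<in>{1..r}. \<nu>).
           lower_density m G (\<Inter>i\<in>{1..r}. hitting_times act Z (z i)) > 0"
proof -
  note act = assms(4) and r = assms(11) and conv = assms(13)
  define L where "L = return_time_set act Z"
  define R where "R = L + (L + L)"
  have Zb: "Z \<in> sets borel" using assms(5) unfolding cross_section_def by blast
  have L: "0 \<in> L" "uminus ` L = L" "uniform_approximate_lattice L"
    using assms(12) unfolding uniform_approximate_lattice_def L_def by auto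
  obtain K where K: "compact K" "K + L = UNIV"
    using L(3) unfolding uniform_approximate_lattice_def by (elim conjE exE) (rule that)
  interpret H: unimodular_haar m by (rule unimodular_haar.intro[OF assms(1,2,3)])
  have Lc: "countable L" by (rule H.approximate_lattice_return_times(1)[OF L(3)])
  obtain U where U: "open U" "0 \<in> U" "R \<inter> U \<subseteq> {0}"
    using H.approximate_lattice_return_times(2)[OF L(3)] unfolding R_def[symmetric] by (elim conjE exE) (rule that)
  define l where "l = from_nat_into L"
  have l: "range l = L" unfolding l_def by (rule range_from_nat_into) (use L(1) Lc in auto)
  note s = jointly_continuous_action_simps(1-4)[OF act]
  have neg: "- a \<in> L" if "a \<in> L" for a using L(2) that by blast
  \<comment> \<open>\<open>- l j + (h + l i)\<close> takes a point of \<open>Z\<close> to a point of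
    \<open>Z\<close>, so it belongs to \<open>L\<close>; solving for \<open>h\<close> leaves a sum
    of three elements of the symmetric set \<open>L\<close>.\<close>
  have returnR: "h \<in> R" if "x \<in> Z" "z \<in> Z" "act h (act (l i) x) = act (l j) z" for h x z i j
  proof -
    have "act (- l j + (h + l i)) x = act (- l j) (act h (act (l i) x))" by (simp only: s(2))
    also have "\<dots> = z" unfolding that(3) by (rule s(3))
    finally have "- l j + (h + l i) \<in> L"
      using that(1,2) unfolding L_def return_time_set_def by blast
    moreover have "h = l j + ((- l j + (h + l i)) + - l i)"
      by (simp add: diff_conv_add_uminus add.assoc del: add_uminus_conv_diff)
    moreover have "l j \<in> L" "- l i \<in> L" using l neg by blast+
    ultimately show ?thesis unfolding R_def by (metis set_plus_intro)
  qed
  have Rc: "countable R"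
    unfolding R_def set_plus_image using Lc by (intro countable_image countable_SIGMA)
  have Rsym: "uminus ` R = R"
  proof -
    have sub: "uminus ` R \<subseteq> R"
    proof
      fix x assume "x \<in> uminus ` R"
      then obtain a b c where abc: "a \<in> L" "b \<in> L" "c \<in> L" "x = - (a + (b + c))"
        unfolding R_def by (auto elim!: set_plus_elim)
      have "x = - c + (- b + - a)" unfolding abc by (simp add: minus_add diff_conv_add_uminus add.assoc del: add_uminus_conv_diff)
      then show "x \<in> R" unfolding R_def using abc(1-3) neg by (metis set_plus_intro)
    qed
    moreover have "R \<subseteq> uminus ` R"
    proof
      fix x assume "x \<in> R"
      then have "- x \<in> R" using sub by blast
      then show "x \<in> uminus ` R" by (metis image_eqI minus_minus)
    qed
    ultimately show ?thesis by blast
  qed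
  interpret T: saturated_transversal m act Z \<mu> \<nu> l R U
  proof (intro saturated_transversal.intro saturated_transversal_axioms.intro transversal.intro transversal_axioms.intro)
    show "0 \<in> range l" using l L(1) by simp
  qed (fact H.unimodular_haar_axioms act Zb assms(7) assms(10) U returnR)+
  let ?da = "diagonal_action act"
  have da: "jointly_continuous_action ?da" by (rule diagonal_action_continuous[OF act])
  note ds = jointly_continuous_action_simps(1-4)[OF da]
  \<comment> \<open>\<open>\<rho>0\<close> carries the measure of the claim, while
    \<open>\<rho>\<close> is partially invariant on the larger set \<open>PP\<close>. Null sets pass
    from \<open>\<rho>\<close> to \<open>\<rho>0\<close>.\<close>
  define \<rho> where "\<rho> = distr (\<Pi>\<^sub>M i\<in>{1..r}. T.\<nu>P) borel (repeat_first r)"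
  define \<rho>0 where "\<rho>0 = distr (\<Pi>\<^sub>M i\<in>{1..r}. \<nu>) borel (repeat_first r)"
  define ZZ where "ZZ = {z :: nat \<Rightarrow> 'x. \<forall>i. z i \<in> Z}"
  define PP where "PP = {z :: nat \<Rightarrow> 'x. \<forall>i. z i \<in> T.P}"
  have ZZb: "ZZ \<in> sets borel" unfolding ZZ_def by (rule all_coordinates_borel[OF Zb])
  have em\<nu>: "repeat_first r \<in> (\<Pi>\<^sub>M i\<in>{1..r}. \<nu>) \<rightarrow>\<^sub>M borel"
    by (rule repeat_first_measurable[OF r T.id_measurable_\<nu>])
  have em\<nu>P: "repeat_first r \<in> (\<Pi>\<^sub>M i\<in>{1..r}. T.\<nu>P) \<rightarrow>\<^sub>M borel"
    by (rule repeat_first_measurable[OF r measurable_ident_sets[OF T.sets_\<nu>P]])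
  have finPi: "finite_measure (\<Pi>\<^sub>M i\<in>{1..r}. N)" if "finite_measure N" for N :: "'x measure"
  proof (rule finite_measureI)
    interpret N: finite_measure N by (rule that)
    interpret product_sigma_finite "\<lambda>_::nat. N" ..
    have "emeasure (\<Pi>\<^sub>M i\<in>{1..r}. N) (Pi\<^sub>E {1..r} (\<lambda>_. space N)) = (\<Prod>i\<in>{1..r}. emeasure N (space N))"
      by (rule emeasure_PiM) auto
    then show "emeasure (\<Pi>\<^sub>M i\<in>{1..r}. N) (space (\<Pi>\<^sub>M i\<in>{1..r}. N)) \<noteq> \<infinity>"
      by (simp add: space_PiM ennreal_prod_eq_top power_eq_top_ennreal)
  qed
  have fin\<rho>: "finite_measure \<rho>" unfolding \<rho>_def
    by (rule finite_measure.finite_measure_distr[OF finPi[OF T.finite_\<nu>P] em\<nu>P])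
  have fin\<rho>0: "finite_measure \<rho>0" unfolding \<rho>0_def
    by (rule finite_measure.finite_measure_distr[OF finPi[OF T.finite_\<nu>] em\<nu>])
  have sets\<rho>: "sets \<rho> = sets borel" "sets \<rho>0 = sets borel" unfolding \<rho>_def \<rho>0_def by simp_all
  have le: "emeasure \<rho>0 N \<le> emeasure \<rho> N" if "N \<in> sets borel" for N
    unfolding \<rho>_def \<rho>0_def
  proof (rule emeasure_product_le[OF r T.finite_\<nu>P T.sets_\<nu>P T.finite_\<nu> T.id_measurable_\<nu> T.space_\<nu> Zb _ T.Int_Z_sets that])
    fix A assume A: "A \<in> sets borel" "A \<subseteq> Z"
    then have "A \<inter> Z = A" by blast
    then show "emeasure \<nu> A = emeasure T.\<nu>P A"
      using T.emeasure_\<nu>P_Z[OF A] T.emeasure_\<nu>'[OF A(1)] by simp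
  qed
  have pinv: "partially_invariant ?da PP \<rho>"
    unfolding PP_def \<rho>_def
    by (rule partially_invariant_product[OF act r T.finite_\<nu>P T.sets_\<nu>P T.P_borel T.partially_invariant_\<nu>P])
  define good where "good y \<longleftrightarrow> 0 < lower_density m G {g. \<forall>i. act g (y i) \<in> Z}" for y :: "nat \<Rightarrow> 'x"
  have compact_case: "\<exists>N\<in>sets borel. emeasure \<rho>0 N = 0 \<and> (\<forall>y\<in>C0 - N. good y)"
    if C0: "compact C0" "C0 \<subseteq> ZZ" for C0
  proof -
    \<comment> \<open>\<open>Q\<close> is the saturation of \<open>C0\<close> by \<open>L\<close>
      under the diagonal action. Its return times are controlled by a single coordinate, so they lie
      in the same \<open>R\<close> for every \<open>r\<close>.\<close>
    define C where "C n = ?da (l n) ` C0" for n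
    define Q where "Q = (\<Union>n. C n)"
    have Cc: "compact (C n)" for n unfolding C_def
      by (rule compact_continuous_image[OF jointly_continuous_action_simps(5)[OF da] C0(1)])
    have Qb: "Q \<in> sets borel"
      unfolding Q_def using Cc by (intro sets.countable_UN) (auto intro: borel_closed compact_imp_closed)
    have QP: "Q \<subseteq> PP"
      unfolding Q_def C_def PP_def T.P_def diagonal_action_def using C0(2) unfolding ZZ_def by blast
    have ret: "h \<in> R" if x: "x \<in> Q" and hx: "?da h x \<in> Q" for h x
    proof -
      obtain i z where z: "z \<in> C0" "x = ?da (l i) z" using x unfolding Q_def C_def by blast
      obtain j z' where z': "z' \<in> C0" "?da h x = ?da (l j) z'" using hx unfolding Q_def C_def by blast
      have "act h (act (l i) (z 0)) = act (l j) (z' 0)"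
        using fun_cong[OF z'(2), of 0] unfolding z(2) diagonal_action_def .
      moreover have "z 0 \<in> Z" "z' 0 \<in> Z" using z(1) z'(1) C0(2) unfolding ZZ_def by auto
      ultimately show ?thesis using returnR by blast
    qed
    interpret S: suspension m ?da Q R \<rho>
    proof (intro suspension.intro suspension_axioms.intro)
      show "partially_invariant ?da Q \<rho>"
        by (rule partially_invariant_subset[OF pinv QP Qb jointly_continuous_action_measurable[OF da] ds(3,4)])
    qed (fact H.unimodular_haar_axioms da fin\<rho> sets\<rho>(1) Qb Rc Rsym ret)+
    \<comment> \<open>Cocompactness is applied to \<open>g + l i\<close> rather than to
      \<open>g\<close>, so that the factor in \<open>L\<close> acts directly on a point of
      \<open>C0\<close>.\<close>
    have KQ: "\<exists>k\<in>K. \<exists>q'\<in>Q. ?da g q = ?da k q'" if q: "q \<in> Q" for g q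
    proof -
      obtain i z where z: "z \<in> C0" "q = ?da (l i) z" using q unfolding Q_def C_def by blast
      have "g + l i \<in> K + L" using K(2) by simp
      then obtain k a where ka: "k \<in> K" "a \<in> L" "g + l i = k + a" by (rule set_plus_elim) blast
      then obtain j where j: "a = l j" using l by blast
      have "?da g q = ?da (g + l i) z" unfolding z(2) by (rule ds(2)[symmetric])
      also have "\<dots> = ?da k (?da (l j) z)" unfolding ka(3) j by (rule ds(2))
      finally have "?da g q = ?da k (?da (l j) z)" .
      moreover have "?da (l j) z \<in> Q" unfolding Q_def C_def using z(1) by blast
      ultimately show ?thesis using ka(1) by blast
    qed
    have C0Q: "C0 \<subseteq> Q"
    proof
      fix y assume "y \<in> C0"
      obtain n where n: "l n = 0" using l L(1) by (metis rangeE)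
      then have "y = ?da (l n) y" by (simp add: ds)
      then have "y \<in> C n" unfolding C_def using \<open>y \<in> C0\<close> by (rule image_eqI)
      then show "y \<in> Q" unfolding Q_def by blast
    qed
    obtain N where N: "N \<in> sets borel" "emeasure \<rho> N = 0"
      "\<And>y. y \<in> C0 - N \<Longrightarrow> 0 < lower_density m G {g. ?da g y \<in> C0}"
    proof (rule S.lower_density_pos[OF Cc Q_def U K(1) _ conv C0(1) C0Q])
      show "\<exists>k\<in>K. \<exists>q'\<in>Q. ?da g q = ?da k q'" if "q \<in> Q" for g q by (rule KQ[OF that])
    qed (rule that)
    have "good y" if "y \<in> C0 - N" for y
    proof -
      have "{g. ?da g y \<in> C0} \<subseteq> {g. \<forall>i. act g (y i) \<in> Z}"
        using C0(2) unfolding ZZ_def diagonal_action_def by auto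
      then show ?thesis unfolding good_def using N(3)[OF that] lower_density_mono less_le_trans by blast
    qed
    moreover have "emeasure \<rho>0 N = 0" using le[OF N(1)] N(2) by simp
    ultimately show ?thesis using N(1) by blast
  qed
  \<comment> \<open>Inner regularity exhausts \<open>ZZ\<close> by countably many compact subsets up
    to a null set, so their exceptional sets together still form a null set.\<close>
  have ireg: "emeasure \<rho>0 ZZ = (SUP K \<in> {K. K \<subseteq> ZZ \<and> compact K}. emeasure \<rho>0 K)"
    by (rule inner_regular[OF sets\<rho>(2) _ ZZb]) (use finite_measure.emeasure_finite[OF fin\<rho>0] in simp)
  have "{K. K \<subseteq> ZZ \<and> compact K} \<noteq> {}" by (intro CollectI ex_in_conv[THEN iffD1] exI[of _ "{}"]) simp
  then obtain f where f: "range f \<subseteq> emeasure \<rho>0 ` {K. K \<subseteq> ZZ \<and> compact K}" "emeasure \<rho>0 ZZ = (SUP n::nat. f n)"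
    using ennreal_SUP_countable_SUP[of "{K. K \<subseteq> ZZ \<and> compact K}" "emeasure \<rho>0"] ireg by metis
  have "\<forall>n. \<exists>K. K \<subseteq> ZZ \<and> compact K \<and> f n = emeasure \<rho>0 K" using f(1) by blast
  then obtain C where C: "\<And>n. C n \<subseteq> ZZ" "\<And>n. compact (C n)" "\<And>n. f n = emeasure \<rho>0 (C n)" by metis
  have Cb: "(\<Union>n. C n) \<in> sets \<rho>0"
    unfolding sets\<rho> using C(2) by (intro sets.countable_UN) (auto intro: borel_closed compact_imp_closed)
  have "emeasure \<rho>0 ZZ \<le> emeasure \<rho>0 (\<Union>n. C n)"
    unfolding f(2) C(3) by (intro SUP_least emeasure_mono[OF _ Cb]) blast
  then have "emeasure \<rho>0 (ZZ - (\<Union>n. C n)) = 0"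
    using emeasure_Diff[of \<rho>0 "\<Union>n. C n" ZZ] finite_measure.emeasure_finite[OF fin\<rho>0] Cb ZZb C(1)
    by (simp add: sets\<rho> UN_least diff_eq_0_iff_ennreal less_top)
  then have n1: "ZZ - (\<Union>n. C n) \<in> null_sets \<rho>0" using ZZb Cb by (auto simp: null_sets_def sets\<rho>)
  have "\<forall>n. \<exists>N\<in>sets borel. emeasure \<rho>0 N = 0 \<and> (\<forall>y\<in>C n - N. good y)" using compact_case C(1,2) by blast
  then obtain N where N: "\<And>n. N n \<in> sets borel" "\<And>n. emeasure \<rho>0 (N n) = 0" "\<And>n y. y \<in> C n - N n \<Longrightarrow> good y" by metis
  have n2: "(\<Union>n. N n) \<in> null_sets \<rho>0" using N(1,2) by (intro null_sets_UN) (auto simp: null_sets_def sets\<rho>)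
  have AE0: "AE y in \<rho>0. y \<in> ZZ \<longrightarrow> good y"
    using AE_not_in[OF n1] AE_not_in[OF n2] by eventually_elim (use N(3) in blast)
  have "AE z in (\<Pi>\<^sub>M i\<in>{1..r}. \<nu>). repeat_first r z \<in> ZZ \<longrightarrow> good (repeat_first r z)"
    using AE_distrD[OF em\<nu> AE0[unfolded \<rho>0_def]] .
  then show ?thesis
  proof (rule AE_mp, intro AE_I2 impI)
    fix z assume z: "z \<in> space (\<Pi>\<^sub>M i\<in>{1..r}. \<nu>)" and *: "repeat_first r z \<in> ZZ \<longrightarrow> good (repeat_first r z)"
    have "\<forall>i\<in>{1..r}. z i \<in> Z" using z by (auto simp: space_PiM T.space_\<nu> PiE_iff)
    then have "repeat_first r z \<in> ZZ" unfolding ZZ_def using all_repeat_first[OF r, of "\<lambda>x. x \<in> Z" z] by simp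
    then have "good (repeat_first r z)" using * by blast
    moreover have "{g. \<forall>i. act g (repeat_first r z i) \<in> Z} = (\<Inter>i\<in>{1..r}. hitting_times act Z (z i))"
      using all_repeat_first[OF r, of "\<lambda>x. act _ x \<in> Z" z] unfolding hitting_times_def by auto
    ultimately show "0 < lower_density m G (\<Inter>i\<in>{1..r}. hitting_times act Z (z i))" unfolding good_def by simp
  qed
qed

end
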